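(* Let $s,L>0$ be fixed ($m$ and $B$ may depend on $n$). Put $$\eta=\Big(\big\lfloor\big(n(\log_2 n)^{2s}/B^{1+2s}\big)^{\frac1{2+2s}}\big\rfloor\wedge m\Big)\vee 1,\qquad \mu_{jk}=\big\lceil(2^j+k)\lfloor B/\log_2 n\rfloor^{-1}\big\rceil-1,$$ and $K_n=(\eta\lfloor B/\log_2 n\rfloor)\wedge(n/\log_2 n)^{1/(1+2s)}$. Let $\hat f$ be the following distributed estimator: for $\ell=1,\dots,\eta$, each machine $i$ with $\lfloor(\ell-1)m/\eta\rfloor+1\le i\le\lfloor\ell m/\eta\rfloor$ transmits $Y^{(i)}_{jk}=\mathrm{TransApprox}(\hat f^{(i)}_{jk})$ for all $(j,k)$ with $(\ell-1)\lfloor B/\log_2 n\rfloor<2^j+k\le\ell\lfloor B/\log_2 n\rfloor$ and $2^j+k\le (n/\log_2 n)^{1/(1+2s)}$; the central machine forms $\hat f=\sum_{j,k}\hat f_{jk}\psi_{jk}$, where $\hat f_{jk}$ is the average of $\{Y^{(i)}_{jk}:\ \mu_{jk}m/\eta<i\le(\mu_{jk}+1)m/\eta\}$ if $2^j+k\le K_n$, and $\hat f_{jk}=0$ otherwise. Then (for $n$ large enough) in each of the following two cases $\hat f\in\mathcal F_{dist}(B,\dots,B;B^s_{\infty,\infty}(L))$, and: - if $B\ge n^{1/(1+2s)}(\log_2 n)^{2s/(1+2s)}$, then $$\sup_{f_0\in B^s_{\infty,\infty}(L)}\mathbb E_{f_0,T}\|\hat f-f_0\|_\infty\lesssim(n/\log_2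 n)^{-\frac{s}{1+2s}};$$ - if $\big(n(\log_2 n)/m^{2+2s}\big)^{1/(1+2s)}\vee\log_2 n\le B<n^{1/(1+2s)}(\log_2 n)^{2s/(1+2s)}$, then $$\sup_{f_0\in B^s_{\infty,\infty}(L)}\mathbb E_{f_0,T}\|\hat f-f_0\|_\infty\lesssim M_n\Big(\frac{n^{\frac1{1+2s}}}{B(\log_2 n)^{\frac{3+4s}{1+2s}}}\Big)^{\frac{s}{2+2s}}(n/\log_2 n)^{-\frac{s}{1+2s}},\qquad M_n=(\log_2 n)^{s\vee\frac{3s}{2+2s}} .$$
   Context: Model. The total sample size is $n$ and there are $m=m_n$ local machines with $n/m\in\mathbb N$. Machine $i\in\{1,\dots,m\}$ observes pairs $(T^{(i)}_\ell,X^{(i)}_\ell)$, $\ell=1,\dots,n/m$, with $X^{(i)}_\ell=f_0(T^{(i)}_\ell)+\sigma\varepsilon^{(i)}_\ell$, where the $T^{(i)}_\ell$ are iid uniform on $(0,1)$, the $\varepsilon^{(i)}_\ell$ are iid $N(0,1)$, independent of the design, $\sigma>0$ is fixed and $f_0\in L_2[0,1]$ is unknown and common to all machines. $\mathbb E_{f_0,T}$ is expectation under the joint law of all data. Distributed estimators. Machine $i$ sends to a central machine a finite binary string $Y^{(i)}$ which is a measurable function of its local data; $l(Y)$ denotes the length of a string $Y$. For $\mathcal F\subset L_2[0,1]$, $\mathcal F_{dist}(B^{(1)},\dots,B^{(m)};\mathcal F)$ is the class of estimators $\hat f$ that are measurable functions of $(Y^{(1)},\dots,Y^{(m)})$ for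 such strings satisfying $\mathbb E_{f_0,T}[l(Y^{(i)})]\le B^{(i)}$ for all $f_0\in\mathcal F$ and all $i$. Wavelets and Besov balls. $\psi_{jk}$ ($j\ge 0$, $0\le k\le 2^j-1$) is a Cohen–Daubechies–Vial compactly supported orthonormal wavelet basis of $L_2[0,1]$ with $N>s$ vanishing moments (coarsest-level scaling functions included in the indexing), $f_{jk}=\langle f,\psi_{jk}\rangle$, $\|f\|_{B^s_{\infty,\infty}}=\sup_{j,k}2^{j(s+1/2)}|f_{jk}|$ and $B^s_{\infty,\infty}(L)=\{f\in L_2[0,1]:\|f\|_{B^s_{\infty,\infty}}<L\}$. Local estimators: $\hat f^{(i)}_{jk}=\frac mn\sum_{\ell=1}^{n/m}X^{(i)}_\ell\psi_{jk}(T^{(i)}_\ell)$. TransApprox. For $x\in\mathbb R$ with binary expansion $|x|=\sum_{k=-\infty}^{\lfloor\log_2|x|\rfloor}b_k2^k$, $b_k\in\{0,1\}$, $\mathrm{TransApprox}(x)$ transmits the sign bit of $x$ and the digits $b_k$ with $-D\log_2 n\le k\le\log_2|x|$, where $D=1/2$; this encodes the number $y$ having the same sign as $x$ and $|y|=\sum_{-D\log_2 n\le k\le\log_2|x|}b_k2^k$. Its length in bits is at most $1+(1\vee\log_2|x|)+D\log_2 n$. The symbol $Y^{(i)}_{jk}$ is used both for the bit string and for the number $y$ it encodes. Notation. $a\wedge b=\min(a,b)$, $a\vee b=\max(a,b)$. For positive sequences, $a_n\lesssim b_n$ means $a_n\le Cb_n$ for all sufficiently large $n$ with a constant $C>0$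 not depending on $n$ (it may depend on fixed quantities such as $s,L,\sigma$ and the wavelet basis). *)

theory Defs
  imports "HOL-Probability.Probability"
begin

section \<open>Square integrable functions on the unit interval\<close>

text \<open>Elements of \<open>L\<^sub>2[0,1]\<close> are given by Borel representatives on the real line; the values
  outside \<open>[0,1]\<close> are irrelevant, and every notion below only depends on the almost everywhere
  class of the restriction to \<open>[0,1]\<close>.\<close>

definition l2_unit :: "(real \<Rightarrow> real) set" where
  "l2_unit = {f \<in> borel_measurable borel. set_integrable lborel {0..1} (\<lambda>x. (f x)\<^sup>2)}"

definition inner_unit :: "(real \<Rightarrow> real) \<Rightarrow> (real \<Rightarrow> real) \<Rightarrow> real" where
  "inner_unit f g = set_lebesgue_integral lborel {0..1} (\<lambda>x. f x * g x)"

definition sup_norm_unit :: "(real \<Rightarrow> real) \<Rightarrow> ennreal" where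
  "sup_norm_unit f = esssup (restrict_space lborel {0..1}) (\<lambda>x. ennreal \<bar>f x\<bar>)"

section \<open>Cohen--Daubechies--Vial wavelets\<close>

text \<open>Daubechies' father and mother wavelet with \<open>N\<close> vanishing moments, placed so that both are
  supported in \<open>[1 - N, N]\<close>. The filter \<open>h\<close> has the minimal length \<open>2N\<close>. Boundedness and
  \<open>\<integral>\<phi> = 1\<close> select the usual representative and sign.\<close>

definition daubechies_pair :: "nat \<Rightarrow> (real \<Rightarrow> real) \<Rightarrow> (real \<Rightarrow> real) \<Rightarrow> bool" where
  "daubechies_pair N \<phi> \<psi> \<longleftrightarrow>
     N \<ge> 1 \<and> \<phi> \<in> borel_measurable borel \<and> bounded (range \<phi>) \<and>
     (\<forall>x. x \<notin> {1 - real N..real N} \<longrightarrow> \<phi> x = 0) \<and>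
     (LBINT x. \<phi> x) = 1 \<and>
     (\<forall>k::int. (LBINT x. \<phi> x * \<phi> (x - of_int k)) = of_bool (k = 0)) \<and>
     (\<exists>h :: int \<Rightarrow> real.
        (\<forall>x. \<phi> x = sqrt 2 * (\<Sum>k = 1 - int N..int N. h k * \<phi> (2 * x - of_int k))) \<and>
        (\<forall>x. \<psi> x = sqrt 2 * (\<Sum>k = 1 - int N..int N.
                     (if even k then 1 else -1) * h (1 - k) * \<phi> (2 * x - of_int k)))) \<and>
     (\<forall>p<N. (LBINT x. x ^ p * \<psi> x) = 0)"

text \<open>Edge functions on the half line \<open>[0,\<infinity>)\<close>. The interior translates \<open>\<phi>(\<cdot> - k)\<close>, \<open>k \<ge> N\<close>, are
  kept. The remaining ones are replaced by \<open>N\<close> combinations, cut off at \<open>0\<close>, which restore the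
  polynomials of degree below \<open>N\<close>.\<close>

definition edge_poly :: "nat \<Rightarrow> (real \<Rightarrow> real) \<Rightarrow> nat \<Rightarrow> real \<Rightarrow> real" where
  "edge_poly N \<phi> i x =
     indicator {0..} x * (\<Sum>r = i..2 * N - 2. real (r choose i) * \<phi> (x + real r - real N + 1))"

text \<open>\<open>edge_poly N \<phi> i\<close> is supported in \<open>[0, 2N - 1 - i]\<close>. Gram--Schmidt starts from the smallest
  support, so that the \<open>k\<close>-th edge function is supported in \<open>[0, N + k]\<close>.\<close>

definition edge_scaling :: "nat \<Rightarrow> (real \<Rightarrow> real) \<Rightarrow> (nat \<Rightarrow> real \<Rightarrow> real) \<Rightarrow> bool" where
  "edge_scaling N \<phi> e \<longleftrightarrow>
     (\<exists>A :: nat \<Rightarrow> nat \<Rightarrow> real. \<forall>k<N. \<forall>x. e k x = (\<Sum>i = N - 1 - k..<N. A k i * edge_poly N \<phi> i x)) \<and>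
     (\<forall>k<N. \<forall>l<N. (LBINT x. e k x * e l x) = of_bool (k = l))"

text \<open>The edge wavelets span the part of \<open>V\<^sub>1\<close> (on the half line) orthogonal to \<open>V\<^sub>0\<close> and to the
  interior wavelets; the \<open>k\<close>-th one is again supported in \<open>[0, N + k]\<close>.\<close>

definition edge_wavelet ::
  "nat \<Rightarrow> (real \<Rightarrow> real) \<Rightarrow> (real \<Rightarrow> real) \<Rightarrow> (nat \<Rightarrow> real \<Rightarrow> real) \<Rightarrow> (nat \<Rightarrow> real \<Rightarrow> real) \<Rightarrow> bool" where
  "edge_wavelet N \<phi> \<psi> e w \<longleftrightarrow>
     (\<exists>G H :: nat \<Rightarrow> nat \<Rightarrow> real. \<forall>k<N. \<forall>x.
        w k x = sqrt 2 * ((\<Sum>l<N. G k l * e l (2 * x)) +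
                          (\<Sum>r = N..N + 2 * k. H k r * \<phi> (2 * x - real r)))) \<and>
     (\<forall>k<N. \<forall>l<N. (LBINT x. w k x * w l x) = of_bool (k = l)) \<and>
     (\<forall>k<N. \<forall>l<N. (LBINT x. w k x * e l x) = 0) \<and>
     (\<forall>k<N. \<forall>r\<ge>N. (LBINT x. w k x * \<phi> (x - real r)) = 0 \<and> (LBINT x. w k x * \<psi> (x - real r)) = 0)"

text \<open>The \<open>2 ^ j\<close> functions of level \<open>j\<close> on \<open>[0,1]\<close>, from left to right, made of an interior function
  \<open>g\<close>, left edge functions \<open>u\<close> and right edge functions \<open>v\<close>. The latter live on the half line
  after the reflection \<open>x \<mapsto> 1 - x\<close>.\<close>

definition level_family ::
  "nat \<Rightarrow> (real \<Rightarrow> real) \<Rightarrow> (nat \<Rightarrow> real \<Rightarrow> real) \<Rightarrow> (nat \<Rightarrow> real \<Rightarrow> real) \<Rightarrow> nat \<Rightarrow> nat \<Rightarrow> real \<Rightarrow> real" where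
  "level_family N g u v j k x = 2 powr (real j / 2) *
     (if k < N then u k (2 ^ j * x)
      else if k < 2 ^ j - N then g (2 ^ j * x - real k)
      else v (2 ^ j - 1 - k) (2 ^ j * (1 - x)))"

text \<open>Indexing. The basis consists of the \<open>2 ^ j0\<close> scaling functions of the coarsest level \<open>j0\<close> and of
  \<open>2 ^ j\<close> wavelets on each level \<open>j \<ge> j0\<close>, and \<open>(j,k) \<mapsto> 2 ^ j + k\<close> enumerates the index pairs by
  the positive integers. There are only \<open>2 ^ j0 - 1\<close> pairs with \<open>j < j0\<close>, one fewer than scaling
  functions. The last scaling function therefore occupies \<open>(j0,0)\<close>, and the leftmost wavelet of
  each level \<open>j\<close> occupies \<open>(j + 1,0)\<close>; all other wavelets keep their own level and location.\<close>

definition cdv_index ::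
  "nat \<Rightarrow> (nat \<Rightarrow> real \<Rightarrow> real) \<Rightarrow> (nat \<Rightarrow> nat \<Rightarrow> real \<Rightarrow> real) \<Rightarrow> nat \<Rightarrow> nat \<Rightarrow> real \<Rightarrow> real" where
  "cdv_index j0 scal wav j k =
     (if j < j0 then scal (2 ^ j + k - 1)
      else if k > 0 then wav j k
      else if j = j0 then scal (2 ^ j0 - 1)
      else wav (j - 1) 0)"

definition orthonormal_basis_unit :: "(nat \<Rightarrow> nat \<Rightarrow> real \<Rightarrow> real) \<Rightarrow> bool" where
  "orthonormal_basis_unit \<psi> \<longleftrightarrow>
     (\<forall>j k. k < 2 ^ j \<longrightarrow> \<psi> j k \<in> l2_unit) \<and>
     (\<forall>j k j' k'. k < 2 ^ j \<longrightarrow> k' < 2 ^ j' \<longrightarrow>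
        inner_unit (\<psi> j k) (\<psi> j' k') = of_bool (j = j' \<and> k = k')) \<and>
     (\<forall>f\<in>l2_unit. (\<forall>j k. k < 2 ^ j \<longrightarrow> inner_unit f (\<psi> j k) = 0) \<longrightarrow>
        (AE x in lborel. x \<in> {0..1} \<longrightarrow> f x = 0))"

definition cdv_wavelet_basis :: "nat \<Rightarrow> (nat \<Rightarrow> nat \<Rightarrow> real \<Rightarrow> real) \<Rightarrow> bool" where
  "cdv_wavelet_basis N \<psi> \<longleftrightarrow>
     (\<exists>j0 father mother eL wL eR wR.
        2 * N \<le> 2 ^ j0 \<and>
        daubechies_pair N father mother \<and>
        edge_scaling N father eL \<and>
        edge_wavelet N father mother eL wL \<and>
        edge_scaling N (\<lambda>y. father (1 - y)) eR \<and>
        edge_wavelet N (\<lambda>y. father (1 - y)) (\<lambda>y. mother (1 - y)) eR wR \<and>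
        (\<forall>j k. k < 2 ^ j \<longrightarrow>
           \<psi> j k = cdv_index j0 (level_family N father eL eR j0) (level_family N mother wL wR) j k)) \<and>
     orthonormal_basis_unit \<psi>"

definition besov_norm :: "real \<Rightarrow> (nat \<Rightarrow> nat \<Rightarrow> real \<Rightarrow> real) \<Rightarrow> (real \<Rightarrow> real) \<Rightarrow> ennreal" where
  "besov_norm s \<psi> f =
     (SUP (j, k) \<in> {(j, k). k < 2 ^ j}. ennreal (2 powr (real j * (s + 1/2)) * \<bar>inner_unit f (\<psi> j k)\<bar>))"

definition besov_ball :: "real \<Rightarrow> (nat \<Rightarrow> nat \<Rightarrow> real \<Rightarrow> real) \<Rightarrow> real \<Rightarrow> (real \<Rightarrow> real) set" where
  "besov_ball s \<psi> L = {f \<in> l2_unit. besov_norm s \<psi> f < ennreal L}"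

section \<open>Distributed regression model\<close>

text \<open>Each observation is a pair \<open>(T, X)\<close>; \<open>r\<close> is the local sample size \<open>n / m\<close>.\<close>

type_synonym local_data = "nat \<Rightarrow> real \<times> real"
type_synonym full_data = "nat \<Rightarrow> local_data"

definition obs_law :: "real \<Rightarrow> (real \<Rightarrow> real) \<Rightarrow> (real \<times> real) measure" where
  "obs_law \<sigma> f =
     distr (uniform_measure lborel {0<..<1} \<Otimes>\<^sub>M density lborel std_normal_density)
       (borel \<Otimes>\<^sub>M borel) (\<lambda>(t, e). (t, f t + \<sigma> * e))"

definition data_law :: "real \<Rightarrow> nat \<Rightarrow> nat \<Rightarrow> (real \<Rightarrow> real) \<Rightarrow> full_data measure" where
  "data_law \<sigma> m r f = (\<Pi>\<^sub>M i\<in>{1..m}. \<Pi>\<^sub>M l\<in>{1..r}. obs_law \<sigma> f)"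

definition local_space :: "nat \<Rightarrow> local_data measure" where
  "local_space r = (\<Pi>\<^sub>M l\<in>{1..r}. borel \<Otimes>\<^sub>M borel)"

text \<open>A message is a finite binary string, i.e. a value of type \<open>bool list\<close> with the discrete
  \<open>\<sigma>\<close>-algebra. Expectations of nonnegative quantities are taken in \<open>[0,\<infinity>]\<close>.\<close>

definition dist_estimators ::
  "real \<Rightarrow> nat \<Rightarrow> nat \<Rightarrow> (nat \<Rightarrow> real) \<Rightarrow> (real \<Rightarrow> real) set \<Rightarrow> (full_data \<Rightarrow> real \<Rightarrow> real) set" where
  "dist_estimators \<sigma> m r B F = {est.
     \<exists>(Y :: nat \<Rightarrow> local_data \<Rightarrow> bool list) (g :: (nat \<Rightarrow> bool list) \<Rightarrow> real \<Rightarrow> real).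
       (\<forall>i\<in>{1..m}. Y i \<in> measurable (local_space r) (count_space UNIV)) \<and>
       (\<forall>f\<in>F. \<forall>i\<in>{1..m}.
          (\<integral>\<^sup>+ d. of_nat (length (Y i (d i))) \<partial>data_law \<sigma> m r f) \<le> ennreal (B i)) \<and>
       (\<lambda>(y, x). g y x) \<in> borel_measurable ((\<Pi>\<^sub>M i\<in>{1..m}. count_space UNIV) \<Otimes>\<^sub>M borel) \<and>
       (\<forall>d\<in>space (\<Pi>\<^sub>M i\<in>{1..m}. local_space r). est d = g (\<lambda>i\<in>{1..m}. Y i (d i)))}"

definition sup_risk ::
  "real \<Rightarrow> nat \<Rightarrow> nat \<Rightarrow> (full_data \<Rightarrow> real \<Rightarrow> real) \<Rightarrow> (real \<Rightarrow> real) set \<Rightarrow> ennreal" where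
  "sup_risk \<sigma> m r est F =
     (SUP f\<in>F. \<integral>\<^sup>+ d. sup_norm_unit (\<lambda>x. est d x - f x) \<partial>data_law \<sigma> m r f)"

section \<open>TransApprox\<close>

text \<open>The digits \<open>b\<^sub>k\<close> are those of the terminating expansion in case \<open>\<bar>x\<bar>\<close> is a dyadic rational.
  The string consists of the sign bit followed by the digits in increasing order of \<open>k\<close>, from
  \<open>lowest_digit n\<close> (this is \<open>-D log\<^sub>2 n\<close> rounded up, for \<open>D = 1/2\<close>) to \<open>\<lfloor>log\<^sub>2 \<bar>x\<bar>\<rfloor>\<close>. For
  \<open>x = 0\<close> there are no digits, in accordance with \<open>log\<^sub>2 0 = -\<infinity>\<close>.\<close>

definition binary_digit :: "real \<Rightarrow> int \<Rightarrow> bool" where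
  "binary_digit x k \<longleftrightarrow> odd \<lfloor>\<bar>x\<bar> / 2 powi k\<rfloor>"

definition lowest_digit :: "nat \<Rightarrow> int" where
  "lowest_digit n = \<lceil>- (1/2) * log 2 (real n)\<rceil>"

definition trans_approx :: "nat \<Rightarrow> real \<Rightarrow> bool list" where
  "trans_approx n x =
     (x < 0) # (if x = 0 then [] else map (binary_digit x) [lowest_digit n..\<lfloor>log 2 \<bar>x\<bar>\<rfloor>])"

definition decode :: "nat \<Rightarrow> bool list \<Rightarrow> real" where
  "decode n bs = (if hd bs then -1 else 1) *
     (\<Sum>i<length (tl bs). of_bool (tl bs ! i) * 2 powi (lowest_digit n + int i))"

section \<open>The estimator\<close>

definition block_size :: "nat \<Rightarrow> real \<Rightarrow> nat" where
  "block_size n B = nat \<lfloor>B / log 2 (real n)\<rfloor>"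

definition eta :: "real \<Rightarrow> nat \<Rightarrow> nat \<Rightarrow> real \<Rightarrow> nat" where
  "eta s n m B = max (min (nat \<lfloor>(real n * log 2 (real n) powr (2 * s) / B powr (1 + 2 * s))
                                 powr (1 / (2 + 2 * s))\<rfloor>) m) 1"

definition max_index :: "real \<Rightarrow> nat \<Rightarrow> real" where
  "max_index s n = (real n / log 2 (real n)) powr (1 / (1 + 2 * s))"

definition cutoff :: "real \<Rightarrow> nat \<Rightarrow> nat \<Rightarrow> real \<Rightarrow> real" where
  "cutoff s n m B = min (real (eta s n m B * block_size n B)) (max_index s n)"

definition mu :: "nat \<Rightarrow> real \<Rightarrow> nat \<Rightarrow> nat \<Rightarrow> int" where
  "mu n B j k = \<lceil>real (2 ^ j + k) * inverse (real (block_size n B))\<rceil> - 1"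

definition local_coeff ::
  "(nat \<Rightarrow> nat \<Rightarrow> real \<Rightarrow> real) \<Rightarrow> nat \<Rightarrow> nat \<Rightarrow> local_data \<Rightarrow> nat \<Rightarrow> nat \<Rightarrow> real" where
  "local_coeff \<psi> n m d j k = real m / real n * (\<Sum>l = 1..n div m. snd (d l) * \<psi> j k (fst (d l)))"

text \<open>Machine \<open>i\<close> transmits an approximation of the coefficient with index \<open>(j,k)\<close>. Here \<open>div\<close> is
  the floor of the quotient.\<close>

definition transmits :: "real \<Rightarrow> nat \<Rightarrow> nat \<Rightarrow> real \<Rightarrow> nat \<Rightarrow> nat \<Rightarrow> nat \<Rightarrow> bool" where
  "transmits s n m B i j k \<longleftrightarrow> k < 2 ^ j \<and>
     (\<exists>l\<in>{1..eta s n m B}.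
        ((l - 1) * m) div eta s n m B + 1 \<le> i \<and> i \<le> (l * m) div eta s n m B \<and>
        (l - 1) * block_size n B < 2 ^ j + k \<and> 2 ^ j + k \<le> l * block_size n B) \<and>
     real (2 ^ j + k) \<le> max_index s n"

text \<open>The number encoded by the string which machine \<open>i\<close> sends for \<open>(j,k)\<close>. The value \<open>0\<close> for
  coefficients that are not sent is a mere convention.\<close>

definition received ::
  "real \<Rightarrow> (nat \<Rightarrow> nat \<Rightarrow> real \<Rightarrow> real) \<Rightarrow> nat \<Rightarrow> nat \<Rightarrow> real \<Rightarrow> full_data \<Rightarrow> nat \<Rightarrow> nat \<Rightarrow> nat \<Rightarrow> real" where
  "received s \<psi> n m B d i j k =
     (if transmits s n m B i j k then decode n (trans_approx n (local_coeff \<psi> n m (d i) j k)) else 0)"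

definition averaged :: "real \<Rightarrow> nat \<Rightarrow> nat \<Rightarrow> real \<Rightarrow> nat \<Rightarrow> nat \<Rightarrow> nat set" where
  "averaged s n m B j k = {i \<in> {1..m}.
     of_int (mu n B j k) * real m / real (eta s n m B) < real i \<and>
     real i \<le> (of_int (mu n B j k) + 1) * real m / real (eta s n m B)}"

definition est_coeff ::
  "real \<Rightarrow> (nat \<Rightarrow> nat \<Rightarrow> real \<Rightarrow> real) \<Rightarrow> nat \<Rightarrow> nat \<Rightarrow> real \<Rightarrow> full_data \<Rightarrow> nat \<Rightarrow> nat \<Rightarrow> real" where
  "est_coeff s \<psi> n m B d j k =
     (if real (2 ^ j + k) \<le> cutoff s n m B
      then (\<Sum>i\<in>averaged s n m B j k. received s \<psi> n m B d i j k) / real (card (averaged s n m B j k))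
      else 0)"

text \<open>The sum runs over the finitely many indices whose coefficient is not set to zero.\<close>

definition estimator ::
  "real \<Rightarrow> (nat \<Rightarrow> nat \<Rightarrow> real \<Rightarrow> real) \<Rightarrow> nat \<Rightarrow> nat \<Rightarrow> real \<Rightarrow> full_data \<Rightarrow> real \<Rightarrow> real" where
  "estimator s \<psi> n m B d x =
     (\<Sum>(j, k) \<in> {(j, k). k < 2 ^ j \<and> real (2 ^ j + k) \<le> cutoff s n m B}.
        est_coeff s \<psi> n m B d j k * \<psi> j k x)"

section \<open>Rates\<close>

definition threshold :: "real \<Rightarrow> nat \<Rightarrow> real" where
  "threshold s n = real n powr (1 / (1 + 2 * s)) * log 2 (real n) powr (2 * s / (1 + 2 * s))"

definition minimax_rate :: "real \<Rightarrow> nat \<Rightarrow> real" where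
  "minimax_rate s n = (real n / log 2 (real n)) powr (- s / (1 + 2 * s))"

definition log_factor :: "real \<Rightarrow> nat \<Rightarrow> real" where
  "log_factor s n = log 2 (real n) powr (max s (3 * s / (2 + 2 * s)))"

end

theory Submission
  imports Defs
begin

text \<open>The only property of the wavelets that matters, besides orthonormality and completeness, is
  \<open>\<Sum>\<^sub>k \<bar>\<psi>\<^sub>j\<^sub>k\<bar> \<le> C 2\<^sup>j\<^sup>/\<^sup>2\<close>. It bounds the sup norm of the coefficients beyond the cutoff \<open>K\<close> by
  a multiple of \<open>K powr (- s)\<close>, and the error of the kept coefficients by \<open>4 C sqrt K\<close> times their
  largest deviation. A kept coefficient is averaged over at least \<open>n / (2 eta)\<close> observations, and its
  moment generating function is sub-Gaussian in the relevant range; hence the expected largest deviation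
  is of order \<open>sqrt (eta log\<^sub>2 n / n)\<close>, which also absorbs the digits lost in \<open>trans_approx\<close>. The
  value of \<open>eta\<close> balances \<open>K powr (- s)\<close> against \<open>sqrt (K eta log\<^sub>2 n / n)\<close>. A transmitted coefficient
  takes about \<open>(log\<^sub>2 n) / 2\<close> bits, which leaves room for a self-delimiting code within the
  budget \<open>B\<close>.\<close>

section \<open>Level sums of the wavelets\<close>

text \<open>\<open>\<rho> = sqrt (K * eta * log\<^sub>2 n / n)\<close> acts twice. It is the order
  of the stochastic error, and it decides whether that error is sub-Gaussian in the range required:
  controlling up to n coefficients at once forces an exponent per observation of order
  \<open>sqrt (eta * log\<^sub>2 n / n)\<close>, the kept wavelets reach size
  \<open>C * sqrt K\<close>, and the product has to stay below a constant. So the smallness of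
  \<rho> that makes the error vanish is also the condition under which it is estimated, and it holds
  for all large n uniformly in m and B. Everything before the final limit is therefore stated for
  fixed n with explicit constants.

  On the communication side only the expected length is constrained. A local coefficient has a first
  absolute moment bounded independently of its level, so unusually large values cost only a bounded
  number of extra bits per coefficient on average.\<close>

definition bdd_fun :: "(real \<Rightarrow> real) \<Rightarrow> bool" where
  "bdd_fun g \<longleftrightarrow> (\<exists>M. \<forall>x. \<bar>g x\<bar> \<le> M)"

lemma bdd_fun_const: "bdd_fun (\<lambda>x. c)"
  by (auto simp: bdd_fun_def)

lemma bdd_fun_add: "bdd_fun f \<Longrightarrow> bdd_fun g \<Longrightarrow> bdd_fun (\<lambda>x. f x + g x)"
  unfolding bdd_fun_def
proof (elim exE)
  fix M M' assume "\<forall>x. \<bar>f x\<bar> \<le> M" "\<forall>x. \<bar>g x\<bar> \<le> M'"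
  then have "\<forall>x. \<bar>f x + g x\<bar> \<le> M + M'"
    by (meson abs_triangle_ineq add_mono order_trans)
  then show "\<exists>M. \<forall>x. \<bar>f x + g x\<bar> \<le> M" by blast
qed

lemma bdd_fun_mult: "bdd_fun f \<Longrightarrow> bdd_fun g \<Longrightarrow> bdd_fun (\<lambda>x. f x * g x)"
  unfolding bdd_fun_def
proof (elim exE)
  fix M M' assume "\<forall>x. \<bar>f x\<bar> \<le> M" "\<forall>x. \<bar>g x\<bar> \<le> M'"
  then have "\<forall>x. \<bar>f x * g x\<bar> \<le> M * M'"
    unfolding abs_mult by (meson abs_ge_zero mult_mono order_trans)
  then show "\<exists>M. \<forall>x. \<bar>f x * g x\<bar> \<le> M" by blast
qed

lemma bdd_fun_sum: "(\<And>i. i \<in> I \<Longrightarrow> bdd_fun (f i)) \<Longrightarrow> bdd_fun (\<lambda>x. \<Sum>i\<in>I. f i x)"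
  by (induction I rule: infinite_finite_induct) (auto intro: bdd_fun_const bdd_fun_add)

lemma bdd_fun_comp: "bdd_fun f \<Longrightarrow> bdd_fun (\<lambda>x. f (h x))"
  unfolding bdd_fun_def by blast

lemma bdd_fun_indicator: "bdd_fun (indicator A)"
  unfolding bdd_fun_def by (rule exI[of _ 1]) (auto simp: indicator_def)

lemma bdd_fun_common_bound:
  fixes N :: nat
  assumes "\<And>k. k < N \<Longrightarrow> bdd_fun (u k)"
  shows "\<exists>M::real. \<forall>k<N. \<forall>x. \<bar>u k x\<bar> \<le> M"
  using assms
proof (induct N)
  case (Suc N)
  have "\<exists>M::real. \<forall>k<N. \<forall>x. \<bar>u k x\<bar> \<le> M" by (rule Suc(1)) (simp add: Suc(2))
  then obtain M where M: "\<forall>k<N. \<forall>x. \<bar>u k x\<bar> \<le> M" by blast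
  obtain M' where M': "\<forall>x. \<bar>u N x\<bar> \<le> M'" using Suc(2)[of N] by (auto simp: bdd_fun_def)
  have "\<forall>k<Suc N. \<forall>x. \<bar>u k x\<bar> \<le> max M M'"
    using M M' by (auto simp: less_Suc_eq le_max_iff_disj)
  then show ?case by blast
qed auto

text \<open>The support is weakened to the symmetric condition \<open>\<bar>x\<bar> \<le> N\<close>
  because translates are later counted by distance. The mother inherits it: for
  \<open>\<bar>x\<bar> > N\<close> and k in the filter range, \<open>2 * x - k\<close> misses the
  support of the father.\<close>

lemma daubechies_pair_bounded:
  assumes "daubechies_pair N \<phi> \<psi>"
  shows "bdd_fun \<phi>" "bdd_fun \<psi>"
    and "\<bar>x\<bar> > real N \<Longrightarrow> \<phi> x = 0" and "\<bar>x\<bar> > real N \<Longrightarrow> \<psi> x = 0"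
proof -
  have "bounded (range \<phi>)" using assms by (simp add: daubechies_pair_def)
  then show b: "bdd_fun \<phi>" by (auto simp: bdd_fun_def bounded_iff)
  obtain h :: "int \<Rightarrow> real" where h: "\<And>x. \<psi> x = sqrt 2 * (\<Sum>k = 1 - int N..int N.
                     (if even k then 1 else -1) * h (1 - k) * \<phi> (2 * x - of_int k))"
    using assms unfolding daubechies_pair_def by blast
  have "\<psi> = (\<lambda>x. sqrt 2 * (\<Sum>k = 1 - int N..int N.
                     (if even k then 1 else -1) * h (1 - k) * \<phi> (2 * x - of_int k)))"
    using h by auto
  then show "bdd_fun \<psi>"
    by (simp only:) (intro bdd_fun_mult bdd_fun_const bdd_fun_sum bdd_fun_comp[OF b])
  have N1: "N \<ge> 1" using assms by (simp add: daubechies_pair_def)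
  have supp: "\<And>x. x \<notin> {1 - real N..real N} \<Longrightarrow> \<phi> x = 0"
    using assms unfolding daubechies_pair_def by blast
  show "\<bar>x\<bar> > real N \<Longrightarrow> \<phi> x = 0" using N1 by (intro supp) auto
  assume x: "\<bar>x\<bar> > real N"
  have "\<phi> (2 * x - of_int k) = 0" if "k \<in> {1 - int N..int N}" for k
  proof (rule supp)
    have "1 - real N \<le> real_of_int k" "real_of_int k \<le> real N"
      using that by auto
    then show "2 * x - of_int k \<notin> {1 - real N..real N}" using x by auto
  qed
  then have "(\<Sum>k = 1 - int N..int N. (if even k then 1 else -1) * h (1 - k) * \<phi> (2 * x - of_int k)) = 0"
    by (intro sum.neutral ballI) (simp only: mult_zero_right)
  then show "\<psi> x = 0" by (simp only: h mult_zero_right)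
qed

lemma edge_scaling_bounded:
  assumes "edge_scaling N \<phi> e" "bdd_fun \<phi>" "k < N"
  shows "bdd_fun (e k)"
proof -
  obtain A :: "nat \<Rightarrow> nat \<Rightarrow> real"
    where "\<forall>k<N. \<forall>x. e k x = (\<Sum>i = N - 1 - k..<N. A k i * edge_poly N \<phi> i x)"
    using assms(1) unfolding edge_scaling_def by (elim exE conjE)
  with assms(3) have "e k = (\<lambda>x. \<Sum>i = N - 1 - k..<N. A k i * edge_poly N \<phi> i x)" by auto
  then show ?thesis
    unfolding edge_poly_def
    by (simp only:) (intro bdd_fun_mult bdd_fun_const bdd_fun_sum bdd_fun_comp[OF assms(2)] bdd_fun_indicator)
qed

lemma edge_wavelet_bounded:
  assumes "edge_wavelet N \<phi> \<psi> e w" "bdd_fun \<phi>" "\<And>l. l < N \<Longrightarrow> bdd_fun (e l)" "k < N"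
  shows "bdd_fun (w k)"
proof -
  obtain G H :: "nat \<Rightarrow> nat \<Rightarrow> real"
    where "\<forall>k<N. \<forall>x. w k x = sqrt 2 * ((\<Sum>l<N. G k l * e l (2 * x)) +
                          (\<Sum>r = N..N + 2 * k. H k r * \<phi> (2 * x - real r)))"
    using assms(1)[unfolded edge_wavelet_def, THEN conjunct1] by (elim exE)
  with assms(4) have "w k = (\<lambda>x. sqrt 2 * ((\<Sum>l<N. G k l * e l (2 * x)) +
                          (\<Sum>r = N..N + 2 * k. H k r * \<phi> (2 * x - real r))))" by auto
  then show ?thesis
    by (simp only:) (intro bdd_fun_mult bdd_fun_add bdd_fun_const bdd_fun_sum
       bdd_fun_comp[OF assms(2)] bdd_fun_comp[OF assms(3)]; simp)
qed

text \<open>Only these translates of a function vanishing beyond distance R from 0 can be non-zero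
  at y.\<close>

lemma card_nat_near_le:
  "finite {k::nat. \<bar>y - real k\<bar> \<le> real R}" "card {k::nat. \<bar>y - real k\<bar> \<le> real R} \<le> 2 * R + 1"
proof -
  have sub: "{k::nat. \<bar>y - real k\<bar> \<le> real R} \<subseteq> nat ` {\<lceil>y - real R\<rceil>..\<lfloor>y + real R\<rfloor>}"
  proof
    fix k assume "k \<in> {k::nat. \<bar>y - real k\<bar> \<le> real R}"
    then have "int k \<in> {\<lceil>y - real R\<rceil>..\<lfloor>y + real R\<rfloor>}"
      by (simp add: le_floor_iff ceiling_le_iff abs_le_iff del: floor_add2 ceiling_diff_numeral)
    then show "k \<in> nat ` {\<lceil>y - real R\<rceil>..\<lfloor>y + real R\<rfloor>}" by (metis imageI nat_int)
  qed
  then show "finite {k::nat. \<bar>y - real k\<bar> \<le> real R}" by (rule finite_subset) auto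
  have "card {k::nat. \<bar>y - real k\<bar> \<le> real R} \<le> card {\<lceil>y - real R\<rceil>..\<lfloor>y + real R\<rfloor>}"
    using sub by (meson card_image_le card_mono finite_atLeastAtMost_int finite_imageI order_trans)
  also have "\<dots> \<le> 2 * R + 1"
    by simp linarith
  finally show "card {k::nat. \<bar>y - real k\<bar> \<le> real R} \<le> 2 * R + 1" .
qed

text \<open>At a given point at most \<open>2 * R + 1\<close> interior functions of a level are
  non-zero. The edge functions are charged at every point; a level has at most \<open>2 * N\<close>
  of them, so apart from the normalization \<open>2 powr (j / 2)\<close> the bound is free of
  j.\<close>

lemma level_family_sum_bound:
  assumes g: "bdd_fun g" "\<And>x. \<bar>x\<bar> > real R \<Longrightarrow> g x = 0"
    and u: "\<And>k. k < N \<Longrightarrow> bdd_fun (u k)" and v: "\<And>k. k < N \<Longrightarrow> bdd_fun (v k)"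
  shows "\<exists>C>0. \<forall>j x. (\<Sum>k<2^j. \<bar>level_family N g u v j k x\<bar>) \<le> C * 2 powr (real j / 2)"
proof -
  obtain Mg where Mg: "\<And>x. \<bar>g x\<bar> \<le> Mg" using g by (auto simp: bdd_fun_def)
  obtain Mu where Mu: "\<And>k x. k < N \<Longrightarrow> \<bar>u k x\<bar> \<le> Mu" using bdd_fun_common_bound[of N u] u by blast
  obtain Mv where Mv: "\<And>k x. k < N \<Longrightarrow> \<bar>v k x\<bar> \<le> Mv" using bdd_fun_common_bound[of N v] v by blast
  define M where "M = \<bar>Mg\<bar> + \<bar>Mu\<bar> + \<bar>Mv\<bar> + 1"
  have M: "M > 0" "Mg \<le> M" "Mu \<le> M" "Mv \<le> M" by (auto simp: M_def)
  have "(\<Sum>k<2^j. \<bar>level_family N g u v j k x\<bar>) \<le> M * real (2 * N + 2 * R + 1) * 2 powr (real j / 2)" for j x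
  proof -
    \<comment> \<open>\<open>c k\<close> counts the reasons for which k may contribute at x. If
      \<open>2 ^ j < N\<close>, the natural subtraction gives 0 and every k is counted as a right
      edge index, still at most N of them.\<close>
    define c :: "nat \<Rightarrow> real" where "c k = of_bool (k < N) + of_bool (2 ^ j - N \<le> k) +
        of_bool (\<bar>2 ^ j * x - real k\<bar> \<le> real R)" for k
    have "\<bar>level_family N g u v j k x\<bar> \<le> 2 powr (real j / 2) * M * c k" if "k < 2 ^ j" for k
    proof -
      consider "k < N" | "\<not> k < N" "k < 2 ^ j - N" "\<bar>2 ^ j * x - real k\<bar> \<le> real R"
        | "\<not> k < N" "k < 2 ^ j - N" "\<bar>2 ^ j * x - real k\<bar> > real R" | "\<not> k < N" "\<not> k < 2 ^ j - N"
        by linarith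
      then have "\<bar>if k < N then u k (2 ^ j * x)
        else if k < 2 ^ j - N then g (2 ^ j * x - real k)
        else v (2 ^ j - 1 - k) (2 ^ j * (1 - x))\<bar> \<le> M * c k"
      proof cases
        case 1
        have "M * 1 \<le> M * c k" using M 1 by (intro mult_left_mono) (auto simp: c_def)
        then show ?thesis using 1 Mu[of k "2 ^ j * x"] M by (simp; linarith)
      next
        case 2
        have "M * 1 \<le> M * c k" using M 2 by (intro mult_left_mono) (auto simp: c_def)
        then show ?thesis using 2 Mg[of "2 ^ j * x - real k"] M by (simp; linarith)
      next
        case 3
        then show ?thesis using g(2)[of "2 ^ j * x - real k"] M by (simp add: c_def)
      next
        case 4
        have "M * 1 \<le> M * c k" using M 4 by (intro mult_left_mono) (auto simp: c_def)
        moreover have "2 ^ j - 1 - k < N" using 4 that by auto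
        ultimately show ?thesis using 4 Mv[of "2 ^ j - 1 - k" "2 ^ j * (1 - x)"] M by (simp; linarith)
      qed
      then show ?thesis
        unfolding level_family_def abs_mult
        by (simp add: mult.assoc)
    qed
    then have "(\<Sum>k<2^j. \<bar>level_family N g u v j k x\<bar>) \<le> (\<Sum>k<2^j. 2 powr (real j / 2) * M * c k)"
      by (intro sum_mono) auto
    also have "\<dots> = 2 powr (real j / 2) * M * (\<Sum>k<2^j. c k)" by (simp add: sum_distrib_left)
    also have "(\<Sum>k<2^j. c k) \<le> real (2 * N + 2 * R + 1)"
    proof -
      have "card ({..<2^j} \<inter> {k. k < N}) \<le> card {..<N}"
        by (intro card_mono) auto
      moreover have "card ({..<2^j} \<inter> {k. 2 ^ j - N \<le> k}) \<le> card {2 ^ j - N..<2 ^ j}"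
        by (intro card_mono) auto
      moreover have "card ({..<2^j} \<inter> {k. \<bar>2 ^ j * x - real k\<bar> \<le> real R}) \<le> card {k. \<bar>2 ^ j * x - real k\<bar> \<le> real R}"
        by (intro card_mono card_nat_near_le) auto
      moreover have "card {k::nat. \<bar>2 ^ j * x - real k\<bar> \<le> real R} \<le> 2 * R + 1"
        by (rule card_nat_near_le)
      ultimately have "card ({..<2^j} \<inter> {k. k < N}) + card ({..<2^j} \<inter> {k. 2 ^ j - N \<le> k})
         + card ({..<2^j} \<inter> {k. \<bar>2 ^ j * x - real k\<bar> \<le> real R}) \<le> 2 * N + 2 * R + 1"
        by simp
      then show ?thesis
        unfolding c_def sum.distrib
        by (simp add: of_bool_def sum.If_cases flip: of_nat_add) 
    qed
    finally show ?thesis using M by (simp add: mult_ac)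
  qed
  moreover have "M * real (2 * N + 2 * R + 1) > 0" using M by simp
  ultimately show ?thesis by blast
qed

text \<open>The enumeration mixes levels, but harmlessly: the levels below \<open>j0\<close> hold
  scaling functions, finitely many with one common bound, and each level from \<open>j0\<close> on
  holds a single foreign function, at k = 0.\<close>

lemma cdv_wavelet_basis_level_sum:
  assumes "cdv_wavelet_basis N \<psi>"
  shows "\<exists>C>0. \<forall>j x. (\<Sum>k<2^j. \<bar>\<psi> j k x\<bar>) \<le> C * 2 powr (real j / 2)"
proof -
  obtain j0 father mother eL wL eR wR where
    dp: "daubechies_pair N father mother"
    and el: "edge_scaling N father eL" and wl: "edge_wavelet N father mother eL wL"
    and er: "edge_scaling N (\<lambda>y. father (1 - y)) eR"
    and wr: "edge_wavelet N (\<lambda>y. father (1 - y)) (\<lambda>y. mother (1 - y)) eR wR"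
    and eq: "\<forall>j k. k < 2 ^ j \<longrightarrow>
           \<psi> j k = cdv_index j0 (level_family N father eL eR j0) (level_family N mother wL wR) j k"
    using assms unfolding cdv_wavelet_basis_def by blast
  note b = daubechies_pair_bounded[OF dp]
  have bf: "bdd_fun (\<lambda>y. father (1 - y))" by (rule bdd_fun_comp[OF b(1)])
  note e = edge_scaling_bounded[OF el b(1)] edge_scaling_bounded[OF er bf]
  define S where "S = level_family N father eL eR j0"
  define W where "W = level_family N mother wL wR"
  obtain C1 where C1: "C1 > 0" "\<And>x. (\<Sum>k<2^j0. \<bar>S k x\<bar>) \<le> C1 * 2 powr (real j0 / 2)"
    using level_family_sum_bound[of father N N eL eR] b(1) b(3) e unfolding S_def by blast
  obtain C2 where C2: "C2 > 0" "\<And>j x. (\<Sum>k<2^j. \<bar>W j k x\<bar>) \<le> C2 * 2 powr (real j / 2)"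
    using level_family_sum_bound[of mother N N wL wR] b(2) b(4) edge_wavelet_bounded[OF wl b(1) e(1)]
      edge_wavelet_bounded[OF wr bf e(2)] unfolding W_def by blast
  \<comment> \<open>One \<open>C2\<close> is for the level itself, one for the wavelet borrowed from
    level \<open>j - 1\<close>; the last term pays for the scaling functions, since
    \<open>2 powr (j / 2)\<close> is at least 1.\<close>
  define C where "C = 2 * C2 + C1 * 2 powr (real j0 / 2)"
  have "(\<Sum>k<2^j. \<bar>\<psi> j k x\<bar>) \<le> C * 2 powr (real j / 2)" for j x
  proof -
    have p1: "1 \<le> 2 powr (real j / 2)" by (simp add: ge_one_powr_ge_zero)
    have p2: "C1 * 2 powr (real j0 / 2) \<le> C1 * 2 powr (real j0 / 2) * 2 powr (real j / 2)"
      using mult_left_mono[OF p1, of "C1 * 2 powr (real j0 / 2)"] C1(1) by simp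
    have psi: "(\<Sum>k<2^j. \<bar>\<psi> j k x\<bar>) = (\<Sum>k<2^j. \<bar>cdv_index j0 S W j k x\<bar>)"
      using eq by (intro sum.cong) (auto simp: S_def W_def)
    show ?thesis
    proof (cases "j < j0")
      case True
      have "(2::nat) ^ Suc j \<le> 2 ^ j0" using True by (intro power_increasing) auto
      then have le: "2 * (2::nat) ^ j \<le> 2 ^ j0" by simp
      have "(\<Sum>k<2^j. \<bar>cdv_index j0 S W j k x\<bar>) = (\<Sum>k<2^j. \<bar>S (2 ^ j + k - 1) x\<bar>)"
        using True by (simp add: cdv_index_def)
      also have "\<dots> = (\<Sum>p\<in>(\<lambda>k. 2 ^ j + k - 1) ` {..<2^j}. \<bar>S p x\<bar>)"
        by (subst sum.reindex) (auto intro!: inj_onI simp: add_diff_cancel_left)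
      also have "\<dots> \<le> (\<Sum>p<2^j0. \<bar>S p x\<bar>)"
        using le by (intro sum_mono2) auto
      also have "\<dots> \<le> C1 * 2 powr (real j0 / 2)" by (rule C1)
      also have "\<dots> \<le> C * 2 powr (real j / 2)" using p2 C2(1) p1 unfolding C_def distrib_right
        by (smt (verit) mult_nonneg_nonneg)
      finally show ?thesis using psi by simp
    next
      case False
      have s0: "\<bar>S (2 ^ j0 - 1) x\<bar> \<le> C1 * 2 powr (real j0 / 2)"
        using C1(2)[of x] member_le_sum[of "2 ^ j0 - 1" "{..<2 ^ j0}" "\<lambda>p. \<bar>S p x\<bar>"] by simp
      have w0: "\<bar>W (j - 1) 0 x\<bar> \<le> C2 * 2 powr (real j / 2)"
      proof -
        have "\<bar>W (j - 1) 0 x\<bar> \<le> C2 * 2 powr (real (j - 1) / 2)"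
          using C2(2)[where j="j - 1" and x=x] member_le_sum[of 0 "{..<2 ^ (j - 1)}" "\<lambda>p. \<bar>W (j - 1) p x\<bar>"] by simp
        also have "\<dots> \<le> C2 * 2 powr (real j / 2)" using C2(1) by (intro mult_left_mono powr_mono) auto
        finally show ?thesis .
      qed
      have "(\<Sum>k<2^j. \<bar>cdv_index j0 S W j k x\<bar>)
          \<le> (\<Sum>k<2^j. \<bar>W j k x\<bar> + (if k = 0 then \<bar>S (2 ^ j0 - 1) x\<bar> + \<bar>W (j - 1) 0 x\<bar> else 0))"
        using False by (intro sum_mono) (auto simp: cdv_index_def)
      also have "\<dots> = (\<Sum>k<2^j. \<bar>W j k x\<bar>) + (\<bar>S (2 ^ j0 - 1) x\<bar> + \<bar>W (j - 1) 0 x\<bar>)"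
        by (simp add: sum.distrib)
      also have "\<dots> \<le> C * 2 powr (real j / 2)"
        using C2(2)[where j=j and x=x] s0 w0 p2 unfolding C_def distrib_right by linarith
      finally show ?thesis using psi by simp
    qed
  qed
  moreover have "C > 0" using C1 C2 unfolding C_def by (intro add_pos_pos) auto
  ultimately show ?thesis by blast
qed

section \<open>Binary transmission\<close>

lemma sum_binary_digits:
  fixes a :: int
  shows "(\<Sum>i<L. of_bool (odd (a div 2 ^ i)) * 2 ^ i) = a mod 2 ^ L"
proof (induct L)
  case (Suc L)
  have "a mod 2 ^ Suc L = 2 ^ L * (a div 2 ^ L mod 2) + a mod 2 ^ L"
    using mod_mult2_eq'[of a "2 ^ L" 1] zmod_zmult2_eq[of 2 a "2 ^ L"] by (simp add: mult.commute)
  then show ?case using Suc by (simp add: mod_2_eq_odd)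
qed simp

text \<open>D = 1/2 places the last digit at the order of the parametric rate
  \<open>1 / sqrt n\<close>, so that cutting digits never dominates the noise. The factor 2 pays for
  rounding \<open>lowest_digit\<close> up to an integer.\<close>

lemma two_powi_lowest_digit_le:
  assumes "n \<ge> 1"
  shows "2 powi (lowest_digit n) \<le> 2 / sqrt (real n)"
proof -
  have "2 powi (lowest_digit n) = 2 powr real_of_int (lowest_digit n)"
    by (simp add: powr_real_of_int')
  also have "\<dots> \<le> 2 powr (- (1/2) * log 2 (real n) + 1)"
    unfolding lowest_digit_def by (intro powr_mono) linarith+
  also have "\<dots> = 2 powr (- (1/2) * log 2 (real n)) * 2"
    by (subst powr_add) simp
  also have "\<dots> = 2 * (2 powr (log 2 (real n))) powr (- (1/2))"
    by (simp add: powr_powr)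
  also have "\<dots> = 2 / sqrt (real n)"
    using assms powr_half_sqrt[of "real n"] by (simp add: powr_minus_divide)
  finally show ?thesis .
qed

text \<open>Measured in units of the lowest digit, the decoded modulus is the floor of
  \<open>\<bar>x\<bar>\<close>, so less than one unit is lost. The list reaches high enough because
  \<open>log 2 \<bar>x\<bar>\<close> is below the top position plus one.\<close>

lemma decode_trans_approx_error:
  "\<bar>decode n (trans_approx n x) - x\<bar> \<le> 2 powi (lowest_digit n)"
proof (cases "x = 0")
  case True
  then show ?thesis by (simp add: decode_def trans_approx_def)
next
  case False
  define lo where "lo = lowest_digit n"
  define h where "h = \<lfloor>log 2 \<bar>x\<bar>\<rfloor>"
  define L where "L = nat (h - lo + 1)"
  define q where "q = \<bar>x\<bar> / 2 powi lo"
  have p: "(2::real) powi lo > 0" by simp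
  have q0: "q \<ge> 0" by (simp add: q_def)
  have "log 2 \<bar>x\<bar> < real_of_int (h + 1)" unfolding h_def by linarith
  then have "\<bar>x\<bar> < 2 powr (real_of_int (h + 1))" using False by (simp add: log_less_iff)
  \<comment> \<open>This also covers numbers below the lowest digit: then \<open>L = 0\<close>, the
    list is empty, and \<open>h + 1 \<le> lo\<close> still gives the inequality.\<close>
  also have "\<dots> \<le> 2 powr (real_of_int (lo + int L))" by (intro powr_mono) (auto simp: L_def)
  also have "\<dots> = 2 powi lo * 2 ^ L" by (simp add: powr_add powr_realpow flip: powr_real_of_int')
  finally have "q < 2 ^ L" using p by (simp add: q_def divide_less_eq mult.commute)
  then have fl: "\<lfloor>q\<rfloor> < 2 ^ L" by (simp add: floor_less_iff)
  have dig: "binary_digit x (lo + int i) = odd (\<lfloor>q\<rfloor> div 2 ^ i)" for i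
  proof -
    have "\<bar>x\<bar> / 2 powi (lo + int i) = q / real_of_int (2 ^ i)"
      by (simp add: q_def power_int_add)
    then have "\<lfloor>\<bar>x\<bar> / 2 powi (lo + int i)\<rfloor> = \<lfloor>q\<rfloor> div 2 ^ i"
      using floor_divide_real_eq_div[of "2 ^ i" q] by simp
    then show ?thesis by (simp add: binary_digit_def)
  qed
  have tl: "tl (trans_approx n x) = map (binary_digit x) [lo..h]"
    using False by (simp add: trans_approx_def lo_def h_def)
  have nth: "map (binary_digit x) [lo..h] ! i = odd (\<lfloor>q\<rfloor> div 2 ^ i)" if "i < L" for i
    using that by (simp add: L_def dig nth_upto)
  have "(\<Sum>i<length (tl (trans_approx n x)). of_bool (tl (trans_approx n x) ! i) * (2::real) powi (lowest_digit n + int i))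
      = (\<Sum>i<L. of_bool (odd (\<lfloor>q\<rfloor> div 2 ^ i)) * (2 powi lo * 2 ^ i))"
    unfolding tl by (intro sum.cong) (auto simp: L_def nth dig lo_def[symmetric] power_int_add)
  also have "\<dots> = 2 powi lo * real_of_int (\<Sum>i<L. of_bool (odd (\<lfloor>q\<rfloor> div 2 ^ i)) * 2 ^ i)"
    unfolding of_int_sum sum_distrib_left by (intro sum.cong refl) simp
  also have "\<dots> = 2 powi lo * real_of_int \<lfloor>q\<rfloor>"
    unfolding sum_binary_digits using fl q0 by simp
  finally have dec: "decode n (trans_approx n x) = (if x < 0 then -1 else 1) * (2 powi lo * real_of_int \<lfloor>q\<rfloor>)"
    by (simp add: decode_def trans_approx_def)
  have x: "x = (if x < 0 then -1 else 1) * (2 powi lo * q)" using p by (simp add: q_def)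
  have "\<bar>decode n (trans_approx n x) - x\<bar> = \<bar>2 powi lo * real_of_int \<lfloor>q\<rfloor> - 2 powi lo * q\<bar>"
    unfolding dec by (subst (2) x) auto
  also have "\<dots> = 2 powi lo * \<bar>real_of_int \<lfloor>q\<rfloor> - q\<bar>"
    by (simp add: abs_mult flip: right_diff_distrib)
  also have "\<dots> \<le> 2 powi lo * 1" by (intro mult_left_mono) (linarith, simp)
  finally show ?thesis by (simp add: lo_def)
qed

text \<open>Concatenated \<open>trans_approx\<close> strings cannot be split again, so each string is made
  self-delimiting. Doubling every bit would exceed the budget of \<open>log\<^sub>2 n\<close> bits per coefficient; since
  the length rarely exceeds \<open>a \<approx> (log\<^sub>2 n) / 2\<close>, it suffices to pad to length \<open>a\<close> (high zero digits do
  not change the decoded number) and to announce the excess over \<open>a\<close> in unary.\<close>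

definition pad_code :: "nat \<Rightarrow> bool list \<Rightarrow> bool list" where
  "pad_code a bs = replicate (length bs - a) True @ False # bs @ replicate (a - length bs) False"

lemma length_pad_code: "length (pad_code a bs) = 1 + a + 2 * (length bs - a)"
  by (simp add: pad_code_def)

lemma replicate_True_cancel:
  "replicate q True @ False # u = replicate q' True @ False # u' \<Longrightarrow> q = q' \<and> u = u'"
proof (induct q arbitrary: q')
  case 0 then show ?case by (cases q') auto
next
  case (Suc q) then show ?case by (cases q') auto
qed

text \<open>The unary header gives the excess over a, hence the length of the padded body, so the
  body can be cut off. What is recovered is the padded body and not \<open>bs\<close>; for decoding
  this makes no difference.\<close>

lemma pad_code_prefix_free:
  assumes "pad_code a bs @ r = pad_code a bs' @ r'"
  shows "bs @ replicate (a - length bs) False = bs' @ replicate (a - length bs') False" "r = r'"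
proof -
  have eq: "length bs - a = length bs' - a"
    "bs @ replicate (a - length bs) False @ r = bs' @ replicate (a - length bs') False @ r'"
    using assms replicate_True_cancel[of "length bs - a" "bs @ replicate (a - length bs) False @ r"
       "length bs' - a" "bs' @ replicate (a - length bs') False @ r'"] by (auto simp: pad_code_def)
  have "length (bs @ replicate (a - length bs) False) = length (bs' @ replicate (a - length bs') False)"
    using eq(1) by simp
  then show "bs @ replicate (a - length bs) False = bs' @ replicate (a - length bs') False" "r = r'"
    using eq(2) append_eq_append_conv[of "bs @ replicate (a - length bs) False" "bs' @ replicate (a - length bs') False" r r']
    by auto
qed

text \<open>Digits are listed from low to high, so appended zeros are leading zeros of the number.
  The list must already contain its sign bit, as otherwise the padding would supply one.\<close>

lemma decode_padding:
  assumes "bs \<noteq> []"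
  shows "decode n (bs @ replicate p False) = decode n bs"
proof -
  have "(\<Sum>i<length (tl bs) + p. of_bool ((tl bs @ replicate p False) ! i) * 2 powi (lowest_digit n + int i))
     = (\<Sum>i<length (tl bs). of_bool (tl bs ! i) * (2::real) powi (lowest_digit n + int i))"
    by (rule sum.mono_neutral_cong_right) (auto simp: nth_append)
  then show ?thesis using assms by (simp add: decode_def)
qed

lemma decode_eq_of_padded_eq:
  assumes "bs @ replicate p False = bs' @ replicate p' False" "bs \<noteq> []" "bs' \<noteq> []"
  shows "decode n bs = decode n bs'"
  using assms by (metis decode_padding)

section \<open>Messages and what the central machine recovers from them\<close>

definition index_list :: "real \<Rightarrow> nat \<Rightarrow> nat \<Rightarrow> real \<Rightarrow> nat \<Rightarrow> (nat \<times> nat) list" where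
  "index_list s n m B i = (SOME xs. set xs = {(j, k). transmits s n m B i j k} \<and> distinct xs)"

text \<open>The order of the coefficients is arbitrary but independent of the data, hence known to
  the receiver: no index has to be transmitted.\<close>

definition message :: "nat \<Rightarrow> real \<Rightarrow> (nat \<Rightarrow> nat \<Rightarrow> real \<Rightarrow> real) \<Rightarrow> nat \<Rightarrow> nat \<Rightarrow> real \<Rightarrow> nat \<Rightarrow> local_data \<Rightarrow> bool list" where
  "message a s \<psi> n m B i d =
     concat (map (\<lambda>(j, k). pad_code a (trans_approx n (local_coeff \<psi> n m d j k))) (index_list s n m B i))"

lemma two_pow_add_inj:
  assumes "k < (2::nat) ^ j" "k' < 2 ^ j'" "2 ^ j + k = 2 ^ j' + k'"
  shows "j = j' \<and> k = k'"
proof -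
  have "\<not> j < j'" if "k < (2::nat) ^ j" "2 ^ j + k = 2 ^ j' + k'" for j j' k k'
  proof
    assume "j < j'"
    then have "(2::nat) ^ Suc j \<le> 2 ^ j'" by (intro power_increasing) auto
    then show False using that by simp
  qed
  from this[OF assms(1) assms(3)] this[OF assms(2) assms(3)[symmetric]] have "j = j'" by simp
  then show ?thesis using assms by simp
qed

lemma transmits_unique_block:
  assumes "l \<in> {1..e}" "((l - 1) * m) div e + 1 \<le> i" "i \<le> (l * m) div e"
    "l' \<in> {1..e}" "((l' - 1) * m) div e + 1 \<le> i" "i \<le> (l' * m) div e"
  shows "l = (l'::nat)"
proof -
  have "\<not> l < l'" if "i \<le> (l * m) div e" "((l' - 1) * m) div e + 1 \<le> i" for l l' :: nat
  proof
    assume "l < l'"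
    then have "(l * m) div e \<le> ((l' - 1) * m) div e" by (intro div_le_mono mult_le_mono1) auto
    then show False using that by simp
  qed
  from this[OF assms(3) assms(5)] this[OF assms(6) assms(2)] show ?thesis by simp
qed

text \<open>The blocks of machines are disjoint, so machine i serves a single block l, and the
  positions \<open>2 ^ j + k\<close> of that block form an interval of length
  \<open>block_size n B\<close>. Positions determine index pairs.\<close>

lemma transmitted_indices:
  "finite {(j, k). transmits s n m B i j k}"
  "card {(j, k). transmits s n m B i j k} \<le> block_size n B"
proof -
  define b where "b = block_size n B"
  have "\<exists>l. (\<lambda>(j, k). 2 ^ j + k) ` {(j, k). transmits s n m B i j k} \<subseteq> {l * b <..l * b + b}"
  proof (cases "\<exists>j k. transmits s n m B i j k")
    case True
    then obtain l where l: "l \<in> {1..eta s n m B}"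
        "((l - 1) * m) div eta s n m B + 1 \<le> i" "i \<le> (l * m) div eta s n m B"
      unfolding transmits_def by blast
    have "2 ^ j + k \<in> {(l - 1) * b <..(l - 1) * b + b}" if tr: "transmits s n m B i j k" for j k
    proof -
      obtain l' where l': "l' \<in> {1..eta s n m B}"
        "((l' - 1) * m) div eta s n m B + 1 \<le> i" "i \<le> (l' * m) div eta s n m B"
        "(l' - 1) * b < 2 ^ j + k" "2 ^ j + k \<le> l' * b"
        using tr unfolding transmits_def b_def by blast
      have "l' = l" using transmits_unique_block l l' by blast
      moreover have "l * b = (l - 1) * b + b" using l by (cases l) auto
      ultimately show ?thesis using l' by auto
    qed
    then show ?thesis by (intro exI[of _ "l - 1"]) auto
  qed auto
  then obtain l where sub: "(\<lambda>(j, k). 2 ^ j + k) ` {(j, k). transmits s n m B i j k} \<subseteq> {l * b <..l * b + b}"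
    by blast
  have inj: "inj_on (\<lambda>(j, k). (2::nat) ^ j + k) {(j, k). transmits s n m B i j k}"
    by (rule inj_onI) (auto simp: transmits_def dest: two_pow_add_inj)
  show fin: "finite {(j, k). transmits s n m B i j k}"
    using finite_imageD[OF finite_subset[OF sub] inj] by simp
  show "card {(j, k). transmits s n m B i j k} \<le> block_size n B"
    using card_inj_on_le[OF inj sub] by (simp add: b_def)
qed

lemma index_list:
  "set (index_list s n m B i) = {(j, k). transmits s n m B i j k}"
  "distinct (index_list s n m B i)"
proof -
  have "set (index_list s n m B i) = {(j, k). transmits s n m B i j k} \<and> distinct (index_list s n m B i)"
    unfolding index_list_def
    by (rule someI_ex[where P="\<lambda>xs. set xs = {(j, k). transmits s n m B i j k} \<and> distinct xs"])
      (use finite_distinct_list[OF transmitted_indices(1)] in blast)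
  then show "set (index_list s n m B i) = {(j, k). transmits s n m B i j k}"
    "distinct (index_list s n m B i)" by auto
qed

text \<open>Stands in for an explicit parser: if equal messages always decode to equal numbers,
  entry by entry, then the estimator is a function of the messages.\<close>

lemma concat_pad_code_eqD:
  assumes "concat (map (\<lambda>p. pad_code a (f p)) xs) = concat (map (\<lambda>p. pad_code a (g p)) xs)"
    and "p \<in> set xs" "f p \<noteq> []" "g p \<noteq> []"
  shows "decode n (f p) = decode n (g p)"
  using assms(1,2)
proof (induct xs)
  case (Cons x xs)
  then have "pad_code a (f x) @ concat (map (\<lambda>p. pad_code a (f p)) xs) =
     pad_code a (g x) @ concat (map (\<lambda>p. pad_code a (g p)) xs)" by simp
  note pf = pad_code_prefix_free[OF this]
  show ?case
  proof (cases "p = x")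
    case True
    then show ?thesis using decode_eq_of_padded_eq[OF pf(1)] assms(3,4) by simp
  next
    case False
    then show ?thesis using Cons pf(2) by simp
  qed
qed simp

lemma received_message_cong:
  assumes "message a s \<psi> n m B i (d i) = message a s \<psi> n m B i (d' i)"
  shows "received s \<psi> n m B d i j k = received s \<psi> n m B d' i j k"
proof (cases "transmits s n m B i j k")
  case True
  have "decode n (case (j, k) of (j, k) \<Rightarrow> trans_approx n (local_coeff \<psi> n m (d i) j k)) =
    decode n (case (j, k) of (j, k) \<Rightarrow> trans_approx n (local_coeff \<psi> n m (d' i) j k))"
    by (rule concat_pad_code_eqD[of a _ "index_list s n m B i"])
      (use assms True in \<open>auto simp: message_def index_list case_prod_unfold trans_approx_def\<close>)
  then show ?thesis by (simp add: received_def)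
qed (simp add: received_def)

lemma estimator_message_cong:
  assumes "\<And>i. i \<in> {1..m} \<Longrightarrow> message a s \<psi> n m B i (d i) = message a s \<psi> n m B i (d' i)"
  shows "estimator s \<psi> n m B d = estimator s \<psi> n m B d'"
proof -
  have "received s \<psi> n m B d i j k = received s \<psi> n m B d' i j k" if "i \<in> {1..m}" for i j k
    using assms[OF that] by (rule received_message_cong[where d=d and d'=d'])
  then have "est_coeff s \<psi> n m B d j k = est_coeff s \<psi> n m B d' j k" for j k
    unfolding est_coeff_def
    by (auto intro!: sum.cong arg_cong2[where f="(/)"] simp: averaged_def)
  then show ?thesis by (simp add: estimator_def fun_eq_iff)
qed

section \<open>Measurability of the messages and membership in the class of distributed
  estimators\<close>

lemma measurable_map_countable:
  assumes "\<And>k. k \<in> set ks \<Longrightarrow> f k \<in> measurable M (count_space (UNIV :: 'b::countable set))"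
  shows "(\<lambda>x. map (\<lambda>k. f k x) ks) \<in> measurable M (count_space UNIV)"
  using assms
proof (induct ks)
  case (Cons k ks)
  have [measurable]: "f k \<in> measurable M (count_space UNIV)"
    "(\<lambda>x. map (\<lambda>k. f k x) ks) \<in> measurable M (count_space UNIV)" using Cons by auto
  have "(\<lambda>x. (\<lambda>y. f k x # y) (map (\<lambda>k. f k x) ks)) \<in> measurable M (count_space UNIV)"
    by (rule measurable_compose_countable'[where I=UNIV and g="f k" and f="\<lambda>b x. b # map (\<lambda>k. f k x) ks"])
      (auto intro: measurable_compose[where g="\<lambda>ys. b # ys" for b])
  then show ?case by simp
qed simp

lemma measurable_trans_approx [measurable]: "trans_approx n \<in> measurable borel (count_space UNIV)"
proof -
  have [measurable]: "(\<lambda>x. binary_digit x k) \<in> measurable borel (count_space UNIV)" for k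
    unfolding binary_digit_def by measurable
  have a: "(\<lambda>x. map (binary_digit x) ks) \<in> measurable borel (count_space UNIV)" for ks
    by (rule measurable_map_countable[of ks "\<lambda>k x. binary_digit x k"]) measurable
  \<comment> \<open>The length of the list varies with x. For each fixed top digit h the list is
    measurable, and the top digit takes countably many values.\<close>
  have b: "(\<lambda>x. map (binary_digit x) [lowest_digit n..\<lfloor>log 2 \<bar>x\<bar>\<rfloor>]) \<in> measurable borel (count_space UNIV)"
    by (rule measurable_compose_countable'[where I=UNIV and f="\<lambda>h x. map (binary_digit x) [lowest_digit n..h]"])
      (use a in auto)
  have c: "(\<lambda>x. if x = 0 then [] else map (binary_digit x) [lowest_digit n..\<lfloor>log 2 \<bar>x\<bar>\<rfloor>]) \<in> measurable borel (count_space UNIV)"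
    using b by measurable
  have "(\<lambda>x. (\<lambda>b. b # (if x = 0 then [] else map (binary_digit x) [lowest_digit n..\<lfloor>log 2 \<bar>x\<bar>\<rfloor>])) (x < 0)) \<in> measurable borel (count_space UNIV)"
    by (rule measurable_compose_countable'[where I=UNIV and g="\<lambda>x. x < 0" and
          f="\<lambda>b x. b # (if x = 0 then [] else map (binary_digit x) [lowest_digit n..\<lfloor>log 2 \<bar>x\<bar>\<rfloor>])"])
      (auto intro: measurable_compose[OF c])
  then show ?thesis unfolding trans_approx_def[abs_def] by simp
qed

lemma measurable_local_coeff:
  assumes "\<psi> j k \<in> borel_measurable borel"
  shows "(\<lambda>d. local_coeff \<psi> n m d j k) \<in> borel_measurable (local_space (n div m))"
proof -
  note assms[measurable]
  have [measurable]: "(\<lambda>d. d l) \<in> measurable (local_space (n div m)) (borel \<Otimes>\<^sub>M borel)" if "l \<in> {1..n div m}" for l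
    unfolding local_space_def using that by measurable
  show ?thesis unfolding local_coeff_def by measurable
qed

lemma measurable_message:
  assumes "\<And>j k. k < 2 ^ j \<Longrightarrow> \<psi> j k \<in> borel_measurable borel"
  shows "message a s \<psi> n m B i \<in> measurable (local_space (n div m)) (count_space UNIV)"
proof -
  have "(\<lambda>d. pad_code a (trans_approx n (local_coeff \<psi> n m d j k))) \<in> measurable (local_space (n div m)) (count_space UNIV)"
    if "(j, k) \<in> set (index_list s n m B i)" for j k
  proof -
    have "k < 2 ^ j" using that by (simp add: index_list transmits_def)
    note assms[OF this]
    note measurable_local_coeff[of \<psi> j k n m, OF this, measurable]
    show ?thesis by measurable
  qed
  then have "(\<lambda>d. map (\<lambda>p. (\<lambda>(j, k). pad_code a (trans_approx n (local_coeff \<psi> n m d j k))) p) (index_list s n m B i))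
     \<in> measurable (local_space (n div m)) (count_space UNIV)"
    by (intro measurable_map_countable) auto
  then show ?thesis unfolding message_def[abs_def] by measurable
qed

lemma measurable_estimator:
  assumes "\<And>j k. k < 2 ^ j \<Longrightarrow> \<psi> j k \<in> borel_measurable borel"
  shows "estimator s \<psi> n m B d \<in> borel_measurable borel"
  unfolding estimator_def[abs_def] using assms by (intro borel_measurable_sum) auto

lemma estimator_in_dist_estimators:
  assumes \<psi>: "\<And>j k. k < 2 ^ j \<Longrightarrow> \<psi> j k \<in> borel_measurable borel"
    and len: "\<And>f i. f \<in> F \<Longrightarrow> i \<in> {1..m} \<Longrightarrow>
      (\<integral>\<^sup>+ d. of_nat (length (message a s \<psi> n m B i (d i))) \<partial>data_law \<sigma> m (n div m) f) \<le> ennreal B"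
  shows "estimator s \<psi> n m B \<in> dist_estimators \<sigma> m (n div m) (\<lambda>i. B) F"
proof -
  define Y where "Y = message a s \<psi> n m B"
  \<comment> \<open>Any data producing the messages will do, since the estimator only depends on them.\<close>
  define g where "g y = estimator s \<psi> n m B (SOME d. \<forall>i\<in>{1..m}. Y i (d i) = y i)" for y
  have "(\<lambda>(y, x). g y x) \<in> borel_measurable ((\<Pi>\<^sub>M i\<in>{1..m}. count_space UNIV) \<Otimes>\<^sub>M borel)"
  proof -
    \<comment> \<open>A finite product of countable discrete spaces is countable and discrete. Joint
      measurability thus reduces to measurability in x for each fixed tuple of messages, whichever
      data the choice operator picks.\<close>
    have eq: "(\<Pi>\<^sub>M i\<in>{1..m}. count_space (UNIV :: bool list set)) = count_space (PiE {1..m} (\<lambda>_. UNIV))"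
      by (rule count_space_PiM_finite) auto
    show ?thesis unfolding eq
      by (rule measurable_pair_measure_countable1)
        (auto intro!: countable_PiE measurable_estimator \<psi> simp: g_def)
  qed
  moreover have "estimator s \<psi> n m B d = g (\<lambda>i\<in>{1..m}. Y i (d i))" for d
  proof -
    have "\<exists>d'. \<forall>i\<in>{1..m}. Y i (d' i) = (\<lambda>i\<in>{1..m}. Y i (d i)) i" by (intro exI[of _ d]) simp
    from someI_ex[OF this] show ?thesis unfolding g_def
      by (intro estimator_message_cong[of m a]) (auto simp: Y_def)
  qed
  moreover have "Y i \<in> measurable (local_space (n div m)) (count_space UNIV)" for i
    unfolding Y_def by (rule measurable_message[OF \<psi>])
  ultimately show ?thesis
    unfolding dist_estimators_def mem_Collect_eq using len
    by (intro exI[of _ Y] exI[of _ g] conjI ballI) (auto simp: Y_def)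
qed

section \<open>Blocks of machines and message lengths\<close>

text \<open>The senders are delimited by integer division, the average of the central machine by
  real end points. These equivalences show that both describe the same machines.\<close>

lemma div_less_real_iff:
  assumes "e > 0"
  shows "real a / real e < real i \<longleftrightarrow> a div e + 1 \<le> i" "real i \<le> real a / real e \<longleftrightarrow> i \<le> a div e"
proof -
  have "real a / real e < real i \<longleftrightarrow> real a < real (i * e)" using assms by (simp add: divide_less_eq)
  also have "\<dots> \<longleftrightarrow> a div e < i" using assms unfolding of_nat_less_iff by (simp add: div_less_iff_less_mult)
  finally show "real a / real e < real i \<longleftrightarrow> a div e + 1 \<le> i" by auto
  have "real i \<le> real a / real e \<longleftrightarrow> real (i * e) \<le> real a" using assms by (simp add: le_divide_eq)
  also have "\<dots> \<longleftrightarrow> i \<le> a div e" using assms unfolding of_nat_le_iff by (simp add: less_eq_div_iff_mult_less_eq)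
  finally show "real i \<le> real a / real e \<longleftrightarrow> i \<le> a div e" .
qed

lemma eta_bounds:
  assumes "m \<ge> 1" shows "1 \<le> eta s n m B" "eta s n m B \<le> m"
  using assms by (auto simp: eta_def)

text \<open>With \<open>l = \<lceil>x / b\<rceil>\<close> the block containing position x,
  \<open>mu\<close> is \<open>l - 1\<close>, and the averaged machines are exactly the senders of
  block l. The block contains at least \<open>m div e\<close> machines.\<close>

lemma averaged_block:
  assumes m: "m \<ge> 1" and b: "block_size n B \<ge> 1" and k: "k < 2 ^ j"
    and cut: "real (2 ^ j + k) \<le> cutoff s n m B"
  shows "\<And>i. i \<in> averaged s n m B j k \<Longrightarrow> transmits s n m B i j k"
    and "real m / (2 * real (eta s n m B)) \<le> real (card (averaged s n m B j k))"
proof -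
  define e where "e = eta s n m B"
  define b where "b = block_size n B"
  define x where "x = 2 ^ j + k"
  define l where "l = nat \<lceil>real x / real b\<rceil>"
  have e: "1 \<le> e" "e \<le> m" using eta_bounds[OF m] by (auto simp: e_def)
  have b1: "b \<ge> 1" using b by (simp add: b_def)
  have x1: "x \<ge> 1" using one_le_power[of "2::nat" j] unfolding x_def by linarith
  have "real x \<le> real (e * b)" using cut by (simp add: cutoff_def e_def b_def x_def)
  then have xe: "x \<le> e * b" unfolding of_nat_le_iff .
  have xm: "real x \<le> max_index s n" using cut by (simp add: cutoff_def x_def)
  have "0 < real x / real b" using b1 x1 by simp
  then have "1 \<le> \<lceil>real x / real b\<rceil>" by linarith
  then have lc: "int l = \<lceil>real x / real b\<rceil>" "l \<ge> 1" unfolding l_def by linarith+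
  have "real l - 1 < real x / real b" "real x / real b \<le> real l"
    using lc(1) by linarith+
  then have "(real l - 1) * real b < real x" "real x \<le> real l * real b"
    using b1 by (auto simp: less_divide_eq divide_le_eq)
  moreover have r: "(real l - 1) * real b = real ((l - 1) * b)" "real l * real b = real (l * b)"
    using lc by simp_all
  ultimately have lx: "(l - 1) * b < x" "x \<le> l * b"
    unfolding r by (simp_all only: of_nat_less_iff of_nat_le_iff)
  have "(l - 1) * b < e * b" using lx(1) xe by (rule less_le_trans)
  then have "l - 1 < e" by simp
  then have le: "l \<le> e" using lc(2) by linarith
  have mu: "of_int (mu n B j k) = real (l - 1)" "of_int (mu n B j k) + 1 = real l"
    using lc by (auto simp: mu_def x_def b_def divide_inverse)
  have avg: "averaged s n m B j k = {(l - 1) * m div e + 1..l * m div e}"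
  proof -
    have "l * m div e \<le> e * m div e" using le by (intro div_le_mono mult_le_mono1)
    then have lm: "l * m div e \<le> m" using e by simp
    have eqs: "real (l - 1) * real m / real e = real ((l - 1) * m) / real e"
      "real l * real m / real e = real (l * m) / real e" by simp_all
    have e0: "0 < e" using e by simp
    show ?thesis unfolding averaged_def unfolding mu(2) unfolding mu(1) e_def[symmetric] eqs div_less_real_iff[OF e0]
      using lm by auto
  qed
  show "transmits s n m B i j k" if "i \<in> averaged s n m B j k" for i
    using that k xm lx le lc(2) unfolding transmits_def avg e_def[symmetric] b_def[symmetric] x_def[symmetric]
    by (intro conjI bexI[of _ l]) auto
  have lm: "l * m = (l - 1) * m + m" using lc(2) by (cases l) auto
  have "(l - 1) * m div e + m div e \<le> l * m div e"
    unfolding lm div_add1_eq[of "(l - 1) * m" m e] by (rule le_add1)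
  then have c1: "m div e \<le> card (averaged s n m B j k)" unfolding avg by simp
  \<comment> \<open>Since \<open>e \<le> m\<close>, the quotient is at least 1, so the remainder
    lost in the floor costs at most a factor 2.\<close>
  have q: "m div e \<ge> 1" using e by (simp add: less_eq_div_iff_mult_less_eq)
  have "m = e * (m div e) + m mod e" by simp
  also have "\<dots> \<le> e * (m div e) + e" using mod_less_divisor[of e m] e by linarith
  also have "\<dots> \<le> 2 * e * (m div e)" using mult_le_mono2[OF q, of e] by simp
  finally have "real m \<le> real (2 * e * (m div e))" unfolding of_nat_le_iff .
  then have "real m / (2 * real e) \<le> real (m div e)" using e by (simp add: divide_le_eq mult_ac)
  then show "real m / (2 * real (eta s n m B)) \<le> real (card (averaged s n m B j k))"
    using c1 unfolding e_def by linarith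
qed

text \<open>The estimated coefficient before any digits are cut. Unlike the truncated version it is
  a plain mean of independent observations, so its moment generating function factorizes.\<close>

definition local_average ::
  "real \<Rightarrow> (nat \<Rightarrow> nat \<Rightarrow> real \<Rightarrow> real) \<Rightarrow> nat \<Rightarrow> nat \<Rightarrow> real \<Rightarrow> full_data \<Rightarrow> nat \<Rightarrow> nat \<Rightarrow> real" where
  "local_average s \<psi> n m B d j k =
     (\<Sum>i\<in>averaged s n m B j k. local_coeff \<psi> n m (d i) j k) / real (card (averaged s n m B j k))"

lemma est_coeff_error:
  assumes n: "n \<ge> 1" and m: "m \<ge> 1" and b: "block_size n B \<ge> 1" and k: "k < 2 ^ j"
    and cut: "real (2 ^ j + k) \<le> cutoff s n m B"
  shows "\<bar>est_coeff s \<psi> n m B d j k - local_average s \<psi> n m B d j k\<bar> \<le> 2 / sqrt (real n)"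
proof -
  define A where "A = averaged s n m B j k"
  define y where "y i = local_coeff \<psi> n m (d i) j k" for i
  note av = averaged_block[OF m b k cut, folded A_def]
  have "0 < real m / (2 * real (eta s n m B))" using m eta_bounds[OF m, of s n B] by simp
  then have A: "real (card A) > 0" using av(2) by linarith
  have "est_coeff s \<psi> n m B d j k = (\<Sum>i\<in>A. decode n (trans_approx n (y i))) / real (card A)"
    using cut av(1) by (simp add: est_coeff_def A_def[symmetric] received_def y_def)
  then have "\<bar>est_coeff s \<psi> n m B d j k - local_average s \<psi> n m B d j k\<bar>
     = \<bar>\<Sum>i\<in>A. decode n (trans_approx n (y i)) - y i\<bar> / real (card A)"
    by (simp add: local_average_def A_def[symmetric] y_def[symmetric] sum_subtractf diff_divide_distrib[symmetric])
  also have "\<dots> \<le> (\<Sum>i\<in>A. \<bar>decode n (trans_approx n (y i)) - y i\<bar>) / real (card A)"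
    by (intro divide_right_mono sum_abs) auto
  also have "\<dots> \<le> (\<Sum>i\<in>A. 2 / sqrt (real n)) / real (card A)"
    using two_powi_lowest_digit_le[OF n] decode_trans_approx_error
    by (intro divide_right_mono sum_mono) (auto intro: order_trans)
  also have "\<dots> = 2 / sqrt (real n)" using A by simp
  finally show ?thesis .
qed

text \<open>One sign bit and \<open>1 - lowest_digit n\<close> digits, which is what a number of modulus below \<open>2\<close> needs.\<close>

definition pad_length :: "nat \<Rightarrow> nat" where
  "pad_length n = nat (2 - lowest_digit n)"

lemma pad_length_le:
  assumes "n \<ge> 1" shows "real (pad_length n) \<le> 2 + log 2 (real n) / 2"
proof -
  have "- (1/2) * log 2 (real n) \<le> real_of_int (lowest_digit n)"
    unfolding lowest_digit_def by (rule le_of_int_ceiling)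
  moreover have "0 \<le> log 2 (real n)" using assms by simp
  ultimately show ?thesis unfolding pad_length_def by linarith
qed

text \<open>Only digits above position 0 exceed the padded length, and there are at most
  \<open>log 2 \<bar>x\<bar>\<close> of them. The crude linear bound reduces the expected length to
  a first absolute moment.\<close>

lemma length_trans_approx_le:
  assumes n: "n \<ge> 1"
  shows "real (length (trans_approx n x) - pad_length n) \<le> 2 * \<bar>x\<bar>"
proof (cases "x = 0")
  case True
  then have "length (trans_approx n x) \<le> 1" by (simp add: trans_approx_def)
  moreover have "lowest_digit n \<le> 0" 
    unfolding lowest_digit_def using n by simp
  then have "pad_length n \<ge> 1" by (simp add: pad_length_def)
  ultimately show ?thesis using True by simp
next
  case False
  define h where "h = \<lfloor>log 2 \<bar>x\<bar>\<rfloor>"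
  have lo: "lowest_digit n \<le> 0" 
    unfolding lowest_digit_def using n by simp
  have "length (trans_approx n x) = 1 + nat (h - lowest_digit n + 1)"
    using False by (simp add: trans_approx_def h_def)
  then have "int (length (trans_approx n x) - pad_length n) \<le> max 0 h"
    using lo by (auto simp: pad_length_def)
  then have "real (length (trans_approx n x) - pad_length n) \<le> max 0 (real_of_int h)"
    by linarith
  also have "\<dots> \<le> 2 * \<bar>x\<bar>"
  proof -
    have "real_of_int h \<le> log 2 \<bar>x\<bar>" by (simp add: h_def)
    also have "\<dots> = ln \<bar>x\<bar> / ln 2" by (simp add: log_def)
    also have "\<dots> \<le> 2 * \<bar>x\<bar>"
    proof (cases "ln \<bar>x\<bar> \<ge> 0")
      case True
      have "ln \<bar>x\<bar> \<le> \<bar>x\<bar>" using ln_le_minus_one[of "\<bar>x\<bar>"] False by simp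
      then have "ln \<bar>x\<bar> / ln 2 \<le> \<bar>x\<bar> / (1 / 2)"
        using True ln2_ge_two_thirds by (intro frac_le) auto
      then show ?thesis by simp
    next
      case False
      then have "ln \<bar>x\<bar> / ln 2 \<le> 0" by (intro divide_nonpos_pos) auto
      then show ?thesis by linarith
    qed
    finally show ?thesis by simp
  qed
  finally show ?thesis .
qed

text \<open>Each coefficient costs one separator bit, a body of \<open>pad_length n\<close> bits, at
  most \<open>2 + log 2 n / 2\<close>, and its excess twice, once in the header and once in the
  body; twice \<open>2 * \<bar>x\<bar>\<close> gives the 4.\<close>

lemma length_message_le:
  assumes n: "n \<ge> 1"
  shows "real (length (message (pad_length n) s \<psi> n m B i d))
    \<le> (\<Sum>p\<in>{(j, k). transmits s n m B i j k}. 3 + log 2 (real n) / 2 + 4 * \<bar>local_coeff \<psi> n m d (fst p) (snd p)\<bar>)"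
proof -
  have one: "real (length (pad_code (pad_length n) (trans_approx n x))) \<le> 3 + log 2 (real n) / 2 + 4 * \<bar>x\<bar>" for x
    using length_trans_approx_le[OF n, of x] pad_length_le[OF n]
    by (simp add: length_pad_code)
  have "real (length (message (pad_length n) s \<psi> n m B i d))
     = (\<Sum>p\<leftarrow>index_list s n m B i. real (length (pad_code (pad_length n) (trans_approx n (local_coeff \<psi> n m d (fst p) (snd p))))))"
    by (simp add: message_def length_concat case_prod_unfold comp_def flip: sum_list_of_nat)
  also have "\<dots> = (\<Sum>p\<in>set (index_list s n m B i). real (length (pad_code (pad_length n) (trans_approx n (local_coeff \<psi> n m d (fst p) (snd p))))))"
    by (rule sum_list_distinct_conv_sum_set) (rule index_list)
  also have "\<dots> \<le> (\<Sum>p\<in>set (index_list s n m B i). 3 + log 2 (real n) / 2 + 4 * \<bar>local_coeff \<psi> n m d (fst p) (snd p)\<bar>)"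
    by (intro sum_mono one)
  finally show ?thesis by (simp add: index_list)
qed

section \<open>Functions in a Besov ball\<close>

abbreviation unit_measure :: "real measure" where
  "unit_measure \<equiv> restrict_space lborel {0..1}"

lemma prob_space_unit_measure: "prob_space unit_measure"
  by (rule prob_spaceI) (simp add: emeasure_restrict_space)

lemma borel_measurable_unit_measure:
  "f \<in> borel_measurable borel \<Longrightarrow> f \<in> borel_measurable unit_measure"
  by (intro measurable_restrict_space1) simp

lemma inner_unit_eq: "inner_unit f g = (\<integral>x. f x * g x \<partial>unit_measure)"
  unfolding inner_unit_def set_lebesgue_integral_def by (subst integral_restrict_space) auto

lemma l2_unit_iff:
  "f \<in> l2_unit \<longleftrightarrow> f \<in> borel_measurable borel \<and> integrable unit_measure (\<lambda>x. (f x)\<^sup>2)"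
  unfolding l2_unit_def set_integrable_def by (subst integrable_restrict_space) auto

lemma AE_unit_measure_iff:
  "(AE x in unit_measure. P x) \<longleftrightarrow> (AE x in lborel. x \<in> {0..1} \<longrightarrow> P x)"
  by (subst AE_restrict_space_iff) auto

lemma integrable_unit_bounded:
  assumes "f \<in> borel_measurable borel" "AE x in unit_measure. \<bar>f x\<bar> \<le> (K::real)"
  shows "integrable unit_measure f"
proof -
  interpret prob_space unit_measure by (rule prob_space_unit_measure)
  show ?thesis
    by (rule integrable_const_bound[where B=K]) (use assms borel_measurable_unit_measure in auto)
qed

lemma l2_unit_mult_integrable:
  assumes "f \<in> l2_unit" "g \<in> borel_measurable borel" "\<And>x. \<bar>g x\<bar> \<le> K"
  shows "integrable unit_measure (\<lambda>x. f x * g x)"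
proof (rule Bochner_Integration.integrable_bound)
  interpret prob_space unit_measure by (rule prob_space_unit_measure)
  have f: "f \<in> borel_measurable borel" "integrable unit_measure (\<lambda>x. (f x)\<^sup>2)"
    using assms by (auto simp: l2_unit_iff)
  show "integrable unit_measure (\<lambda>x. (1 + (f x)\<^sup>2) * K)" using f by auto
  show "(\<lambda>x. f x * g x) \<in> borel_measurable unit_measure"
    using f assms by (intro borel_measurable_unit_measure) measurable
  show "AE x in unit_measure. norm (f x * g x) \<le> norm ((1 + (f x)\<^sup>2) * K)"
  proof (intro AE_I2)
    fix x
    have "0 \<le> (\<bar>f x\<bar> - 1)\<^sup>2" by simp
    then have "\<bar>f x\<bar> \<le> 1 + (f x)\<^sup>2" by (simp add: power2_diff) 
    moreover have "K \<ge> 0" using assms(3)[of x] by linarith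
    ultimately show "norm (f x * g x) \<le> norm ((1 + (f x)\<^sup>2) * K)"
      using assms(3)[of x] by (auto simp: abs_mult intro!: mult_mono)
  qed
qed

section \<open>Coefficient decay and the wavelet expansion of a Besov function\<close>

locale bounded_wavelets =
  fixes \<psi> :: "nat \<Rightarrow> nat \<Rightarrow> real \<Rightarrow> real" and C :: real
  assumes onb: "orthonormal_basis_unit \<psi>"
    and level_sum: "\<And>j x. (\<Sum>k<2^j. \<bar>\<psi> j k x\<bar>) \<le> C * 2 powr (real j / 2)"
    and C_pos: "C > 0"
begin

lemma psi_measurable: "k < 2 ^ j \<Longrightarrow> \<psi> j k \<in> borel_measurable borel"
  using onb by (auto simp: orthonormal_basis_unit_def l2_unit_iff)

lemma psi_bound: "k < 2 ^ j \<Longrightarrow> \<bar>\<psi> j k x\<bar> \<le> C * 2 powr (real j / 2)"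
  using level_sum[where j=j and x=x] member_le_sum[of k "{..<2 ^ j}" "\<lambda>k. \<bar>\<psi> j k x\<bar>"] by auto

lemma inner_psi:
  "k < 2 ^ j \<Longrightarrow> k' < 2 ^ j' \<Longrightarrow> (\<integral>x. \<psi> j k x * \<psi> j' k' x \<partial>unit_measure) = of_bool (j = j' \<and> k = k')"
  using onb unfolding orthonormal_basis_unit_def inner_unit_eq[symmetric] by blast

lemma besov_coeff_bound:
  assumes "f \<in> besov_ball s \<psi> L" "k < 2 ^ j" "L > 0"
  shows "\<bar>inner_unit f (\<psi> j k)\<bar> \<le> L * 2 powr (- (real j * (s + 1/2)))"
proof -
  have "ennreal (2 powr (real j * (s + 1/2)) * \<bar>inner_unit f (\<psi> j k)\<bar>) \<le> besov_norm s \<psi> f"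
    unfolding besov_norm_def using assms(2) by (intro SUP_upper2[of "(j, k)"]) auto
  also have "\<dots> \<le> ennreal L" using assms(1) by (simp add: besov_ball_def less_imp_le)
  finally have "2 powr (real j * (s + 1/2)) * \<bar>inner_unit f (\<psi> j k)\<bar> \<le> L"
    using assms(3) by (simp add: ennreal_le_iff)
  then have "\<bar>inner_unit f (\<psi> j k)\<bar> \<le> L / 2 powr (real j * (s + 1/2))"
    by (simp add: pos_le_divide_eq mult.commute)
  then show ?thesis by (simp only: powr_minus_divide times_divide_eq_right mult_1_right)
qed

text \<open>The decay \<open>2 powr (- j * (s + 1/2))\<close> of the coefficients meets the level
  sum \<open>2 powr (j / 2)\<close>. Arbitrary subsets S are allowed because the cutoff may fall
  inside a level.\<close>

lemma level_term_bound:
  assumes "f \<in> besov_ball s \<psi> L" "L > 0" "S \<subseteq> {..<2 ^ j}"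
  shows "\<bar>\<Sum>k\<in>S. inner_unit f (\<psi> j k) * \<psi> j k x\<bar> \<le> L * C * (2 powr (- s)) ^ j"
proof -
  have "\<bar>\<Sum>k\<in>S. inner_unit f (\<psi> j k) * \<psi> j k x\<bar> \<le> (\<Sum>k\<in>S. \<bar>inner_unit f (\<psi> j k) * \<psi> j k x\<bar>)"
    by (rule sum_abs)
  also have "\<dots> \<le> (\<Sum>k<2^j. \<bar>inner_unit f (\<psi> j k) * \<psi> j k x\<bar>)"
    using assms(3) by (intro sum_mono2) auto
  also have "\<dots> \<le> (\<Sum>k<2^j. L * 2 powr (- (real j * (s + 1/2))) * \<bar>\<psi> j k x\<bar>)"
    unfolding abs_mult by (intro sum_mono mult_right_mono besov_coeff_bound[OF assms(1) _ assms(2)]) auto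
  also have "\<dots> = L * 2 powr (- (real j * (s + 1/2))) * (\<Sum>k<2^j. \<bar>\<psi> j k x\<bar>)"
    by (simp add: sum_distrib_left)
  also have "\<dots> \<le> L * 2 powr (- (real j * (s + 1/2))) * (C * 2 powr (real j / 2))"
    using assms(2) by (intro mult_left_mono level_sum) auto
  also have "\<dots> = L * C * (2 powr (- (real j * (s + 1/2))) * 2 powr (real j / 2))" by simp
  also have "2 powr (- (real j * (s + 1/2))) * 2 powr (real j / 2) = 2 powr (- s * real j)"
    by (subst powr_add[symmetric]) (simp add: algebra_simps)
  also have "\<dots> = (2 powr (- s)) ^ j" using powr_realpow[of "2 powr (- s)" j] by (simp add: powr_powr)
  finally show ?thesis .
qed

text \<open>The wavelet series converges uniformly. Its sum has the same coefficients as \<open>f\<close>, so it equals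
  \<open>f\<close> by completeness of the basis.\<close>

lemma besov_expansion:
  assumes f: "f \<in> besov_ball s \<psi> L" and L: "L > 0" and s: "s > 0"
  shows "AE x in unit_measure. f x = (\<Sum>j. \<Sum>k<2^j. inner_unit f (\<psi> j k) * \<psi> j k x)"
proof -
  interpret prob_space unit_measure by (rule prob_space_unit_measure)
  define q where "q = 2 powr (- s)"
  have q: "0 < q" "q < 1" using s by (auto simp: q_def powr_less_one)
  define g' where "g' j x = (\<Sum>k<2^j. inner_unit f (\<psi> j k) * \<psi> j k x)" for j x
  define g where "g x = (\<Sum>j. g' j x)" for x
  have g'b: "\<bar>g' j x\<bar> \<le> L * C * q ^ j" for j x
    unfolding g'_def q_def by (rule level_term_bound[OF f L]) simp
  have geo: "summable (\<lambda>j. K * q ^ j)" for K using q by (intro summable_mult summable_geometric) auto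
  have sg: "summable (\<lambda>j. \<bar>g' j x\<bar>)" for x
    by (rule summable_comparison_test'[OF geo[of "L * C"], of 0]) (use g'b in auto)
  have g'm [measurable]: "g' j \<in> borel_measurable borel" for j
    unfolding g'_def[abs_def] using psi_measurable by (intro borel_measurable_sum borel_measurable_times) auto
  have gm [measurable]: "g \<in> borel_measurable borel" unfolding g_def[abs_def] by measurable
  define G where "G = (\<Sum>j. L * C * q ^ j)"
  have gb: "\<bar>g x\<bar> \<le> G" for x
  proof -
    have "\<bar>g x\<bar> \<le> (\<Sum>j. \<bar>g' j x\<bar>)" unfolding g_def by (rule summable_rabs[OF sg])
    also have "\<dots> \<le> G" unfolding G_def by (rule suminf_le[OF g'b sg geo])
    finally show ?thesis .
  qed
  have f2: "f \<in> l2_unit" using f by (simp add: besov_ball_def)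
  have fm [measurable]: "f \<in> borel_measurable borel" using f2 by (simp add: l2_unit_iff)
  \<comment> \<open>Completeness speaks about square integrable functions only. Since g is bounded
    by a geometric series, the mixed term and \<open>g\<^sup>2\<close> are integrable.\<close>
  have diff: "(\<lambda>x. f x - g x) \<in> l2_unit"
  proof -
    have "integrable unit_measure (\<lambda>x. (f x)\<^sup>2 - 2 * (f x * g x) + (g x)\<^sup>2)"
    proof (intro Bochner_Integration.integrable_add Bochner_Integration.integrable_diff integrable_mult_right)
      show "integrable unit_measure (\<lambda>x. (f x)\<^sup>2)" using f2 by (simp add: l2_unit_iff)
      show "integrable unit_measure (\<lambda>x. f x * g x)" by (rule l2_unit_mult_integrable[OF f2 gm gb])
      show "integrable unit_measure (\<lambda>x. (g x)\<^sup>2)"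
        by (rule integrable_unit_bounded[where K="G\<^sup>2"])
          (use power_mono[OF gb, where n=2] in auto)
    qed
    then show ?thesis by (simp add: l2_unit_iff power2_diff algebra_simps)
  qed
  have "inner_unit (\<lambda>x. f x - g x) (\<psi> j k) = 0" if k: "k < 2 ^ j" for j k
  proof -
    note psi_measurable[OF k, measurable]
    define P where "P = C * 2 powr (real j / 2)"
    have P: "\<bar>\<psi> j k x\<bar> \<le> P" for x unfolding P_def by (rule psi_bound[OF k])
    have P0: "P \<ge> 0" using P[of 0] by linarith
    have ppi: "integrable unit_measure (\<lambda>x. \<psi> j' k' x * \<psi> j k x)" if "k' < 2 ^ j'" for j' k'
    proof (rule integrable_unit_bounded[where K="C * 2 powr (real j' / 2) * P"])
      show "(\<lambda>x. \<psi> j' k' x * \<psi> j k x) \<in> borel_measurable borel" using psi_measurable[OF that] by measurable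
      show "AE x in unit_measure. \<bar>\<psi> j' k' x * \<psi> j k x\<bar> \<le> C * 2 powr (real j' / 2) * P"
        unfolding abs_mult using psi_bound[OF that] P C_pos by (intro AE_I2 mult_mono) auto
    qed
    have int: "(\<integral>x. g' j' x * \<psi> j k x \<partial>unit_measure) = (if j' = j then inner_unit f (\<psi> j k) else 0)" for j'
    proof -
      have "(\<integral>x. g' j' x * \<psi> j k x \<partial>unit_measure)
        = (\<integral>x. (\<Sum>k'<2^j'. inner_unit f (\<psi> j' k') * (\<psi> j' k' x * \<psi> j k x)) \<partial>unit_measure)"
        unfolding g'_def by (simp add: sum_distrib_right mult.assoc)
      also have "\<dots> = (\<Sum>k'<2^j'. inner_unit f (\<psi> j' k') * (\<integral>x. \<psi> j' k' x * \<psi> j k x \<partial>unit_measure))"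
        using ppi by (subst Bochner_Integration.integral_sum) auto
      also have "\<dots> = (\<Sum>k'<2^j'. inner_unit f (\<psi> j' k') * of_bool (j' = j \<and> k' = k))"
        using inner_psi k by (intro sum.cong) auto
      also have "\<dots> = (if j' = j then inner_unit f (\<psi> j k) else 0)"
        using k by (auto simp: of_bool_def if_distrib[of "\<lambda>x. _ * x"] cong: if_cong)
      finally show ?thesis .
    qed
    have gpi: "integrable unit_measure (\<lambda>x. g' j' x * \<psi> j k x)" for j'
      unfolding g'_def sum_distrib_right mult.assoc using ppi by (intro Bochner_Integration.integrable_sum integrable_mult_right) auto
    have b: "\<bar>g' j' x * \<psi> j k x\<bar> \<le> L * C * P * q ^ j'" for j' x
    proof -
      have "\<bar>g' j' x * \<psi> j k x\<bar> \<le> (L * C * q ^ j') * P"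
        unfolding abs_mult using g'b[of j' x] P[of x] P0 by (intro mult_mono) auto
      then show ?thesis by (simp add: mult_ac)
    qed
    \<comment> \<open>The geometric majorant justifies exchanging series and integral; by
      orthonormality a single level survives.\<close>
    have "(\<lambda>j'. \<integral>x. g' j' x * \<psi> j k x \<partial>unit_measure) sums (\<integral>x. (\<Sum>j'. g' j' x * \<psi> j k x) \<partial>unit_measure)"
    proof (rule sums_integral[OF gpi])
      show "AE x in unit_measure. summable (\<lambda>j'. norm (g' j' x * \<psi> j k x))"
        by (intro AE_I2 summable_comparison_test'[OF geo[of "L * C * P"], of 0]) (use b in auto)
      have "norm (\<integral>x. norm (g' j' x * \<psi> j k x) \<partial>unit_measure) \<le> L * C * P * q ^ j'" for j'
      proof -
        have "(\<integral>x. norm (g' j' x * \<psi> j k x) \<partial>unit_measure) \<le> (\<integral>x. L * C * P * q ^ j' \<partial>unit_measure)"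
          using b gpi by (intro integral_mono) auto
        then show ?thesis by (simp add: prob_space[simplified])
      qed
      then show "summable (\<lambda>j'. \<integral>x. norm (g' j' x * \<psi> j k x) \<partial>unit_measure)"
        by (intro summable_comparison_test'[OF geo[of "L * C * P"], of 0]) auto
    qed
    then have "(\<Sum>j'. (if j' = j then inner_unit f (\<psi> j k) else 0)) = (\<integral>x. (\<Sum>j'. g' j' x * \<psi> j k x) \<partial>unit_measure)"
      unfolding int by (rule sums_unique[symmetric])
    moreover have "(\<Sum>j'. (if j' = j then inner_unit f (\<psi> j k) else 0)) = inner_unit f (\<psi> j k)"
      using sums_single[of j "\<lambda>_. inner_unit f (\<psi> j k)"] by (rule sums_unique[symmetric])
    moreover have "(\<Sum>j'. g' j' x * \<psi> j k x) = g x * \<psi> j k x" for x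
      unfolding g_def by (rule suminf_mult2[OF summable_rabs_cancel[OF sg], symmetric])
    ultimately have ig: "(\<integral>x. g x * \<psi> j k x \<partial>unit_measure) = inner_unit f (\<psi> j k)" by simp
    have "(\<integral>x. (f x - g x) * \<psi> j k x \<partial>unit_measure) = (\<integral>x. f x * \<psi> j k x \<partial>unit_measure) - (\<integral>x. g x * \<psi> j k x \<partial>unit_measure)"
    proof (subst Bochner_Integration.integral_diff[symmetric])
      show "integrable unit_measure (\<lambda>x. f x * \<psi> j k x)" by (rule l2_unit_mult_integrable[OF f2 _ P]) measurable
      show "integrable unit_measure (\<lambda>x. g x * \<psi> j k x)"
      proof (rule integrable_unit_bounded[where K="G * P"])
        have "G \<ge> 0" using gb[of 0] by linarith
        then show "AE x in unit_measure. \<bar>g x * \<psi> j k x\<bar> \<le> G * P"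
          unfolding abs_mult by (intro AE_I2 mult_mono gb P) auto
      qed measurable
    qed (simp add: left_diff_distrib)
    then show ?thesis using ig by (simp add: inner_unit_eq)
  qed
  then have "AE x in lborel. x \<in> {0..1} \<longrightarrow> f x - g x = 0"
    using onb diff unfolding orthonormal_basis_unit_def by blast
  then have "AE x in unit_measure. f x - g x = 0" unfolding AE_unit_measure_iff .
  then show ?thesis by eventually_elim (simp add: g_def g'_def)
qed

end

section \<open>Moment generating functions of one observation\<close>

abbreviation noise_measure :: "real measure" where
  "noise_measure \<equiv> density lborel std_normal_density"

text \<open>The design law lives on the open interval, the inner products on the closed one; the end
  points are null.\<close>

lemma nn_integral_uniform_eq_unit_measure:
  assumes [measurable]: "h \<in> borel_measurable borel"
  shows "(\<integral>\<^sup>+ t. h t \<partial>uniform_measure lborel {0<..<1}) = (\<integral>\<^sup>+ t. h t \<partial>unit_measure)"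
proof -
  have "(\<integral>\<^sup>+ t. h t \<partial>uniform_measure lborel {0<..<1}) = (\<integral>\<^sup>+ t. h t * indicator {0<..<1} t \<partial>lborel)"
    by (subst nn_integral_uniform_measure) (auto simp: divide_ennreal_def)
  also have "\<dots> = (\<integral>\<^sup>+ t. h t * indicator {0..1} t \<partial>lborel)"
  proof (rule nn_integral_cong_AE)
    have "AE t in lborel. t \<noteq> (0::real)" "AE t in lborel. t \<noteq> (1::real)" by (auto intro: AE_lborel_singleton)
    then show "AE t in lborel. h t * indicator {0<..<1} t = h t * indicator {0..1} t"
      by eventually_elim (auto simp: indicator_def)
  qed
  also have "\<dots> = (\<integral>\<^sup>+ t. h t \<partial>unit_measure)"
    by (subst nn_integral_restrict_space) auto
  finally show ?thesis .
qed

lemma prob_space_obs_law: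
  assumes [measurable]: "f \<in> borel_measurable borel"
  shows "prob_space (obs_law \<sigma> f)"
proof -
  interpret U: prob_space "uniform_measure lborel {0<..<1::real}"
    by (rule prob_space_uniform_measure) auto
  interpret N: prob_space noise_measure by (rule prob_space_normal_density) simp
  interpret UN: pair_prob_space "uniform_measure lborel {0<..<1::real}" noise_measure ..
  show ?thesis unfolding obs_law_def
    by (rule UN.prob_space_distr) measurable
qed

lemma nn_integral_obs_law:
  assumes [measurable]: "f \<in> borel_measurable borel" "h \<in> borel_measurable (borel \<Otimes>\<^sub>M borel)"
  shows "(\<integral>\<^sup>+ p. h p \<partial>obs_law \<sigma> f) = (\<integral>\<^sup>+ t. \<integral>\<^sup>+ e. h (t, f t + \<sigma> * e) \<partial>noise_measure \<partial>unit_measure)"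
proof -
  interpret N: prob_space noise_measure by (rule prob_space_normal_density) simp
  have "(\<integral>\<^sup>+ p. h p \<partial>obs_law \<sigma> f) =
     (\<integral>\<^sup>+ p. h (fst p, f (fst p) + \<sigma> * snd p) \<partial>(uniform_measure lborel {0<..<1} \<Otimes>\<^sub>M noise_measure))"
    unfolding obs_law_def by (subst nn_integral_distr) (auto simp: case_prod_unfold)
  also have "\<dots> = (\<integral>\<^sup>+ t. \<integral>\<^sup>+ e. h (t, f t + \<sigma> * e) \<partial>noise_measure \<partial>uniform_measure lborel {0<..<1})"
    by (subst N.nn_integral_fst[symmetric]) auto
  also have "\<dots> = (\<integral>\<^sup>+ t. \<integral>\<^sup>+ e. h (t, f t + \<sigma> * e) \<partial>noise_measure \<partial>unit_measure)"
    by (rule nn_integral_uniform_eq_unit_measure) measurable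
  finally show ?thesis .
qed

lemma noise_mgf: "(\<integral>\<^sup>+ e. ennreal (exp (v * e)) \<partial>noise_measure) = ennreal (exp (v\<^sup>2 / 2))"
proof -
  have "(\<integral>\<^sup>+ e. ennreal (exp (v * e)) \<partial>noise_measure)
    = (\<integral>\<^sup>+ e. ennreal (exp (v\<^sup>2 / 2)) * ennreal (normal_density v 1 e) \<partial>lborel)"
  proof (subst nn_integral_density)
    show "(\<integral>\<^sup>+ x. ennreal (std_normal_density x) * ennreal (exp (v * x)) \<partial>lborel)
      = (\<integral>\<^sup>+ e. ennreal (exp (v\<^sup>2 / 2)) * ennreal (normal_density v 1 e) \<partial>lborel)"
    proof (rule nn_integral_cong)
      fix x :: real
      have "- x\<^sup>2 / 2 + v * x = v\<^sup>2 / 2 + - (x - v)\<^sup>2 / 2" by (simp add: power2_diff field_simps)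
      then have "exp (- x\<^sup>2 / 2) * exp (v * x) = exp (v\<^sup>2 / 2) * exp (- (x - v)\<^sup>2 / 2)"
        by (simp only: exp_add[symmetric])
      then have "std_normal_density x * exp (v * x) = exp (v\<^sup>2 / 2) * normal_density v 1 x"
        by (simp add: normal_density_def field_simps)
      then show "ennreal (std_normal_density x) * ennreal (exp (v * x)) = ennreal (exp (v\<^sup>2 / 2)) * ennreal (normal_density v 1 x)"
        by (simp add: ennreal_mult[symmetric])
    qed
  qed auto
  also have "\<dots> = ennreal (exp (v\<^sup>2 / 2)) * (\<integral>\<^sup>+ e. ennreal (normal_density v 1 e) \<partial>lborel)"
    by (rule nn_integral_cmult) auto
  also have "(\<integral>\<^sup>+ e. ennreal (normal_density v 1 e) \<partial>lborel) = 1"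
  proof -
    interpret prob_space "density lborel (normal_density v 1)" by (rule prob_space_normal_density) simp
    show ?thesis using emeasure_space_1 by (simp add: emeasure_density)
  qed
  finally show ?thesis by simp
qed

text \<open>Estimating \<open>\<bar>e\<bar>\<close> by \<open>exp e + exp (- e)\<close> reuses the
  moment generating function. The value 4 enters only the message length, where any constant is
  affordable.\<close>

lemma noise_abs_moment: "(\<integral>\<^sup>+ e. ennreal \<bar>e\<bar> \<partial>noise_measure) \<le> 4"
proof -
  have "(\<integral>\<^sup>+ e. ennreal \<bar>e\<bar> \<partial>noise_measure) \<le> (\<integral>\<^sup>+ e. ennreal (exp (1 * e)) + ennreal (exp (-1 * e)) \<partial>noise_measure)"
  proof (rule nn_integral_mono)
    fix e :: real
    have "\<bar>e\<bar> \<le> exp (1 * e) + exp (- 1 * e)"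
      using exp_ge_add_one_self[of e] exp_ge_add_one_self[of "- e"] exp_gt_zero[of e] exp_gt_zero[of "- e"]
      by (simp add: abs_if; linarith)
    then show "ennreal \<bar>e\<bar> \<le> ennreal (exp (1 * e)) + ennreal (exp (- 1 * e))"
      by (simp add: ennreal_plus[symmetric] ennreal_leI del: ennreal_plus)
  qed
  also have "\<dots> = ennreal (exp (1\<^sup>2 / 2)) + ennreal (exp ((-1)\<^sup>2 / 2))"
    by (subst nn_integral_add) (simp_all only: noise_mgf, simp_all)
  also have "\<dots> = ennreal (2 * exp (1 / 2))" by (simp add: ennreal_plus[symmetric] del: ennreal_plus)
  also have "\<dots> \<le> ennreal 4"
  proof (rule ennreal_leI)
    have "exp (1 / 2 :: real) ^ 2 = exp 1" by (simp add: exp_of_nat_mult[symmetric])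
    moreover have "(2::real) ^ 2 = 4" by simp
    ultimately have "exp (1 / 2 :: real) ^ 2 \<le> 2 ^ 2" using exp_le by linarith
    then show "2 * exp (1 / 2) \<le> (4::real)" using power2_le_imp_le[of "exp (1/2)" 2] by simp
  qed
  finally show ?thesis by simp
qed

lemma exp_le_quadratic:
  fixes y :: real
  assumes "y \<le> 1"
  shows "exp y \<le> 1 + y + y\<^sup>2"
proof (cases "y \<ge> 0")
  case True then show ?thesis using assms by (rule exp_bound)
next
  case False
  define z where "z = - y"
  have z: "z > 0" using False by (simp add: z_def)
  \<comment> \<open>The product equals \<open>1 + z ^ 3\<close>.\<close>
  have "1 \<le> (1 - z + z\<^sup>2) * (1 + z)"
    using z by (simp add: algebra_simps power2_eq_square) 
  also have "\<dots> \<le> (1 - z + z\<^sup>2) * exp z"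
  proof (rule mult_left_mono)
    have "1 - z + z\<^sup>2 = (z - 1/2)\<^sup>2 + 3/4" by (simp add: power2_diff algebra_simps power2_eq_square)
    then show "0 \<le> 1 - z + z\<^sup>2" by (metis add_nonneg_nonneg zero_le_power2 divide_nonneg_nonneg zero_le_numeral)
  qed simp
  finally have "exp (- z) \<le> 1 - z + z\<^sup>2" by (simp add: exp_minus field_simps)
  then show ?thesis by (simp add: z_def)
qed

text \<open>The summand \<open>(u \<sigma> P)\<^sup>2 / 2\<close> comes from integrating out the Gaussian noise. For \<open>u\<close> of order at
  most \<open>1 / Q\<close> the exponent stays below \<open>1\<close>, where \<open>exp y \<le> 1 + y + y\<^sup>2\<close>, and the bound no longer
  depends on the sup norm \<open>Q\<close> of the wavelet.\<close>

lemma noise_design_mgf_le: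
  fixes A P :: "'a \<Rightarrow> real"
  assumes "prob_space M" and [measurable]: "A \<in> borel_measurable M" "P \<in> borel_measurable M"
    and A: "AE t in M. \<bar>A t\<bar> \<le> F" and P: "\<And>t. \<bar>P t\<bar> \<le> Q" and P2: "(\<integral>t. (P t)\<^sup>2 \<partial>M) = 1"
    and c: "c = (\<integral>t. A t * P t \<partial>M)" and F: "F \<ge> 0" and \<sigma>: "\<sigma> \<ge> 0" and u: "\<bar>u\<bar> * Q * (F + \<sigma>) \<le> 1 / 4"
  shows "(\<integral>\<^sup>+ t. ennreal (exp (u * (A t * P t - c) + (u * \<sigma> * P t)\<^sup>2 / 2)) \<partial>M)
     \<le> ennreal (exp (7 * (F\<^sup>2 + \<sigma>\<^sup>2) * u\<^sup>2))"
proof -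
  interpret prob_space M by fact
  have Q: "Q \<ge> 0" using P[of undefined] by linarith
  have iAP: "integrable M (\<lambda>t. A t * P t)"
  proof (rule integrable_const_bound[where B="F * Q"])
    show "AE t in M. norm (A t * P t) \<le> F * Q"
      using A by eventually_elim (auto simp: abs_mult intro!: mult_mono P F)
  qed measurable
  have iP2: "integrable M (\<lambda>t. (P t)\<^sup>2)"
    by (rule integrable_const_bound[where B="Q\<^sup>2"]) (use power_mono[OF P, where n=2] in auto)
  \<comment> \<open>The mean is bounded twice: by F, free of Q, for the second order term, and by
    \<open>F * Q\<close> to keep the exponent below 1.\<close>
  have cF: "\<bar>c\<bar> \<le> F" 
  proof -
    have "\<bar>c\<bar> \<le> (\<integral>t. \<bar>A t * P t\<bar> \<partial>M)" unfolding c by (rule integral_abs_bound)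
    also have "\<dots> \<le> (\<integral>t. F * (1/2 + (P t)\<^sup>2 / 2) \<partial>M)"
    proof (rule integral_mono_AE)
      show "AE t in M. \<bar>A t * P t\<bar> \<le> F * (1/2 + (P t)\<^sup>2 / 2)"
        using A
      proof eventually_elim
        fix t assume "\<bar>A t\<bar> \<le> F"
        have "0 \<le> (\<bar>P t\<bar> - 1)\<^sup>2" by simp
        then have "\<bar>P t\<bar> \<le> 1/2 + (P t)\<^sup>2 / 2" by (simp add: power2_diff)
        with \<open>\<bar>A t\<bar> \<le> F\<close> show "\<bar>A t * P t\<bar> \<le> F * (1/2 + (P t)\<^sup>2 / 2)"
          unfolding abs_mult using F by (intro mult_mono) auto
      qed
    qed (use iAP iP2 in auto)
    also have "\<dots> = F" using iP2 P2 by (simp add: prob_space)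
    finally show ?thesis .
  qed
  have cQ: "\<bar>c\<bar> \<le> F * Q"
  proof -
    have "\<bar>c\<bar> \<le> (\<integral>t. \<bar>A t * P t\<bar> \<partial>M)" unfolding c by (rule integral_abs_bound)
    also have "\<dots> \<le> (\<integral>t. F * Q \<partial>M)"
    proof (rule integral_mono_AE)
      show "AE t in M. \<bar>A t * P t\<bar> \<le> F * Q"
        using A by eventually_elim (auto simp: abs_mult intro!: mult_mono P F)
    qed (use iAP in auto)
    finally show ?thesis by (simp add: prob_space)
  qed
  \<comment> \<open>R is the quadratic majorant of the exponential. Its centred linear part
    integrates to zero, and the 3 comes from estimating the square of a sum of three terms.\<close>
  define R where "R t = 1 + (u * (A t * P t) - u * c) + u\<^sup>2 * (\<sigma>\<^sup>2 * (P t)\<^sup>2) / 2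
     + 3 * u\<^sup>2 * (F\<^sup>2 * (P t)\<^sup>2 + F\<^sup>2 + \<sigma>\<^sup>2 * (P t)\<^sup>2)" for t
  have pt: "AE t in M. exp (u * (A t * P t - c) + (u * \<sigma> * P t)\<^sup>2 / 2) \<le> R t"
    using A
  proof eventually_elim
    fix t assume At: "\<bar>A t\<bar> \<le> F"
    define y1 where "y1 = u * (A t * P t)"
    define y2 where "y2 = u * c"
    define y3 where "y3 = (u * \<sigma> * P t)\<^sup>2 / 2"
    define \<delta> where "\<delta> = \<bar>u\<bar> * Q * (F + \<sigma>)"
    have d: "0 \<le> \<delta>" "\<delta> \<le> 1/4" "\<bar>u\<bar> * (F * Q) \<le> \<delta>" "\<bar>u\<bar> * \<sigma> * Q \<le> \<delta>"
      using u Q F \<sigma> by (auto simp: \<delta>_def algebra_simps)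
    have "\<bar>y1\<bar> \<le> \<bar>u\<bar> * (F * Q)" unfolding y1_def abs_mult
      using At P[of t] F by (intro mult_left_mono mult_mono) auto
    then have b1: "\<bar>y1\<bar> \<le> 1/4" using d by linarith
    have "\<bar>y2\<bar> \<le> \<bar>u\<bar> * (F * Q)" unfolding y2_def abs_mult using cQ by (intro mult_left_mono) auto
    then have b2: "\<bar>y2\<bar> \<le> 1/4" using d by linarith
    have "\<bar>u * \<sigma> * P t\<bar> \<le> \<bar>u\<bar> * \<sigma> * Q" unfolding abs_mult using P[of t] \<sigma> by (intro mult_mono) auto
    then have b: "\<bar>u * \<sigma> * P t\<bar> \<le> 1" using d by linarith
    then have sq: "(u * \<sigma> * P t)\<^sup>2 \<le> 1" by (simp add: abs_square_le_1)
    have y3: "0 \<le> y3" "y3 \<le> 1/2" using sq by (auto simp: y3_def)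
    \<comment> \<open>The three bounds 1/4, 1/4 and 1/2 add up to 1, the largest argument for which
      the quadratic bound on \<open>exp\<close> is available.\<close>
    have "exp (y1 - y2 + y3) \<le> 1 + (y1 - y2 + y3) + (y1 - y2 + y3)\<^sup>2"
      using b1 b2 y3 by (intro exp_le_quadratic) linarith
    also have "(y1 - y2 + y3)\<^sup>2 \<le> 3 * (y1\<^sup>2 + y2\<^sup>2 + y3\<^sup>2)"
    proof -
      have "0 \<le> (y1 + y2)\<^sup>2 + (y1 - y3)\<^sup>2 + (y2 + y3)\<^sup>2" by simp
      then show ?thesis by (simp add: power2_eq_square algebra_simps)
    qed
    also have "y1\<^sup>2 \<le> u\<^sup>2 * (F\<^sup>2 * (P t)\<^sup>2)"
      unfolding y1_def power_mult_distrib using power_mono[OF At, of 2] by (intro mult_left_mono mult_right_mono) auto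
    also have "y2\<^sup>2 \<le> u\<^sup>2 * F\<^sup>2"
      unfolding y2_def power_mult_distrib using power_mono[OF cF, of 2] by (intro mult_left_mono) auto
    also have "y3\<^sup>2 \<le> u\<^sup>2 * (\<sigma>\<^sup>2 * (P t)\<^sup>2)"
    proof -
      have "y3\<^sup>2 \<le> y3 * 1" unfolding power2_eq_square using y3 by (intro mult_left_mono) auto
      also have "\<dots> \<le> (u * \<sigma> * P t)\<^sup>2" using zero_le_power2[of "u * \<sigma> * P t"] unfolding y3_def by linarith
      finally show ?thesis by (simp add: power_mult_distrib mult.assoc)
    qed
    finally have "exp (y1 - y2 + y3) \<le> 1 + (y1 - y2 + y3) + 3 * (u\<^sup>2 * (F\<^sup>2 * (P t)\<^sup>2) + u\<^sup>2 * F\<^sup>2 + u\<^sup>2 * (\<sigma>\<^sup>2 * (P t)\<^sup>2))"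
      by simp
    then show "exp (u * (A t * P t - c) + (u * \<sigma> * P t)\<^sup>2 / 2) \<le> R t"
      unfolding R_def y1_def y2_def y3_def by (simp add: algebra_simps power_mult_distrib)
  qed
  have iR: "integrable M R" unfolding R_def
    by (intro Bochner_Integration.integrable_add Bochner_Integration.integrable_diff integrable_mult_right
      integrable_divide_zero iAP iP2) auto
  have "(\<integral>\<^sup>+ t. ennreal (exp (u * (A t * P t - c) + (u * \<sigma> * P t)\<^sup>2 / 2)) \<partial>M) \<le> (\<integral>\<^sup>+ t. ennreal (R t) \<partial>M)"
    using pt by (intro nn_integral_mono_AE) (auto intro: ennreal_leI)
  also have "\<dots> = ennreal (\<integral>t. R t \<partial>M)"
  proof (rule nn_integral_eq_integral[OF iR])
    show "AE t in M. 0 \<le> R t" using pt by eventually_elim (meson exp_ge_zero order_trans)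
  qed
  also have "(\<integral>t. R t \<partial>M) = 1 + u\<^sup>2 * \<sigma>\<^sup>2 / 2 + 3 * u\<^sup>2 * (F\<^sup>2 + F\<^sup>2 + \<sigma>\<^sup>2)"
    unfolding R_def using iAP iP2 P2 c by (simp add: prob_space)
  \<comment> \<open>The coefficients of \<open>F\<^sup>2\<close> and \<open>\<sigma>\<^sup>2\<close>
    are 6 and 7/2; 7 covers both.\<close>
  also have "\<dots> \<le> 1 + 7 * (F\<^sup>2 + \<sigma>\<^sup>2) * u\<^sup>2" 
    using mult_nonneg_nonneg[of "u\<^sup>2" "\<sigma>\<^sup>2"] mult_nonneg_nonneg[of "u\<^sup>2" "F\<^sup>2"] by (simp add: algebra_simps)
  also have "\<dots> \<le> exp (7 * (F\<^sup>2 + \<sigma>\<^sup>2) * u\<^sup>2)" by (rule exp_ge_add_one_self)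
  finally show ?thesis by (simp add: ennreal_leI)
qed

section \<open>One observation tested against a wavelet\<close>

context bounded_wavelets
begin

lemma obs_law_mgf_le:
  assumes [measurable]: "f \<in> borel_measurable borel" and k: "k < 2 ^ j"
    and F: "AE t in unit_measure. \<bar>f t\<bar> \<le> F" "F \<ge> 0" and \<sigma>: "\<sigma> \<ge> 0"
    and u: "\<bar>u\<bar> * (C * 2 powr (real j / 2)) * (F + \<sigma>) \<le> 1 / 4"
  shows "(\<integral>\<^sup>+ p. ennreal (exp (u * (snd p * \<psi> j k (fst p) - inner_unit f (\<psi> j k)))) \<partial>obs_law \<sigma> f)
     \<le> ennreal (exp (7 * (F\<^sup>2 + \<sigma>\<^sup>2) * u\<^sup>2))"
proof -
  note psi_measurable[OF k, measurable]
  define c where "c = inner_unit f (\<psi> j k)"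
  have "(\<integral>\<^sup>+ p. ennreal (exp (u * (snd p * \<psi> j k (fst p) - c))) \<partial>obs_law \<sigma> f)
    = (\<integral>\<^sup>+ t. \<integral>\<^sup>+ e. ennreal (exp (u * (f t * \<psi> j k t - c))) * ennreal (exp ((u * \<sigma> * \<psi> j k t) * e)) \<partial>noise_measure \<partial>unit_measure)"
    by (subst nn_integral_obs_law)
      (auto intro!: nn_integral_cong simp: ennreal_mult[symmetric] exp_add[symmetric] algebra_simps)
  also have "\<dots> = (\<integral>\<^sup>+ t. ennreal (exp (u * (f t * \<psi> j k t - c) + (u * \<sigma> * \<psi> j k t)\<^sup>2 / 2)) \<partial>unit_measure)"
    by (intro nn_integral_cong, subst nn_integral_cmult)
      (auto simp: noise_mgf ennreal_mult[symmetric] exp_add[symmetric] simp del: power_mult_distrib)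
  also have "\<dots> \<le> ennreal (exp (7 * (F\<^sup>2 + \<sigma>\<^sup>2) * u\<^sup>2))"
  proof (rule noise_design_mgf_le[OF prob_space_unit_measure _ _ F(1) psi_bound[OF k] _ _ F(2) \<sigma> u])
    show "(\<integral>t. (\<psi> j k t)\<^sup>2 \<partial>unit_measure) = 1" using inner_psi[OF k k] by (simp add: power2_eq_square)
    show "c = (\<integral>t. f t * \<psi> j k t \<partial>unit_measure)" by (simp add: c_def inner_unit_eq)
  qed (auto intro!: borel_measurable_unit_measure)
  finally show ?thesis by (simp add: c_def)
qed

text \<open>The majorant \<open>1/2 + \<psi>\<^sup>2 / 2\<close> of
  \<open>\<bar>\<psi>\<bar>\<close> integrates to 1, so the bound does not grow with the level
  although the sup norm of the wavelet may.\<close>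

lemma obs_law_abs_le:
  assumes [measurable]: "f \<in> borel_measurable borel" and k: "k < 2 ^ j"
    and F: "AE t in unit_measure. \<bar>f t\<bar> \<le> F" "F \<ge> 0" and \<sigma>: "\<sigma> \<ge> 0"
  shows "(\<integral>\<^sup>+ p. ennreal \<bar>snd p * \<psi> j k (fst p)\<bar> \<partial>obs_law \<sigma> f) \<le> ennreal (F + 4 * \<sigma>)"
proof -
  interpret prob_space unit_measure by (rule prob_space_unit_measure)
  interpret N: prob_space noise_measure by (rule prob_space_normal_density) simp
  note psi_measurable[OF k, measurable]
  have iP2: "integrable unit_measure (\<lambda>t. (\<psi> j k t)\<^sup>2)"
    using onb k unfolding orthonormal_basis_unit_def l2_unit_iff by blast
  have P2: "(\<integral>t. (\<psi> j k t)\<^sup>2 \<partial>unit_measure) = 1" using inner_psi[OF k k] by (simp add: power2_eq_square)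
  have "(\<integral>\<^sup>+ p. ennreal \<bar>snd p * \<psi> j k (fst p)\<bar> \<partial>obs_law \<sigma> f)
     = (\<integral>\<^sup>+ t. \<integral>\<^sup>+ e. ennreal \<bar>(f t + \<sigma> * e) * \<psi> j k t\<bar> \<partial>noise_measure \<partial>unit_measure)"
    by (subst nn_integral_obs_law) auto
  also have "\<dots> \<le> (\<integral>\<^sup>+ t. ennreal (F + 4 * \<sigma>) * ennreal (1/2 + (\<psi> j k t)\<^sup>2 / 2) \<partial>unit_measure)"
  proof (rule nn_integral_mono_AE)
    show "AE t in unit_measure. (\<integral>\<^sup>+ e. ennreal \<bar>(f t + \<sigma> * e) * \<psi> j k t\<bar> \<partial>noise_measure)
       \<le> ennreal (F + 4 * \<sigma>) * ennreal (1/2 + (\<psi> j k t)\<^sup>2 / 2)"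
      using F(1)
    proof eventually_elim
      fix t assume ft: "\<bar>f t\<bar> \<le> F"
      have "0 \<le> (\<bar>\<psi> j k t\<bar> - 1)\<^sup>2" by simp
      then have psi: "\<bar>\<psi> j k t\<bar> \<le> 1/2 + (\<psi> j k t)\<^sup>2 / 2" by (simp add: power2_diff)
      have "(\<integral>\<^sup>+ e. ennreal \<bar>(f t + \<sigma> * e) * \<psi> j k t\<bar> \<partial>noise_measure)
        \<le> (\<integral>\<^sup>+ e. (ennreal F + ennreal \<sigma> * ennreal \<bar>e\<bar>) * ennreal (1/2 + (\<psi> j k t)\<^sup>2 / 2) \<partial>noise_measure)"
      proof (rule nn_integral_mono)
        fix e
        have "\<bar>f t + \<sigma> * e\<bar> \<le> \<bar>f t\<bar> + \<bar>\<sigma> * e\<bar>" by (rule abs_triangle_ineq)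
        also have "\<dots> \<le> F + \<sigma> * \<bar>e\<bar>" using ft \<sigma> by (simp add: abs_mult)
        finally have "\<bar>(f t + \<sigma> * e) * \<psi> j k t\<bar> \<le> (F + \<sigma> * \<bar>e\<bar>) * (1/2 + (\<psi> j k t)\<^sup>2 / 2)"
          unfolding abs_mult using psi F \<sigma> by (intro mult_mono) auto
        then show "ennreal \<bar>(f t + \<sigma> * e) * \<psi> j k t\<bar> \<le> (ennreal F + ennreal \<sigma> * ennreal \<bar>e\<bar>) * ennreal (1/2 + (\<psi> j k t)\<^sup>2 / 2)"
          using F \<sigma> by (simp add: ennreal_mult[symmetric] ennreal_plus[symmetric] ennreal_leI del: ennreal_plus)
      qed
      also have "\<dots> = (ennreal F + ennreal \<sigma> * (\<integral>\<^sup>+ e. ennreal \<bar>e\<bar> \<partial>noise_measure)) * ennreal (1/2 + (\<psi> j k t)\<^sup>2 / 2)"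
        by (simp add: nn_integral_multc nn_integral_add nn_integral_cmult N.emeasure_space_1[simplified])
      also have "\<dots> \<le> (ennreal F + ennreal \<sigma> * 4) * ennreal (1/2 + (\<psi> j k t)\<^sup>2 / 2)"
        using noise_abs_moment by (intro mult_right_mono add_left_mono mult_left_mono) auto
      also have "ennreal F + ennreal \<sigma> * 4 = ennreal (F + 4 * \<sigma>)"
      proof -
        have "ennreal F + ennreal \<sigma> * ennreal 4 = ennreal (F + 4 * \<sigma>)"
          using F \<sigma> by (simp only: ennreal_mult[symmetric] ennreal_plus[symmetric] zero_le_numeral mult_nonneg_nonneg mult.commute)
        then show ?thesis by simp
      qed
      finally show "(\<integral>\<^sup>+ e. ennreal \<bar>(f t + \<sigma> * e) * \<psi> j k t\<bar> \<partial>noise_measure)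
       \<le> ennreal (F + 4 * \<sigma>) * ennreal (1/2 + (\<psi> j k t)\<^sup>2 / 2)" .
    qed
  qed
  also have "\<dots> = ennreal (F + 4 * \<sigma>) * (\<integral>\<^sup>+ t. ennreal (1/2 + (\<psi> j k t)\<^sup>2 / 2) \<partial>unit_measure)"
    by (rule nn_integral_cmult) (auto intro!: borel_measurable_unit_measure)
  also have "(\<integral>\<^sup>+ t. ennreal (1/2 + (\<psi> j k t)\<^sup>2 / 2) \<partial>unit_measure) = ennreal (\<integral>t. 1/2 + (\<psi> j k t)\<^sup>2 / 2 \<partial>unit_measure)"
    using iP2 by (intro nn_integral_eq_integral) auto
  also have "(\<integral>t. 1/2 + (\<psi> j k t)\<^sup>2 / 2 \<partial>unit_measure) = 1" using iP2 P2 by (simp add: prob_space[simplified])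
  finally show ?thesis by simp
qed

end

section \<open>Product laws\<close>

lemma sets_obs_law: "sets (obs_law \<sigma> f) = sets (borel \<Otimes>\<^sub>M borel)"
  by (simp add: obs_law_def)

lemma sets_local_law: "sets (\<Pi>\<^sub>M l\<in>{1..r}. obs_law \<sigma> f) = sets (local_space r)"
  unfolding local_space_def by (intro sets_PiM_cong) (auto simp: sets_obs_law)

lemma prob_space_local_law:
  "f \<in> borel_measurable borel \<Longrightarrow> prob_space (\<Pi>\<^sub>M l\<in>{1..r}. obs_law \<sigma> f)"
  by (intro prob_space_PiM prob_space_obs_law)

lemma prob_space_data_law:
  "f \<in> borel_measurable borel \<Longrightarrow> prob_space (data_law \<sigma> m r f)"
  unfolding data_law_def by (intro prob_space_PiM prob_space_local_law)

lemma nn_integral_local_law_component: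
  assumes f: "f \<in> borel_measurable borel" and h: "h \<in> borel_measurable (borel \<Otimes>\<^sub>M borel)" and l: "l \<in> {1..r}"
  shows "(\<integral>\<^sup>+ d. h (d l) \<partial>(\<Pi>\<^sub>M l\<in>{1..r}. obs_law \<sigma> f)) = (\<integral>\<^sup>+ p. h p \<partial>obs_law \<sigma> f)"
proof -
  have hm: "h \<in> borel_measurable (obs_law \<sigma> f)" using h by (simp add: sets_obs_law cong: measurable_cong_sets)
  have "(\<integral>\<^sup>+ p. h p \<partial>obs_law \<sigma> f)
      = (\<integral>\<^sup>+ p. h p \<partial>distr (\<Pi>\<^sub>M l\<in>{1..r}. obs_law \<sigma> f) (obs_law \<sigma> f) (\<lambda>d. d l))"
    using distr_PiM_component[of "{1..r}" "\<lambda>_. obs_law \<sigma> f" l] prob_space_obs_law[OF f] l by simp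
  also have "\<dots> = (\<integral>\<^sup>+ d. h (d l) \<partial>(\<Pi>\<^sub>M l\<in>{1..r}. obs_law \<sigma> f))"
    using hm l by (intro nn_integral_distr measurable_component_singleton) auto
  finally show ?thesis by simp
qed

lemma nn_integral_data_law_component:
  assumes f: "f \<in> borel_measurable borel" and h: "h \<in> borel_measurable (local_space r)" and i: "i \<in> {1..m}"
  shows "(\<integral>\<^sup>+ d. h (d i) \<partial>data_law \<sigma> m r f) = (\<integral>\<^sup>+ e. h e \<partial>(\<Pi>\<^sub>M l\<in>{1..r}. obs_law \<sigma> f))"
proof -
  define P where "P = (\<Pi>\<^sub>M l\<in>{1..r}. obs_law \<sigma> f)"
  have hm: "h \<in> borel_measurable P" using h unfolding P_def measurable_cong_sets[OF sets_local_law refl] .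
  have "(\<integral>\<^sup>+ p. h p \<partial>P) = (\<integral>\<^sup>+ p. h p \<partial>distr (\<Pi>\<^sub>M i\<in>{1..m}. P) P (\<lambda>d. d i))"
  proof -
    have "prob_space P" unfolding P_def by (rule prob_space_local_law[OF f])
    then have "distr (\<Pi>\<^sub>M i\<in>{1..m}. P) P (\<lambda>d. d i) = P" by (intro distr_PiM_component i)
    then show ?thesis by simp
  qed
  also have "\<dots> = (\<integral>\<^sup>+ d. h (d i) \<partial>(\<Pi>\<^sub>M i\<in>{1..m}. P))"
    using hm i by (intro nn_integral_distr measurable_component_singleton) auto
  finally show ?thesis by (simp add: data_law_def P_def)
qed

text \<open>Independence is used in both layers, between machines and within one; machines outside A
  enter the full product with the factor 1.\<close>

lemma nn_integral_data_law_prod: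
  assumes f: "f \<in> borel_measurable borel" and h: "h \<in> borel_measurable (borel \<Otimes>\<^sub>M borel)" and A: "A \<subseteq> {1..m}"
  shows "(\<integral>\<^sup>+ d. (\<Prod>i\<in>A. \<Prod>l=1..r. h (d i l)) \<partial>data_law \<sigma> m r f) = (\<integral>\<^sup>+ p. h p \<partial>obs_law \<sigma> f) ^ (r * card A)"
proof -
  define P where "P = (\<Pi>\<^sub>M l\<in>{1..r}. obs_law \<sigma> f)"
  interpret O: prob_space "obs_law \<sigma> f" by (rule prob_space_obs_law[OF f])
  interpret P: prob_space P unfolding P_def by (rule prob_space_local_law[OF f])
  interpret PO: product_sigma_finite "\<lambda>_::nat. obs_law \<sigma> f" by standard
  interpret PP: product_sigma_finite "\<lambda>_::nat. P" by standard
  have hm [measurable]: "h \<in> borel_measurable (obs_law \<sigma> f)" using h by (simp add: sets_obs_law cong: measurable_cong_sets)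
  have inner: "(\<integral>\<^sup>+ e. (\<Prod>l=1..r. h (e l)) \<partial>P) = (\<integral>\<^sup>+ p. h p \<partial>obs_law \<sigma> f) ^ r"
    unfolding P_def by (subst PO.product_nn_integral_prod) auto
  have "(\<integral>\<^sup>+ d. (\<Prod>i\<in>A. \<Prod>l=1..r. h (d i l)) \<partial>data_law \<sigma> m r f)
    = (\<integral>\<^sup>+ d. (\<Prod>i\<in>{1..m}. (if i \<in> A then \<Prod>l=1..r. h (d i l) else 1)) \<partial>(\<Pi>\<^sub>M i\<in>{1..m}. P))"
    unfolding data_law_def P_def[symmetric]
    using A by (intro nn_integral_cong prod.mono_neutral_cong_left) auto
  also have "\<dots> = (\<Prod>i\<in>{1..m}. \<integral>\<^sup>+ e. (if i \<in> A then \<Prod>l=1..r. h (e l) else 1) \<partial>P)"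
  proof (rule PP.product_nn_integral_prod)
    fix i
    have "(\<lambda>e. \<Prod>l=1..r. h (e l)) \<in> borel_measurable P" unfolding P_def by measurable
    then show "(\<lambda>e. if i \<in> A then \<Prod>l=1..r. h (e l) else 1) \<in> borel_measurable P"
      by (cases "i \<in> A") (simp_all del: One_nat_def)
  qed simp
  also have "\<dots> = (\<Prod>i\<in>A. (\<integral>\<^sup>+ p. h p \<partial>obs_law \<sigma> f) ^ r)"
    using A by (intro prod.mono_neutral_cong_right) (auto simp: inner P.emeasure_space_1 simp del: One_nat_def)
  also have "\<dots> = (\<integral>\<^sup>+ p. h p \<partial>obs_law \<sigma> f) ^ (r * card A)"
    by (simp add: power_mult)
  finally show ?thesis .
qed

lemma measurable_local_average:
  assumes "\<psi> j k \<in> borel_measurable borel" "r = n div m"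
  shows "(\<lambda>d. local_average s \<psi> n m B d j k) \<in> borel_measurable (data_law \<sigma> m r f)"
proof -
  have "(\<lambda>d. local_coeff \<psi> n m (d i) j k) \<in> borel_measurable (data_law \<sigma> m r f)" if "i \<in> {1..m}" for i
  proof (rule measurable_compose[OF _ measurable_local_coeff[of \<psi> j k n m]])
    have "(\<lambda>d. d i) \<in> measurable (data_law \<sigma> m r f) (\<Pi>\<^sub>M l\<in>{1..r}. obs_law \<sigma> f)"
      unfolding data_law_def using that by measurable
    then show "(\<lambda>d. d i) \<in> measurable (data_law \<sigma> m r f) (local_space (n div m))"
      unfolding assms(2) measurable_cong_sets[OF refl sets_local_law] .
  qed (rule assms)
  then show ?thesis unfolding local_average_def
    by (intro borel_measurable_divide borel_measurable_sum) (auto simp: averaged_def)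
qed

context bounded_wavelets
begin

lemma nn_integral_local_coeff_le:
  assumes f: "f \<in> borel_measurable borel" and k: "k < 2 ^ j"
    and F: "AE t in unit_measure. \<bar>f t\<bar> \<le> F" "F \<ge> 0" and \<sigma>: "\<sigma> \<ge> 0" and i: "i \<in> {1..m}"
    and n: "n \<ge> 1" "m dvd n"
  shows "(\<integral>\<^sup>+ d. ennreal \<bar>local_coeff \<psi> n m (d i) j k\<bar> \<partial>data_law \<sigma> m (n div m) f) \<le> ennreal (F + 4 * \<sigma>)"
proof -
  note [measurable] = psi_measurable[OF k] measurable_local_coeff[where \<psi>=\<psi> and j=j and k=k, OF psi_measurable[OF k]]
  define r where "r = n div m"
  define P where "P = (\<Pi>\<^sub>M l\<in>{1..r}. obs_law \<sigma> f)"
  have m: "m \<ge> 1" using i by simp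
  have rn: "real m / real n * real r = 1" "r \<ge> 1" using n m by (auto simp: r_def real_of_nat_div div_greater_zero_iff dvd_imp_le Suc_le_eq)
  have "(\<integral>\<^sup>+ d. ennreal \<bar>local_coeff \<psi> n m (d i) j k\<bar> \<partial>data_law \<sigma> m r f)
     = (\<integral>\<^sup>+ e. ennreal \<bar>local_coeff \<psi> n m e j k\<bar> \<partial>P)"
    unfolding P_def r_def using i
    by (intro nn_integral_data_law_component[OF f, where h="\<lambda>e. ennreal \<bar>local_coeff \<psi> n m e j k\<bar>"]) measurable
  also have "\<dots> \<le> (\<integral>\<^sup>+ e. ennreal (real m / real n) * (\<Sum>l=1..r. ennreal \<bar>snd (e l) * \<psi> j k (fst (e l))\<bar>) \<partial>P)"
  proof (rule nn_integral_mono)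
    fix e
    have "\<bar>local_coeff \<psi> n m e j k\<bar> \<le> real m / real n * (\<Sum>l=1..r. \<bar>snd (e l) * \<psi> j k (fst (e l))\<bar>)"
      unfolding local_coeff_def r_def[symmetric] abs_mult[of "real m / real n"]
      using mult_left_mono[OF sum_abs, of "real m / real n"] by simp
    then show "ennreal \<bar>local_coeff \<psi> n m e j k\<bar> \<le> ennreal (real m / real n) * (\<Sum>l=1..r. ennreal \<bar>snd (e l) * \<psi> j k (fst (e l))\<bar>)"
      by (subst sum_ennreal) (auto simp: ennreal_mult[symmetric] sum_nonneg ennreal_leI)
  qed
  also have "\<dots> = ennreal (real m / real n) * (\<Sum>l=1..r. \<integral>\<^sup>+ e. ennreal \<bar>snd (e l) * \<psi> j k (fst (e l))\<bar> \<partial>P)"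
  proof -
    have [measurable]: "(\<lambda>e. e l) \<in> measurable P (borel \<Otimes>\<^sub>M borel)" if "l \<in> {1..r}" for l
    proof -
      have "(\<lambda>e. e l) \<in> measurable P (obs_law \<sigma> f)" unfolding P_def using that by measurable
      then show ?thesis by (simp add: sets_obs_law cong: measurable_cong_sets)
    qed
    have m: "(\<lambda>e. ennreal \<bar>snd (e l) * \<psi> j k (fst (e l))\<bar>) \<in> borel_measurable P" if "l \<in> {1..r}" for l
      using that by measurable
    show ?thesis
      by (subst nn_integral_cmult, rule borel_measurable_sum, erule m, subst nn_integral_sum, erule m, rule refl)
  qed
  also have "\<dots> \<le> ennreal (real m / real n) * (\<Sum>l=1..r. ennreal (F + 4 * \<sigma>))"
  proof (intro mult_left_mono sum_mono)
    fix l assume l: "l \<in> {1..r}"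
    have "(\<integral>\<^sup>+ e. ennreal \<bar>snd (e l) * \<psi> j k (fst (e l))\<bar> \<partial>P) = (\<integral>\<^sup>+ p. ennreal \<bar>snd p * \<psi> j k (fst p)\<bar> \<partial>obs_law \<sigma> f)"
      unfolding P_def by (rule nn_integral_local_law_component[OF f _ l, where h="\<lambda>p. ennreal \<bar>snd p * \<psi> j k (fst p)\<bar>"]) measurable
    then show "(\<integral>\<^sup>+ e. ennreal \<bar>snd (e l) * \<psi> j k (fst (e l))\<bar> \<partial>P) \<le> ennreal (F + 4 * \<sigma>)"
      using obs_law_abs_le[OF f k F \<sigma>] by simp
  qed simp
  also have "\<dots> = ennreal (real m / real n * (real r * (F + 4 * \<sigma>)))"
  proof -
    define G where "G = F + 4 * \<sigma>"
    have "G \<ge> 0" using F \<sigma> by (simp add: G_def)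
    then have "ennreal (real m / real n) * (\<Sum>l=1..r. ennreal G) = ennreal (real m / real n * (real r * G))"
      by (subst sum_ennreal) (simp_all add: ennreal_mult[symmetric])
    then show ?thesis by (simp only: G_def)
  qed
  also have "real m / real n * (real r * (F + 4 * \<sigma>)) = F + 4 * \<sigma>"
    by (simp only: mult.assoc[symmetric] rn(1) mult_1_left)
  finally show ?thesis by (simp add: r_def)
qed

text \<open>A coefficient takes at most \<open>3 + log 2 n / 2 + 4 * (F + 4 * \<sigma>)\<close> bits
  on average. Assumption \<open>large\<close> lets the constant part fit into the other half of
  \<open>log 2 n\<close>, and a machine sends at most \<open>B / log 2 n\<close>
  coefficients.\<close>

lemma expected_message_length_le:
  assumes f: "f \<in> borel_measurable borel"
    and F: "AE t in unit_measure. \<bar>f t\<bar> \<le> F" "F \<ge> 0" and \<sigma>: "\<sigma> \<ge> 0" and i: "i \<in> {1..m}"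
    and n: "n \<ge> 2" "m dvd n" and B: "B \<ge> 0" and large: "3 + 4 * (F + 4 * \<sigma>) \<le> log 2 (real n) / 2"
  shows "(\<integral>\<^sup>+ d. of_nat (length (message (pad_length n) s \<psi> n m B i (d i))) \<partial>data_law \<sigma> m (n div m) f) \<le> ennreal B"
proof -
  define T where "T = {(j, k). transmits s n m B i j k}"
  define c where "c = 3 + log 2 (real n) / 2"
  define D where "D = data_law \<sigma> m (n div m) f"
  interpret prob_space D unfolding D_def by (rule prob_space_data_law[OF f])
  have n1: "n \<ge> 1" using n by simp
  have lg: "log 2 (real n) \<ge> 1" using n by (simp add: le_log_iff)
  have c0: "c \<ge> 0" using lg by (simp add: c_def)
  have T: "finite T" "card T \<le> block_size n B" unfolding T_def by (rule transmitted_indices)+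
  have kT: "snd p < 2 ^ fst p" if "p \<in> T" for p using that by (auto simp: T_def transmits_def)
  have meas: "(\<lambda>d. ennreal \<bar>local_coeff \<psi> n m (d i) (fst p) (snd p)\<bar>) \<in> borel_measurable D" if "p \<in> T" for p
  proof -
    have "(\<lambda>d. d i) \<in> measurable D (\<Pi>\<^sub>M l\<in>{1..n div m}. obs_law \<sigma> f)"
      unfolding D_def data_law_def using i by measurable
    then have [measurable]: "(\<lambda>d. d i) \<in> measurable D (local_space (n div m))"
      unfolding measurable_cong_sets[OF refl sets_local_law] .
    note [measurable] = measurable_local_coeff[where \<psi>=\<psi> and j="fst p" and k="snd p", OF psi_measurable[OF kT[OF that]]]
    show ?thesis by measurable
  qed
  have "(\<integral>\<^sup>+ d. of_nat (length (message (pad_length n) s \<psi> n m B i (d i))) \<partial>D)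
    \<le> (\<integral>\<^sup>+ d. (\<Sum>p\<in>T. ennreal c + 4 * ennreal \<bar>local_coeff \<psi> n m (d i) (fst p) (snd p)\<bar>) \<partial>D)"
  proof (rule nn_integral_mono)
    fix d
    have "ennreal (real (length (message (pad_length n) s \<psi> n m B i (d i)))) \<le> ennreal (\<Sum>p\<in>T. c + 4 * \<bar>local_coeff \<psi> n m (d i) (fst p) (snd p)\<bar>)"
      unfolding T_def c_def by (intro ennreal_leI length_message_le n1)
    also have "\<dots> = (\<Sum>p\<in>T. ennreal (c + 4 * \<bar>local_coeff \<psi> n m (d i) (fst p) (snd p)\<bar>))"
      using c0 by (intro sum_ennreal[symmetric]) auto
    also have "\<dots> = (\<Sum>p\<in>T. ennreal c + 4 * ennreal \<bar>local_coeff \<psi> n m (d i) (fst p) (snd p)\<bar>)"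
      using c0 by (simp add: ennreal_plus ennreal_mult)
    finally show "of_nat (length (message (pad_length n) s \<psi> n m B i (d i))) \<le> (\<Sum>p\<in>T. ennreal c + 4 * ennreal \<bar>local_coeff \<psi> n m (d i) (fst p) (snd p)\<bar>)"
      by (simp add: ennreal_of_nat_eq_real_of_nat)
  qed
  also have "\<dots> = (\<Sum>p\<in>T. ennreal c + 4 * (\<integral>\<^sup>+ d. ennreal \<bar>local_coeff \<psi> n m (d i) (fst p) (snd p)\<bar> \<partial>D))"
    using meas by (simp add: nn_integral_sum nn_integral_add nn_integral_cmult emeasure_space_1)
  also have "\<dots> \<le> (\<Sum>p\<in>T. ennreal c + 4 * ennreal (F + 4 * \<sigma>))"
    unfolding D_def using nn_integral_local_coeff_le[OF f kT F \<sigma> i n1 n(2)]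
    by (intro sum_mono add_left_mono mult_left_mono) auto
  also have "\<dots> = ennreal (real (card T) * (c + 4 * (F + 4 * \<sigma>)))"
    using c0 F \<sigma> by (simp add: ennreal_plus ennreal_mult ennreal_of_nat_eq_real_of_nat)
  also have "\<dots> \<le> ennreal B"
  proof (rule ennreal_leI)
    have "real (card T) * (c + 4 * (F + 4 * \<sigma>)) \<le> real (block_size n B) * log 2 (real n)"
      using T large lg c0 F \<sigma> by (intro mult_mono) (auto simp: c_def)
    also have "real (block_size n B) \<le> B / log 2 (real n)"
      using B lg by (simp add: block_size_def)
    then have "real (block_size n B) * log 2 (real n) \<le> B" using lg by (simp add: pos_le_divide_eq)
    finally show "real (card T) * (c + 4 * (F + 4 * \<sigma>)) \<le> B" .
  qed
  finally show ?thesis by (simp add: D_def)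
qed

text \<open>The exponent v is spread evenly over the \<open>N'\<close> observations, each of which
  contributes order \<open>(v / N')\<^sup>2\<close>. Only the lower bound N on their number is
  known, which suffices because the condition on v and the bound both weaken as the number
  decreases.\<close>

lemma local_average_mgf_le:
  assumes f: "f \<in> borel_measurable borel" and k: "k < 2 ^ j"
    and F: "AE t in unit_measure. \<bar>f t\<bar> \<le> F" "F \<ge> 0" and \<sigma>: "\<sigma> \<ge> 0"
    and m: "m \<ge> 1" "m dvd n" "n \<ge> 1"
    and N: "real (card (averaged s n m B j k)) * real (n div m) \<ge> N" "N > 0"
    and u: "\<bar>v\<bar> / N * (C * 2 powr (real j / 2)) * (F + \<sigma>) \<le> 1 / 4"
  shows "(\<integral>\<^sup>+ d. ennreal (exp (v * (local_average s \<psi> n m B d j k - inner_unit f (\<psi> j k)))) \<partial>data_law \<sigma> m (n div m) f)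
     \<le> ennreal (exp (7 * (F\<^sup>2 + \<sigma>\<^sup>2) * v\<^sup>2 / N))"
proof -
  note [measurable] = psi_measurable[OF k]
  define r where "r = n div m"
  define A where "A = averaged s n m B j k"
  define N' where "N' = real (card A) * real r"
  define c where "c = inner_unit f (\<psi> j k)"
  define w where "w = v / N'"
  have N': "N' \<ge> N" using N by (simp add: N'_def A_def r_def)
  have "real n = real r * real m" using m by (simp add: r_def flip: of_nat_mult)
  then have rn: "real m / real n = 1 / real r" using m by (cases "r = 0") (auto simp: field_simps)
  have "N' > 0" using N' N by linarith
  then have pos: "real (card A) > 0" "real r > 0" unfolding N'_def by (auto simp: zero_less_mult_iff)
  have eq: "v * (local_average s \<psi> n m B d j k - c) = (\<Sum>i\<in>A. \<Sum>l=1..r. w * (snd (d i l) * \<psi> j k (fst (d i l)) - c))" for d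
  proof -
    have "(\<Sum>i\<in>A. \<Sum>l=1..r. w * (snd (d i l) * \<psi> j k (fst (d i l)) - c))
       = w * ((\<Sum>i\<in>A. \<Sum>l=1..r. snd (d i l) * \<psi> j k (fst (d i l))) - N' * c)"
      by (simp add: sum_distrib_left[symmetric] sum_subtractf N'_def)
    also have "\<dots> = v * ((\<Sum>i\<in>A. \<Sum>l=1..r. snd (d i l) * \<psi> j k (fst (d i l))) / N' - c)"
      using \<open>N' > 0\<close> by (simp add: w_def field_simps)
    also have "(\<Sum>i\<in>A. \<Sum>l=1..r. snd (d i l) * \<psi> j k (fst (d i l))) / N' = local_average s \<psi> n m B d j k"
      unfolding local_average_def local_coeff_def A_def[symmetric] r_def[symmetric] rn N'_def
      by (simp add: sum_divide_distrib[symmetric] sum_distrib_left[symmetric])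
    finally show ?thesis by simp
  qed
  have A: "A \<subseteq> {1..m}" by (auto simp: A_def averaged_def)
  have "(\<integral>\<^sup>+ d. ennreal (exp (v * (local_average s \<psi> n m B d j k - c))) \<partial>data_law \<sigma> m r f)
    = (\<integral>\<^sup>+ d. (\<Prod>i\<in>A. \<Prod>l=1..r. ennreal (exp (w * (snd (d i l) * \<psi> j k (fst (d i l)) - c)))) \<partial>data_law \<sigma> m r f)"
    unfolding eq using finite_subset[OF A] by (simp add: exp_sum prod_ennreal prod_nonneg)
  also have "\<dots> = (\<integral>\<^sup>+ p. ennreal (exp (w * (snd p * \<psi> j k (fst p) - c))) \<partial>obs_law \<sigma> f) ^ (r * card A)"
    by (rule nn_integral_data_law_prod[OF f _ A, where h="\<lambda>p. ennreal (exp (w * (snd p * \<psi> j k (fst p) - c)))"]) measurable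
  also have "\<dots> \<le> ennreal (exp (7 * (F\<^sup>2 + \<sigma>\<^sup>2) * w\<^sup>2)) ^ (r * card A)"
  proof (intro power_mono)
    have "\<bar>w\<bar> = \<bar>v\<bar> / N'" using \<open>N' > 0\<close> by (simp add: w_def)
    also have "\<dots> \<le> \<bar>v\<bar> / N" using N N' by (intro divide_left_mono) auto
    finally have "\<bar>w\<bar> * (C * 2 powr (real j / 2)) * (F + \<sigma>) \<le> \<bar>v\<bar> / N * (C * 2 powr (real j / 2)) * (F + \<sigma>)"
      using C_pos F \<sigma> by (intro mult_right_mono) auto
    then show "(\<integral>\<^sup>+ p. ennreal (exp (w * (snd p * \<psi> j k (fst p) - c))) \<partial>obs_law \<sigma> f) \<le> ennreal (exp (7 * (F\<^sup>2 + \<sigma>\<^sup>2) * w\<^sup>2))"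
      unfolding c_def using u by (intro obs_law_mgf_le f k F \<sigma>) linarith
  qed simp
  also have "\<dots> = ennreal (exp (real (r * card A) * (7 * (F\<^sup>2 + \<sigma>\<^sup>2) * w\<^sup>2)))"
    by (simp only: ennreal_power exp_ge_zero exp_of_nat_mult)
  also have "\<dots> \<le> ennreal (exp (7 * (F\<^sup>2 + \<sigma>\<^sup>2) * v\<^sup>2 / N))"
  proof (intro ennreal_leI, simp only: exp_le_cancel_iff)
    have "real (r * card A) * (7 * (F\<^sup>2 + \<sigma>\<^sup>2) * w\<^sup>2) = 7 * (F\<^sup>2 + \<sigma>\<^sup>2) * v\<^sup>2 / N'"
    proof -
      have "real (r * card A) = N'" by (simp add: N'_def)
      then show ?thesis using \<open>N' > 0\<close> by (simp add: w_def power_divide power2_eq_square)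
    qed
    also have "\<dots> \<le> 7 * (F\<^sup>2 + \<sigma>\<^sup>2) * v\<^sup>2 / N" using N N' by (intro divide_left_mono) auto
    finally show "real (r * card A) * (7 * (F\<^sup>2 + \<sigma>\<^sup>2) * w\<^sup>2) \<le> 7 * (F\<^sup>2 + \<sigma>\<^sup>2) * v\<^sup>2 / N" .
  qed
  finally show ?thesis by (simp add: r_def c_def)
qed

end

section \<open>Truncation to the kept indices\<close>

definition kept_indices :: "real \<Rightarrow> (nat \<times> nat) set" where
  "kept_indices K = {(j, k). k < 2 ^ j \<and> real (2 ^ j + k) \<le> K}"

definition kept_level :: "real \<Rightarrow> nat \<Rightarrow> nat set" where
  "kept_level K j = {k. k < 2 ^ j \<and> real (2 ^ j + k) \<le> K}"

lemma kept_level: "finite (kept_level K j)" "kept_level K j \<subseteq> {..<2 ^ j}"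
  by (auto simp: kept_level_def)

lemma finite_kept_levels: "finite {j. (2::real) ^ j \<le> K}"
proof (rule finite_subset)
  show "{j. (2::real) ^ j \<le> K} \<subseteq> {..nat \<lfloor>K\<rfloor>}"
  proof
    fix j assume "j \<in> {j. (2::real) ^ j \<le> K}"
    then have "2 ^ j \<le> K" by simp
    moreover have "real j < real (2 ^ j)" by (simp only: of_nat_less_iff less_exp)
    then have "real j < 2 ^ j" by simp
    ultimately have "real j \<le> K" by linarith
    then show "j \<in> {..nat \<lfloor>K\<rfloor>}" by (simp add: le_nat_floor)
  qed
qed simp

lemma kept_indices_Sigma: "kept_indices K = Sigma {j. (2::real) ^ j \<le> K} (kept_level K)"
proof -
  have "(2::real) ^ j \<le> K" if "2 ^ j + real k \<le> K" for j k
    using that of_nat_0_le_iff[of k, where 'a=real] by linarith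
  then show ?thesis by (auto simp: kept_indices_def kept_level_def)
qed

lemma finite_kept_indices: "finite (kept_indices K)"
  unfolding kept_indices_Sigma by (intro finite_SigmaI finite_kept_levels kept_level)

lemma card_kept_indices_le:
  assumes "K \<ge> 0" shows "real (card (kept_indices K)) \<le> K"
proof -
  have inj: "inj_on (\<lambda>(j, k). (2::nat) ^ j + k) (kept_indices K)"
    by (rule inj_onI) (auto simp: kept_indices_def dest: two_pow_add_inj)
  have "(\<lambda>(j, k). (2::nat) ^ j + k) ` kept_indices K \<subseteq> {1..nat \<lfloor>K\<rfloor>}"
  proof
    fix x assume "x \<in> (\<lambda>(j, k). (2::nat) ^ j + k) ` kept_indices K"
    then obtain j k where x: "x = 2 ^ j + k" "real x \<le> K" by (auto simp: kept_indices_def)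
    have "1 \<le> x" using x(1) one_le_power[of "2::nat" j] by linarith
    then show "x \<in> {1..nat \<lfloor>K\<rfloor>}" using x(2) by (simp add: le_nat_floor)
  qed
  from card_inj_on_le[OF inj this] have "card (kept_indices K) \<le> nat \<lfloor>K\<rfloor>" by simp
  then have "real (card (kept_indices K)) \<le> real (nat \<lfloor>K\<rfloor>)" by simp
  also have "\<dots> \<le> K" using assms by simp
  finally show ?thesis .
qed

text \<open>A geometric sum is dominated by its top term, here at most \<open>sqrt K\<close>. The
  constant comes from \<open>q / (q - 1) \<le> 4\<close>, valid for
  \<open>q = sqrt 2 > 4/3\<close>.\<close>

lemma sum_sqrt_powers_le:
  assumes "K \<ge> 1"
  shows "(\<Sum>j\<in>{j. (2::real) ^ j \<le> K}. 2 powr (real j / 2)) \<le> 4 * sqrt K"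
proof -
  define J where "J = {j. (2::real) ^ j \<le> K}"
  define M where "M = Max J"
  define q where "q = sqrt 2"
  have fin: "finite J" unfolding J_def by (rule finite_kept_levels)
  have "0 \<in> J" using assms by (simp add: J_def)
  then have "M \<in> J" unfolding M_def using fin by (intro Max_in) auto
  then have M: "2 ^ M \<le> K" by (simp add: J_def)
  have pq: "2 powr (real j / 2) = q ^ j" for j
  proof -
    have "2 powr (real j / 2) = (2 powr (1/2)) powr real j" by (simp add: powr_powr)
    then show ?thesis by (simp add: powr_half_sqrt powr_realpow q_def)
  qed
  have "4/3 < sqrt 2" by (rule real_less_rsqrt) (simp add: power2_eq_square)
  moreover have "sqrt 2 < 3/2" by (rule real_less_lsqrt) (simp_all add: power2_eq_square)
  ultimately have q: "q > 4/3" "q < 3/2" "q * q = 2" unfolding q_def by simp_all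
  have "(\<Sum>j\<in>J. 2 powr (real j / 2)) \<le> (\<Sum>j\<in>{..<Suc M}. q ^ j)"
    unfolding pq using fin q by (intro sum_mono2) (auto simp: M_def less_Suc_eq_le)
  also have "\<dots> = (q ^ Suc M - 1) / (q - 1)" using q by (intro geometric_sum) auto
  also have "\<dots> \<le> 4 * q ^ M"
  proof -
    have "q ^ M \<ge> 0" using q by simp
    then have "q * q ^ M \<le> 4 * (q - 1) * q ^ M" using q by (intro mult_right_mono) auto
    moreover have "4 * (q - 1) * q ^ M = 4 * q ^ M * (q - 1)" by simp
    ultimately have "q ^ Suc M - 1 \<le> 4 * q ^ M * (q - 1)" unfolding power_Suc by linarith
    then show ?thesis using q(1) by (subst pos_divide_le_eq) auto
  qed
  also have "q ^ M = sqrt (2 ^ M)" by (simp add: q_def real_sqrt_power)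
  also have "\<dots> \<le> sqrt K" using M by simp
  finally show ?thesis unfolding J_def by simp
qed

context bounded_wavelets
begin

lemma sum_kept_psi_le:
  assumes "K \<ge> 1"
  shows "(\<Sum>(j, k)\<in>kept_indices K. \<bar>\<psi> j k x\<bar>) \<le> 4 * C * sqrt K"
proof -
  have "(\<Sum>(j, k)\<in>kept_indices K. \<bar>\<psi> j k x\<bar>) = (\<Sum>j\<in>{j. (2::real) ^ j \<le> K}. \<Sum>k\<in>kept_level K j. \<bar>\<psi> j k x\<bar>)"
    unfolding kept_indices_Sigma by (intro sum.Sigma[symmetric] finite_kept_levels) (auto simp: kept_level)
  also have "\<dots> \<le> (\<Sum>j\<in>{j. (2::real) ^ j \<le> K}. C * 2 powr (real j / 2))"
  proof (rule sum_mono)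
    fix j
    have "(\<Sum>k\<in>kept_level K j. \<bar>\<psi> j k x\<bar>) \<le> (\<Sum>k<2^j. \<bar>\<psi> j k x\<bar>)"
      using kept_level by (intro sum_mono2) auto
    then show "(\<Sum>k\<in>kept_level K j. \<bar>\<psi> j k x\<bar>) \<le> C * 2 powr (real j / 2)" using level_sum[where j=j and x=x] by linarith
  qed
  also have "\<dots> = C * (\<Sum>j\<in>{j. (2::real) ^ j \<le> K}. 2 powr (real j / 2))" by (simp add: sum_distrib_left)
  also have "\<dots> \<le> C * (4 * sqrt K)" using C_pos sum_sqrt_powers_le[OF assms] by (intro mult_left_mono) auto
  finally show ?thesis by simp
qed

text \<open>Supplies the constant F of the moment bounds, uniformly over the ball, by summing the
  level bounds geometrically.\<close>

lemma besov_function_bound: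
  assumes f: "f \<in> besov_ball s \<psi> L" and L: "L > 0" and s: "s > 0"
  shows "AE x in unit_measure. \<bar>f x\<bar> \<le> L * C / (1 - 2 powr (- s))"
  using besov_expansion[OF f L s]
proof eventually_elim
  fix x
  define q where "q = 2 powr (- s)"
  have q: "0 < q" "q < 1" using s by (auto simp: q_def powr_less_one)
  define g where "g j = (\<Sum>k<2^j. inner_unit f (\<psi> j k) * \<psi> j k x)" for j
  assume "f x = (\<Sum>j. \<Sum>k<2^j. inner_unit f (\<psi> j k) * \<psi> j k x)"
  then have fx: "f x = (\<Sum>j. g j)" by (simp add: g_def)
  have gb: "norm (g j) \<le> L * C * q ^ j" for j
    unfolding g_def q_def real_norm_def by (rule level_term_bound[OF f L]) simp
  have "norm (\<Sum>j. g j) \<le> (\<Sum>j. L * C * q ^ j)"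
    by (rule norm_suminf_le[OF gb]) (use q in \<open>auto intro!: summable_mult summable_geometric\<close>)
  also have "\<dots> = L * C / (1 - q)" using q by (subst suminf_mult) (auto intro!: summable_geometric simp: suminf_geometric)
  finally show "\<bar>f x\<bar> \<le> L * C / (1 - 2 powr (- s))" by (simp add: fx q_def)
qed

text \<open>Complete levels cancel and what is missing from any other level is a partial level sum,
  so the difference is a geometric tail. It is compared with the series, which makes it valid at
  every x; the series represents f almost everywhere.\<close>

lemma truncation_bias_le:
  assumes f: "f \<in> besov_ball s \<psi> L" and L: "L > 0" and s: "s > 0" and K: "K > 0"
  shows "\<bar>(\<Sum>(j, k)\<in>kept_indices K. inner_unit f (\<psi> j k) * \<psi> j k x)
      - (\<Sum>j. \<Sum>k<2^j. inner_unit f (\<psi> j k) * \<psi> j k x)\<bar>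
    \<le> L * C / (1 - 2 powr (- s)) * 2 powr s * K powr (- s)"
proof -
  define q where "q = 2 powr (- s)"
  have q: "0 < q" "q < 1" using s by (auto simp: q_def powr_less_one)
  define t where "t j k = inner_unit f (\<psi> j k) * \<psi> j k x" for j k
  define a where "a j = (\<Sum>k<2^j. t j k)" for j
  define b where "b j = (\<Sum>k\<in>kept_level K j. t j k)" for j
  define J where "J = {j. (2::real) ^ j \<le> K}"
  have geo: "summable (\<lambda>j. D * q ^ j)" for D using q by (intro summable_mult summable_geometric) auto
  have ab: "\<bar>a j\<bar> \<le> L * C * q ^ j" for j
    unfolding a_def t_def q_def by (rule level_term_bound[OF f L]) simp
  have sa: "summable a" by (rule summable_comparison_test'[OF geo, of 0]) (use ab in auto)
  have b0: "b j = 0" if "j \<notin> J" for j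
  proof -
    have "kept_level K j = {}"
    proof (rule ccontr)
      assume "kept_level K j \<noteq> {}"
      then obtain k where "2 ^ j + real k \<le> K" by (auto simp: kept_level_def)
      then have "2 ^ j \<le> K" using of_nat_0_le_iff[of k, where 'a=real] by linarith
      then show False using that by (simp add: J_def)
    qed
    then show ?thesis by (simp add: b_def)
  qed
  have finJ: "finite J" unfolding J_def by (rule finite_kept_levels)
  have sb: "b sums (\<Sum>j\<in>J. b j)" by (rule sums_finite[OF finJ]) (use b0 in auto)
  have "(\<Sum>(j, k)\<in>kept_indices K. t j k) = (\<Sum>j\<in>J. b j)"
    unfolding kept_indices_Sigma b_def J_def by (intro sum.Sigma[symmetric] finite_kept_levels) (auto simp: kept_level)
  then have kept: "(\<Sum>(j, k)\<in>kept_indices K. t j k) = (\<Sum>j. b j)" using sums_unique[OF sb] by simp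
  have diff: "\<bar>b j - a j\<bar> \<le> L * C * q ^ j" for j
  proof -
    have "a j = b j + (\<Sum>k\<in>{..<2^j} - kept_level K j. t j k)"
      unfolding a_def b_def using sum.subset_diff[OF kept_level(2)[of K j], where g="t j"] by (simp add: add.commute)
    moreover have "\<bar>\<Sum>k\<in>{..<2^j} - kept_level K j. t j k\<bar> \<le> L * C * q ^ j"
      unfolding t_def q_def by (rule level_term_bound[OF f L]) auto
    ultimately show ?thesis by simp
  qed
  \<comment> \<open>\<open>J0\<close> is the first level that may be incomplete: a level j with
    \<open>2 ^ Suc j \<le> K\<close> is kept entirely. The factor \<open>2 powr s\<close> in the
    bound is the price of \<open>K < 2 ^ Suc J0\<close>.\<close>
  define J0 where "J0 = (LEAST j. K < 2 ^ Suc j)"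
  obtain n where n: "K < 2 ^ n" using real_arch_pow[of "2::real"] by auto
  have "(2::real) ^ n \<le> 2 ^ Suc n" by (rule power_increasing) auto
  then have ex: "\<exists>j. K < 2 ^ Suc j" using n less_le_trans by blast
  have J0: "K < 2 ^ Suc J0" unfolding J0_def using ex by (rule LeastI_ex)
  have zero: "b j - a j = 0" if "j < J0" for j
  proof -
    have le: "2 ^ Suc j \<le> K" using not_less_Least[of j "\<lambda>j. K < 2 ^ Suc j"] that by (auto simp: J0_def not_less)
    have "kept_level K j = {..<2 ^ j}"
    proof (intro equalityI kept_level subsetI)
      fix k :: nat assume "k \<in> {..<2 ^ j}"
      then have "real k \<le> real (2 ^ j)" unfolding of_nat_le_iff by simp
      then have "2 ^ j + real k \<le> K" using le unfolding of_nat_power of_nat_numeral power_Suc by linarith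
      then show "k \<in> kept_level K j" using \<open>k \<in> {..<2 ^ j}\<close> by (simp add: kept_level_def)
    qed
    then show ?thesis by (simp add: a_def b_def)
  qed
  have sd: "summable (\<lambda>j. b j - a j)" using sums_summable[OF sb] sa by (rule summable_diff)
  have "(\<Sum>j. b j) - (\<Sum>j. a j) = (\<Sum>j. b j - a j)" by (rule suminf_diff[OF sums_summable[OF sb] sa])
  also have "\<dots> = (\<Sum>i. b (i + J0) - a (i + J0)) + (\<Sum>i<J0. b i - a i)"
    by (rule suminf_split_initial_segment[OF sd])
  also have "(\<Sum>i<J0. b i - a i) = 0" using zero by (intro sum.neutral) auto
  finally have "\<bar>(\<Sum>j. b j) - (\<Sum>j. a j)\<bar> = norm (\<Sum>i. b (i + J0) - a (i + J0))" by simp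
  also have "\<dots> \<le> (\<Sum>i. L * C * q ^ J0 * q ^ i)"
  proof (rule norm_suminf_le[OF _ geo])
    show "norm (b (i + J0) - a (i + J0)) \<le> L * C * q ^ J0 * q ^ i" for i
      using diff[of "i + J0"] by (simp add: power_add mult_ac)
  qed
  also have "\<dots> = L * C / (1 - q) * q ^ J0"
    using q by (subst suminf_mult) (auto intro!: summable_geometric simp: suminf_geometric)
  also have "\<dots> \<le> L * C / (1 - q) * (2 powr s * K powr (- s))"
  proof (rule mult_left_mono)
    have "q ^ J0 = q powr real J0" using q by (simp add: powr_realpow)
    also have "\<dots> = (2 powr real J0) powr (- s)" by (simp add: q_def powr_powr mult.commute)
    also have "\<dots> = (2 ^ J0) powr (- s)" by (simp add: powr_realpow)
    also have "\<dots> \<le> (K / 2) powr (- s)"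
      using J0 K s by (intro powr_mono2') auto
    also have "\<dots> = 2 powr s * K powr (- s)"
      using K by (simp add: powr_divide powr_minus field_simps)
    finally show "q ^ J0 \<le> 2 powr s * K powr (- s)" .
    show "0 \<le> L * C / (1 - q)" using L C_pos q by simp
  qed
  finally show ?thesis unfolding kept[unfolded t_def] a_def t_def q_def by simp
qed

end

section \<open>The risk bound\<close>

text \<open>A maximal inequality in linearized form: \<open>ln y \<le> ln a + y / a - 1\<close> makes the bound affine in the
  exponential sum, so that taking expectations requires neither a maximum nor Jensen's inequality.\<close>

lemma abs_le_ln_plus_exp_sum:
  fixes z :: "'i \<Rightarrow> real"
  assumes "finite I" "p \<in> I" "a > 0" "v > 0"
  shows "\<bar>z p\<bar> \<le> (ln a + (\<Sum>p\<in>I. exp (v * z p) + exp (- v * z p)) / a) / v"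
proof -
  define S where "S = (\<Sum>p\<in>I. exp (v * z p) + exp (- v * z p))"
  have "exp (v * \<bar>z p\<bar>) \<le> exp (v * z p) + exp (- v * z p)"
    by (cases "z p \<ge> 0") auto
  also have "\<dots> \<le> S" unfolding S_def using assms by (intro member_le_sum add_nonneg_nonneg) auto
  finally have S: "exp (v * \<bar>z p\<bar>) \<le> S" .
  have "ln (exp (v * \<bar>z p\<bar>) / a) \<le> exp (v * \<bar>z p\<bar>) / a - 1"
    using assms by (intro ln_le_minus_one) auto
  then have "v * \<bar>z p\<bar> \<le> ln a + exp (v * \<bar>z p\<bar>) / a" using assms by (simp add: ln_div)
  also have "\<dots> \<le> ln a + S / a" using S assms by (simp add: divide_right_mono)
  finally show ?thesis using assms by (simp add: S_def pos_le_divide_eq mult.commute)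
qed

context bounded_wavelets
begin

text \<open>Bias plus stochastic error for fixed n. The constant 8 in \<open>small\<close> makes the
  chosen exponent admissible: \<open>\<bar>v\<bar> / N\<close> is \<open>2 * \<theta>\<close>, and
  \<open>2 * C * (F + \<sigma>) * \<rho> \<le> 1/4\<close> is the condition on the moment generating
  function.\<close>

lemma sup_risk_le:
  fixes s L \<sigma> B :: real and n m :: nat
  defines "F \<equiv> L * C / (1 - 2 powr (- s))"
  defines "\<kappa> \<equiv> 7 * (F\<^sup>2 + \<sigma>\<^sup>2)"
  defines "K \<equiv> cutoff s n m B"
  defines "\<rho> \<equiv> sqrt (K * real (eta s n m B) * log 2 (real n) / real n)"
  assumes s: "s > 0" and L: "L > 0" and \<sigma>: "\<sigma> > 0"
    and n: "n \<ge> 2" and m: "m \<ge> 1" "m dvd n" and b: "block_size n B \<ge> 1"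
    and K: "1 \<le> K" "K \<le> real n" and small: "8 * C * (F + \<sigma>) * \<rho> \<le> 1"
  shows "sup_risk \<sigma> m (n div m) (estimator s \<psi> n m B) (besov_ball s \<psi> L)
     \<le> ennreal (F * 2 powr s * K powr (- s) + 4 * C * (5 + 2 * \<kappa>) * \<rho>)"
  unfolding sup_risk_def
proof (rule SUP_least)
  fix f assume f: "f \<in> besov_ball s \<psi> L"
  define E where "E = real (eta s n m B)"
  define lg where "lg = log 2 (real n)"
  define I where "I = kept_indices K"
  define D where "D = data_law \<sigma> m (n div m) f"
  \<comment> \<open>Each kept coefficient is an average over at least \<open>N\<close> observations. The choice of \<open>v\<close> balances
    \<open>ln a / v\<close> against the Gaussian exponent \<open>v\<^sup>2 / N = 2 lg\<close>.\<close>
  define v where "v = sqrt (real n * lg / E)"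
  define N where "N = real n / (2 * E)"
  define \<theta> where "\<theta> = sqrt (E * lg / real n)"
  define Z where "Z d p = local_average s \<psi> n m B d (fst p) (snd p) - inner_unit f (\<psi> (fst p) (snd p))" for d p
  \<comment> \<open>An upper bound for the expectation of S: at most n kept indices, with two
    exponentials each. With it the term \<open>S d / a\<close> of the maximal inequality has
    expectation at most 1.\<close>
  define a where "a = 2 * real n * exp (2 * \<kappa> * lg)"
  define S where "S d = (\<Sum>p\<in>I. exp (v * Z d p) + exp (- v * Z d p))" for d
  define bias where "bias = F * 2 powr s * K powr (- s)"
  have n1: "n \<ge> 1" and n0: "real n > 0" using n by auto
  have lg: "lg \<ge> 1" unfolding lg_def using n by (simp add: le_log_iff)
  have E1: "E \<ge> 1" unfolding E_def using eta_bounds(1)[OF m(1), of s n B] by simp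
  have q: "2 powr (- s) < (1::real)" using s by (simp add: powr_less_one)
  have F0: "F > 0" unfolding F_def using L C_pos q by simp
  have k0: "\<kappa> \<ge> 0" by (simp add: \<kappa>_def)
  have v0: "v > 0" unfolding v_def using n0 lg E1 by simp
  have N0: "N > 0" unfolding N_def using n0 E1 by simp
  have a0: "a > 0" unfolding a_def using n0 by simp
  have th: "\<theta> > 0" unfolding \<theta>_def using n0 lg E1 by simp
  have rho: "\<rho> = sqrt K * \<theta>"
    unfolding \<rho>_def \<theta>_def real_sqrt_mult[symmetric] by (simp add: E_def lg_def mult.assoc)
  have vN: "v / N = 2 * \<theta>"
  proof -
    have "v = \<theta> * (real n / E)"
    proof -
      have "real n * lg / E = (E * lg / real n) * (real n / E)\<^sup>2" using n0 E1 by (simp add: power2_eq_square)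
      then have "v = \<theta> * \<bar>real n / E\<bar>" unfolding v_def \<theta>_def by (simp only: real_sqrt_mult real_sqrt_abs)
      then show ?thesis using n0 E1 by simp
    qed
    then show ?thesis using n0 E1 by (simp add: N_def)
  qed
  have v2N: "v\<^sup>2 / N = 2 * lg" unfolding v_def N_def using n0 lg E1 by simp
  have lgv: "lg / v = \<theta>"
  proof -
    have "v * \<theta> = lg" unfolding v_def \<theta>_def real_sqrt_mult[symmetric] using n0 lg E1 by simp
    then show ?thesis using v0 by (simp add: field_simps)
  qed
  have finI: "finite I" unfolding I_def by (rule finite_kept_indices)
  have kI: "snd p < 2 ^ fst p" "real (2 ^ fst p + snd p) \<le> cutoff s n m B" if "p \<in> I" for p
    using that by (auto simp: I_def kept_indices_def K_def)
  have f2: "f \<in> l2_unit" using f by (simp add: besov_ball_def)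
  have fm: "f \<in> borel_measurable borel" using f2 by (simp add: l2_unit_iff)
  have fF: "AE x in unit_measure. \<bar>f x\<bar> \<le> F" unfolding F_def by (rule besov_function_bound[OF f L s])
  interpret D: prob_space D unfolding D_def by (rule prob_space_data_law[OF fm])
  have Zm [measurable]: "(\<lambda>d. Z d p) \<in> borel_measurable D" if "p \<in> I" for p
    unfolding Z_def D_def by (intro borel_measurable_diff measurable_local_average psi_measurable kI(1)[OF that]) auto
  have mgf: "(\<integral>\<^sup>+ d. ennreal (exp (w * Z d p)) \<partial>D) \<le> ennreal (exp (2 * \<kappa> * lg))" if p: "p \<in> I" and w: "\<bar>w\<bar> = v" for p w
  proof -
    define A where "A = averaged s n m B (fst p) (snd p)"
    have "real m / (2 * E) \<le> real (card A)"
      unfolding E_def A_def by (rule averaged_block(2)[OF m(1) b kI[OF p]])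
    then have "real m / (2 * E) * real (n div m) \<le> real (card A) * real (n div m)" by (intro mult_right_mono) auto
    moreover have "real m / (2 * E) * real (n div m) = N"
    proof -
      have "real m * real (n div m) = real n" using m by (simp flip: of_nat_mult)
      then show ?thesis by (simp add: N_def)
    qed
    ultimately have NA: "real (card (averaged s n m B (fst p) (snd p))) * real (n div m) \<ge> N" by (simp add: A_def)
    have "2 ^ fst p \<le> K" using kI(2)[OF p] by (simp add: K_def)
    then have "sqrt (2 ^ fst p) \<le> sqrt K" by simp
    moreover have "2 powr (real (fst p) / 2) = sqrt (2 ^ fst p)"
    proof -
      have "2 powr (real (fst p) / 2) = (2 powr real (fst p)) powr (1 / 2)" by (simp add: powr_powr)
      then show ?thesis by (simp add: powr_half_sqrt powr_realpow)
    qed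
    ultimately have pK: "2 powr (real (fst p) / 2) \<le> sqrt K" by simp
    have "\<bar>w\<bar> / N * (C * 2 powr (real (fst p) / 2)) * (F + \<sigma>) = 2 * \<theta> * (C * 2 powr (real (fst p) / 2)) * (F + \<sigma>)"
      unfolding w vN ..
    also have "\<dots> \<le> 2 * \<theta> * (C * sqrt K) * (F + \<sigma>)"
      using th C_pos F0 \<sigma> pK by (intro mult_right_mono mult_left_mono) auto
    also have "\<dots> = 2 * C * (F + \<sigma>) * \<rho>" by (simp add: rho)
    also have "\<dots> \<le> 1 / 4" using small by simp
    finally have "(\<integral>\<^sup>+ d. ennreal (exp (w * Z d p)) \<partial>D) \<le> ennreal (exp (7 * (F\<^sup>2 + \<sigma>\<^sup>2) * w\<^sup>2 / N))"
      unfolding D_def Z_def using F0 \<sigma>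
      by (intro local_average_mgf_le[OF fm kI(1)[OF p] fF _ _ m n1 NA N0]) auto
    also have "7 * (F\<^sup>2 + \<sigma>\<^sup>2) * w\<^sup>2 / N = \<kappa> * (v\<^sup>2 / N)"
      using w by (simp add: \<kappa>_def) (metis power2_abs)
    also have "\<dots> = 2 * \<kappa> * lg" by (simp add: v2N)
    finally show ?thesis .
  qed
  have Sm [measurable]: "S \<in> borel_measurable D" unfolding S_def[abs_def] by measurable
  have ES: "(\<integral>\<^sup>+ d. ennreal (S d) \<partial>D) \<le> ennreal a"
  proof -
    have "(\<integral>\<^sup>+ d. ennreal (S d) \<partial>D) = (\<integral>\<^sup>+ d. (\<Sum>p\<in>I. ennreal (exp (v * Z d p)) + ennreal (exp (- v * Z d p))) \<partial>D)"
      unfolding S_def by (subst sum_ennreal[symmetric]) (auto simp: ennreal_plus[symmetric] simp del: ennreal_plus)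
    also have "\<dots> = (\<Sum>p\<in>I. (\<integral>\<^sup>+ d. ennreal (exp (v * Z d p)) \<partial>D) + (\<integral>\<^sup>+ d. ennreal (exp (- v * Z d p)) \<partial>D))"
      by (subst nn_integral_sum) (auto intro!: sum.cong nn_integral_add)
    also have "\<dots> \<le> (\<Sum>p\<in>I. ennreal (exp (2 * \<kappa> * lg)) + ennreal (exp (2 * \<kappa> * lg)))"
      using v0 by (intro sum_mono add_mono mgf) auto
    also have "\<dots> = ennreal (\<Sum>p\<in>I. 2 * exp (2 * \<kappa> * lg))"
      by (subst sum_ennreal[symmetric]) (auto simp: ennreal_plus[symmetric] simp del: ennreal_plus)
    also have "\<dots> \<le> ennreal a"
    proof (rule ennreal_leI)
      have "real (card I) \<le> real n" using card_kept_indices_le[of K] K by (simp add: I_def)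
      then have "real (card I) * (2 * exp (2 * \<kappa> * lg)) \<le> real n * (2 * exp (2 * \<kappa> * lg))" by (intro mult_right_mono) auto
      then show "(\<Sum>p\<in>I. 2 * exp (2 * \<kappa> * lg)) \<le> a" by (simp add: a_def mult_ac)
    qed
    finally show ?thesis .
  qed
  define P where "P = 4 * C * sqrt K"
  define R where "R d = ((ln a + S d / a) / v + 2 / sqrt (real n)) * P + bias" for d
  have P0: "P \<ge> 0" unfolding P_def using C_pos K by simp
  \<comment> \<open>The bound holds for each d separately and is affine in \<open>S d\<close>. Only
    the exponential sum has to be integrated, and measurability of the sup norm as a function of the
    data never comes up.\<close>
  have sup: "sup_norm_unit (\<lambda>x. estimator s \<psi> n m B d x - f x) \<le> ennreal (R d)" for d
    unfolding sup_norm_unit_def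
  proof (rule esssup_I)
    show "(\<lambda>x. ennreal \<bar>estimator s \<psi> n m B d x - f x\<bar>) \<in> borel_measurable (restrict_space lborel {0..1})"
    proof (rule measurable_restrict_space1)
      have [measurable]: "estimator s \<psi> n m B d \<in> borel_measurable borel"
        by (rule measurable_estimator[OF psi_measurable])
      note fm [measurable]
      show "(\<lambda>x. ennreal \<bar>estimator s \<psi> n m B d x - f x\<bar>) \<in> borel_measurable lborel" by measurable
    qed
    show "AE x in restrict_space lborel {0..1}. ennreal \<bar>estimator s \<psi> n m B d x - f x\<bar> \<le> ennreal (R d)"
      using besov_expansion[OF f L s]
    proof eventually_elim
      fix x assume fx: "f x = (\<Sum>j. \<Sum>k<2^j. inner_unit f (\<psi> j k) * \<psi> j k x)"
      define e where "e p = est_coeff s \<psi> n m B d (fst p) (snd p)" for p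
      define c where "c p = inner_unit f (\<psi> (fst p) (snd p))" for p
      define \<Psi> where "\<Psi> p = \<psi> (fst p) (snd p) x" for p
      have est: "estimator s \<psi> n m B d x = (\<Sum>p\<in>I. e p * \<Psi> p)"
        by (simp add: estimator_def I_def kept_indices_def K_def e_def \<Psi>_def case_prod_unfold)
      have err: "\<bar>e p - c p\<bar> \<le> (ln a + S d / a) / v + 2 / sqrt (real n)" if p: "p \<in> I" for p
      proof -
        have "\<bar>e p - local_average s \<psi> n m B d (fst p) (snd p)\<bar> \<le> 2 / sqrt (real n)"
          unfolding e_def by (rule est_coeff_error[OF n1 m(1) b kI[OF p]])
        moreover have "\<bar>Z d p\<bar> \<le> (ln a + S d / a) / v"
          unfolding S_def by (rule abs_le_ln_plus_exp_sum[OF finI p a0 v0])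
        ultimately show ?thesis unfolding Z_def c_def by linarith
      qed
      have "\<bar>(\<Sum>p\<in>I. c p * \<Psi> p) - f x\<bar> \<le> bias"
        using truncation_bias_le[OF f L s, of K x] K
        by (simp add: fx bias_def F_def I_def c_def \<Psi>_def case_prod_unfold)
      moreover have "\<bar>(\<Sum>p\<in>I. e p * \<Psi> p) - (\<Sum>p\<in>I. c p * \<Psi> p)\<bar> \<le> ((ln a + S d / a) / v + 2 / sqrt (real n)) * P"
      proof -
        have "(\<Sum>p\<in>I. e p * \<Psi> p) - (\<Sum>p\<in>I. c p * \<Psi> p) = (\<Sum>p\<in>I. (e p - c p) * \<Psi> p)"
          by (simp add: sum_subtractf left_diff_distrib)
        then have "\<bar>(\<Sum>p\<in>I. e p * \<Psi> p) - (\<Sum>p\<in>I. c p * \<Psi> p)\<bar> \<le> (\<Sum>p\<in>I. \<bar>e p - c p\<bar> * \<bar>\<Psi> p\<bar>)"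
          using sum_abs[of "\<lambda>p. (e p - c p) * \<Psi> p" I] by (simp add: abs_mult)
        also have "\<dots> \<le> (\<Sum>p\<in>I. ((ln a + S d / a) / v + 2 / sqrt (real n)) * \<bar>\<Psi> p\<bar>)"
          using err by (intro sum_mono mult_right_mono) auto
        also have "\<dots> = ((ln a + S d / a) / v + 2 / sqrt (real n)) * (\<Sum>p\<in>I. \<bar>\<Psi> p\<bar>)"
          by (simp add: sum_distrib_left)
        also have "\<dots> \<le> ((ln a + S d / a) / v + 2 / sqrt (real n)) * P"
        proof (rule mult_left_mono)
          show "(\<Sum>p\<in>I. \<bar>\<Psi> p\<bar>) \<le> P"
            using sum_kept_psi_le[OF K(1), of x] by (simp add: I_def \<Psi>_def P_def case_prod_unfold)
          have "a \<ge> 1"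
          proof -
            have "1 * 1 \<le> (2 * real n) * exp (2 * \<kappa> * lg)" using n1 k0 lg by (intro mult_mono) auto
            then show ?thesis by (simp add: a_def)
          qed
          moreover have "S d \<ge> 0" unfolding S_def by (intro sum_nonneg) auto
          ultimately show "0 \<le> (ln a + S d / a) / v + 2 / sqrt (real n)" using v0 by simp
        qed
        finally show ?thesis .
      qed
      ultimately have "\<bar>estimator s \<psi> n m B d x - f x\<bar> \<le> R d" unfolding est R_def by linarith
      then show "ennreal \<bar>estimator s \<psi> n m B d x - f x\<bar> \<le> ennreal (R d)" by (rule ennreal_leI)
    qed
  qed
  have bias0: "bias \<ge> 0" unfolding bias_def using F0 by simp
  have a1: "ln a \<ge> 0"
  proof -
    have "1 * 1 \<le> (2 * real n) * exp (2 * \<kappa> * lg)" using n1 k0 lg by (intro mult_mono) auto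
    then show ?thesis by (simp add: a_def)
  qed
  define c0 where "c0 = (ln a / v + 2 / sqrt (real n)) * P + bias"
  define c1 where "c1 = P / (a * v)"
  have c: "c0 \<ge> 0" "c1 \<ge> 0" unfolding c0_def c1_def using a0 a1 v0 P0 bias0 by simp_all
  have S0: "S d \<ge> 0" for d unfolding S_def by (intro sum_nonneg) auto
  have Rd: "ennreal (R d) = ennreal c0 + ennreal c1 * ennreal (S d)" for d
  proof -
    have "R d = c0 + c1 * S d" unfolding R_def c0_def c1_def using a0 v0 by (simp add: field_simps)
    then show ?thesis using c S0[of d] by (simp add: ennreal_mult)
  qed
  have "(\<integral>\<^sup>+ d. sup_norm_unit (\<lambda>x. estimator s \<psi> n m B d x - f x) \<partial>D) \<le> (\<integral>\<^sup>+ d. ennreal (R d) \<partial>D)"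
    by (intro nn_integral_mono sup)
  also have "\<dots> = ennreal c0 + ennreal c1 * (\<integral>\<^sup>+ d. ennreal (S d) \<partial>D)"
    unfolding Rd by (simp add: nn_integral_add nn_integral_cmult D.emeasure_space_1)
  also have "\<dots> \<le> ennreal c0 + ennreal c1 * ennreal a"
    by (intro add_left_mono mult_left_mono ES) auto
  also have "\<dots> = ennreal (c0 + c1 * a)" using c a0 by (simp add: ennreal_mult)
  also have "\<dots> \<le> ennreal (F * 2 powr s * K powr (- s) + 4 * C * (5 + 2 * \<kappa>) * \<rho>)"
  proof (rule ennreal_leI)
    have "ln 2 \<le> (1::real)" using ln_le_minus_one[of 2] by simp
    have "ln (real n) = lg * ln 2" by (simp add: lg_def log_def)
    also have "\<dots> \<le> lg * 1" using lg \<open>ln 2 \<le> 1\<close> by (intro mult_left_mono) auto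
    finally have lnn: "ln (real n) \<le> lg" by simp
    \<comment> \<open>Of the factor \<open>5 + 2 * \<kappa>\<close>, one unit each is due to
      \<open>ln 2\<close>, \<open>ln n\<close> and the additive 1, two units to the lost digits, and
      \<open>2 * \<kappa>\<close> to the Gaussian exponent.\<close>
    have "ln a = ln 2 + ln (real n) + 2 * \<kappa> * lg" unfolding a_def using n0 by (simp add: ln_mult)
    then have "ln a + 1 \<le> lg + lg + 2 * \<kappa> * lg + lg" using lnn lg \<open>ln 2 \<le> 1\<close> by linarith
    then have "ln a + 1 \<le> (3 + 2 * \<kappa>) * lg" by (simp add: algebra_simps)
    then have "(ln a + 1) / v \<le> (3 + 2 * \<kappa>) * lg / v" using v0 by (intro divide_right_mono) auto
    also have "\<dots> = (3 + 2 * \<kappa>) * \<theta>" using lgv by (simp add: times_divide_eq_right[symmetric] del: times_divide_eq_right)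
    finally have t1: "(ln a + 1) / v \<le> (3 + 2 * \<kappa>) * \<theta>" .
    have "1 / real n \<le> E * lg / real n"
    proof (rule divide_right_mono)
      show "1 \<le> E * lg" using mult_mono[of 1 E 1 lg] E1 lg by simp
    qed simp
    then have "sqrt (1 / real n) \<le> \<theta>" unfolding \<theta>_def by (rule real_sqrt_le_mono)
    then have t2: "2 / sqrt (real n) \<le> 2 * \<theta>" by (simp add: real_sqrt_divide)
    have "c0 + c1 * a = ((ln a + 1) / v + 2 / sqrt (real n)) * P + bias"
      unfolding c0_def c1_def using a0 v0 by (simp add: field_simps)
    also have "\<dots> \<le> ((3 + 2 * \<kappa>) * \<theta> + 2 * \<theta>) * P + bias"
      using t1 t2 P0 by (intro add_right_mono mult_right_mono) auto
    also have "\<dots> = bias + 4 * C * (5 + 2 * \<kappa>) * \<rho>" unfolding P_def rho by (simp add: algebra_simps)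
    finally show "c0 + c1 * a \<le> F * 2 powr s * K powr (- s) + 4 * C * (5 + 2 * \<kappa>) * \<rho>" unfolding bias_def .
  qed
  finally show "(\<integral>\<^sup>+ d. sup_norm_unit (\<lambda>x. estimator s \<psi> n m B d x - f x) \<partial>data_law \<sigma> m (n div m) f)
     \<le> ennreal (F * 2 powr s * K powr (- s) + 4 * C * (5 + 2 * \<kappa>) * \<rho>)" unfolding D_def .
qed

end

section \<open>Rates\<close>

definition sampling_error :: "real \<Rightarrow> nat \<Rightarrow> nat \<Rightarrow> real \<Rightarrow> real" where
  "sampling_error s n m B = sqrt (cutoff s n m B * real (eta s n m B) * log 2 (real n) / real n)"

definition limited_rate :: "real \<Rightarrow> nat \<Rightarrow> real \<Rightarrow> real" where
  "limited_rate s n B = log_factor s n *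
     (real n powr (1 / (1 + 2 * s)) / (B * log 2 (real n) powr ((3 + 4 * s) / (1 + 2 * s)))) powr (s / (2 + 2 * s)) *
     minimax_rate s n"

lemma log2_bounds:
  assumes "n \<ge> 2"
  shows "1 \<le> log 2 (real n)" "log 2 (real n) \<le> real n"
proof -
  show "1 \<le> log 2 (real n)" using assms by (simp add: le_log_iff)
  have "real n < 2 ^ n" using less_exp[of n] by (metis of_nat_less_iff of_nat_numeral of_nat_power)
  then have "log 2 (real n) < real n" using assms by (simp add: log_less_iff powr_realpow)
  then show "log 2 (real n) \<le> real n" by simp
qed

lemma nat_floor_ge_half:
  assumes "x \<ge> (1::real)" shows "x / 2 \<le> real (nat \<lfloor>x\<rfloor>)" "real (nat \<lfloor>x\<rfloor>) \<le> x" "nat \<lfloor>x\<rfloor> \<ge> 1"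
proof -
  have "\<lfloor>x\<rfloor> \<ge> 1" using assms by simp
  then have e: "real (nat \<lfloor>x\<rfloor>) = of_int \<lfloor>x\<rfloor>" and f: "nat \<lfloor>x\<rfloor> \<ge> 1" by linarith+
  show "nat \<lfloor>x\<rfloor> \<ge> 1" by (rule f)
  have "1 \<le> real (nat \<lfloor>x\<rfloor>)" using f by simp
  then show "x / 2 \<le> real (nat \<lfloor>x\<rfloor>)" "real (nat \<lfloor>x\<rfloor>) \<le> x" unfolding e by linarith+
qed

text \<open>\<open>max_index\<close> is the classical balance of bias and noise without
  communication constraint: it solves \<open>M powr (- s) = sqrt (M * log 2 n / n)\<close>, and both
  sides equal \<open>minimax_rate\<close>.\<close>

lemma max_index_bounds:
  assumes n: "n \<ge> 2" and s: "s > 0"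
  shows "1 \<le> max_index s n" "max_index s n \<le> real n"
    and "max_index s n powr (- s) = minimax_rate s n"
    and "max_index s n * log 2 (real n) / real n = (minimax_rate s n)\<^sup>2"
    and "minimax_rate s n > 0"
proof -
  define X where "X = real n / log 2 (real n)"
  define l where "l = log 2 (real n)"
  have l: "1 \<le> l" "l \<le> real n" "l > 0" using log2_bounds[OF n] unfolding l_def by linarith+
  have X: "X \<ge> 1" using l by (simp add: X_def l_def[symmetric])
  have Xn: "X \<le> real n" using l by (simp add: X_def l_def[symmetric] divide_le_eq)
  show "1 \<le> max_index s n" unfolding max_index_def X_def[symmetric] using X s by (intro ge_one_powr_ge_zero) auto
  have "max_index s n \<le> X powr 1" unfolding max_index_def X_def[symmetric] using X s by (intro powr_mono) auto
  then show "max_index s n \<le> real n" using X Xn by simp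
  show "max_index s n powr (- s) = minimax_rate s n"
    unfolding max_index_def minimax_rate_def X_def[symmetric] by (simp add: powr_powr)
  have "max_index s n * log 2 (real n) / real n = X powr (1 / (1 + 2 * s)) / X powr 1"
  proof -
    have "a * log 2 (real n) / real n = a / X" for a by (simp add: X_def)
    then show ?thesis unfolding max_index_def X_def[symmetric] using X by simp
  qed
  also have "\<dots> = X powr (1 / (1 + 2 * s) - 1)" by (rule powr_diff[symmetric])
  also have "1 / (1 + 2 * s) - 1 = 2 * (- s / (1 + 2 * s))" using s by (simp add: field_simps)
  also have "X powr \<dots> = (X powr (- s / (1 + 2 * s)))\<^sup>2"
    by (simp add: power2_eq_square flip: powr_add)
  finally show "max_index s n * log 2 (real n) / real n = (minimax_rate s n)\<^sup>2"
    by (simp add: minimax_rate_def X_def)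
  show "minimax_rate s n > 0" unfolding minimax_rate_def X_def[symmetric] using X by simp
qed

text \<open>At this budget a single machine can afford \<open>max_index\<close> coefficients, up to
  rounding, and the ratio inside \<open>eta\<close> equals 1.\<close>

lemma threshold_powr:
  assumes n: "n \<ge> 2" and s: "s > 0"
  shows "threshold s n powr (1 + 2 * s) = real n * log 2 (real n) powr (2 * s)"
    and "threshold s n / log 2 (real n) = max_index s n" and "threshold s n > 0"
proof -
  define l where "l = log 2 (real n)"
  have l: "l > 0" using log2_bounds(1)[OF n] unfolding l_def by linarith
  have n0: "real n > 0" using n by simp
  show "threshold s n > 0" unfolding threshold_def l_def[symmetric] using l n0 by simp
  show "threshold s n powr (1 + 2 * s) = real n * log 2 (real n) powr (2 * s)"
    unfolding threshold_def l_def[symmetric] using l n0 s by (simp add: powr_mult powr_powr)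
  have "threshold s n / l = real n powr (1 / (1 + 2 * s)) * (l powr (2 * s / (1 + 2 * s)) / l powr 1)"
    unfolding threshold_def l_def[symmetric] using l by simp
  also have "l powr (2 * s / (1 + 2 * s)) / l powr 1 = l powr (2 * s / (1 + 2 * s) - 1)" by (rule powr_diff[symmetric])
  also have "2 * s / (1 + 2 * s) - 1 = - (1 / (1 + 2 * s))" using s by (simp add: field_simps)
  also have "real n powr (1 / (1 + 2 * s)) * l powr \<dots> = max_index s n"
    unfolding max_index_def l_def[symmetric] using l n0 by (simp add: powr_divide powr_minus_divide)
  finally show "threshold s n / log 2 (real n) = max_index s n" by (simp add: l_def)
qed

text \<open>Above the threshold \<open>eta\<close> is 1: there is one block and every machine
  reports every kept coefficient. Rounding \<open>block_size\<close> down may cost half of the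
  cutoff, hence the factor \<open>2 powr s\<close>.\<close>

lemma large_budget_rates:
  assumes n: "n \<ge> 2" and s: "s > 0" and m: "m \<ge> 1" and B: "B \<ge> threshold s n"
  shows "block_size n B \<ge> 1" and "1 \<le> cutoff s n m B" and "cutoff s n m B \<le> real n"
    and "cutoff s n m B powr (- s) \<le> 2 powr s * minimax_rate s n"
    and "sampling_error s n m B \<le> minimax_rate s n"
proof -
  define M where "M = max_index s n"
  note mi = max_index_bounds[OF n s, folded M_def]
  note th = threshold_powr[OF n s, folded M_def]
  have l: "log 2 (real n) \<ge> 1" by (rule log2_bounds[OF n])
  have "M \<le> B / log 2 (real n)" using B l th(2) by (metis divide_right_mono order_trans zero_le_one)
  moreover from this have "1 \<le> B / log 2 (real n)" using mi(1) by linarith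
  ultimately have b: "block_size n B \<ge> 1" "M / 2 \<le> real (block_size n B)"
    using nat_floor_ge_half(1,3)[of "B / log 2 (real n)"] unfolding block_size_def by simp_all
  show "block_size n B \<ge> 1" by (rule b)
  have "threshold s n powr (1 + 2 * s) \<le> B powr (1 + 2 * s)" using B th(3) s by (intro powr_mono2) auto
  then have "real n * log 2 (real n) powr (2 * s) / B powr (1 + 2 * s) \<le> 1"
    unfolding th(1) using B th(3) by (simp add: divide_le_eq)
  then have "(real n * log 2 (real n) powr (2 * s) / B powr (1 + 2 * s)) powr (1 / (2 + 2 * s)) \<le> 1"
    using s by (intro powr_le1) auto
  then have "nat \<lfloor>(real n * log 2 (real n) powr (2 * s) / B powr (1 + 2 * s)) powr (1 / (2 + 2 * s))\<rfloor> \<le> 1"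
    by linarith
  then have eta: "eta s n m B = 1" unfolding eta_def by linarith
  have K: "cutoff s n m B = min (real (block_size n B)) M" by (simp add: cutoff_def eta M_def)
  show K1: "1 \<le> cutoff s n m B" "cutoff s n m B \<le> real n" unfolding K using b mi by auto
  have "cutoff s n m B powr (- s) \<le> (M / 2) powr (- s)"
    unfolding K using b mi s by (intro powr_mono2') auto
  also have "\<dots> = 2 powr s * minimax_rate s n"
    unfolding mi(3)[symmetric] using mi(1) by (simp add: powr_divide powr_minus_divide)
  finally show "cutoff s n m B powr (- s) \<le> 2 powr s * minimax_rate s n" .
  have "cutoff s n m B * real (eta s n m B) * log 2 (real n) / real n \<le> M * log 2 (real n) / real n"
    unfolding eta K using l by (intro divide_right_mono mult_right_mono) auto
  then have "sampling_error s n m B \<le> sqrt ((minimax_rate s n)\<^sup>2)"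
    unfolding sampling_error_def mi(4) by (rule real_sqrt_le_mono)
  then show "sampling_error s n m B \<le> minimax_rate s n" using mi(5) by simp
qed

text \<open>The exponents in the stated rate collapse to those of one product
  \<open>n * B * log 2 n\<close>. Taking logarithms turns the claim into an identity between
  coefficients.\<close>

lemma limited_rate_eq:
  assumes n: "n \<ge> 2" and s: "s > 0" and B: "B > 0"
  shows "limited_rate s n B = log 2 (real n) powr (max s (3 * s / (2 + 2 * s))) *
     (real n * B * log 2 (real n)) powr (- s / (2 + 2 * s))"
proof -
  define l where "l = log 2 (real n)"
  have l: "l > 0" using log2_bounds(1)[OF n] unfolding l_def by linarith
  have n0: "real n > 0" using n by simp
  define e where "e = max s (3 * s / (2 + 2 * s))"
  have ne: "1 + 2 * s \<noteq> 0" "2 + 2 * s \<noteq> 0" "1 + s \<noteq> 0" using s by auto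
  define h where "h = s / (2 + 2 * s)"
  have h: "(1 / (1 + 2 * s)) * h - s / (1 + 2 * s) = - h" "h * ((3 + 4 * s) / (1 + 2 * s)) - s / (1 + 2 * s) = h"
    using ne by (simp_all add: h_def divide_simps) (simp_all add: algebra_simps)
  have "ln ((real n powr (1 / (1 + 2 * s)) / (B * l powr ((3 + 4 * s) / (1 + 2 * s)))) powr h * (real n / l) powr (- s / (1 + 2 * s)))
     = ln (real n) * ((1 / (1 + 2 * s)) * h - s / (1 + 2 * s)) - h * ln B
       - ln l * (h * ((3 + 4 * s) / (1 + 2 * s)) - s / (1 + 2 * s))"
    using n0 l B by (simp add: ln_mult ln_div) (simp add: algebra_simps diff_divide_distrib add_divide_distrib)
  also have "\<dots> = ln ((real n * B * l) powr (- h))"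
    unfolding h using n0 l B by (simp add: ln_mult algebra_simps)
  finally have "(real n powr (1 / (1 + 2 * s)) / (B * l powr ((3 + 4 * s) / (1 + 2 * s)))) powr h * (real n / l) powr (- s / (1 + 2 * s))
     = (real n * B * l) powr (- h)"
    using n0 l B by (subst (asm) ln_inj_iff) auto
  then show ?thesis
    by (simp add: limited_rate_def log_factor_def minimax_rate_def l_def h_def mult.assoc)
qed

text \<open>The two terms of the exponent \<open>max s (3 * s / (2 + 2 * s))\<close> correspond to the two values of
  \<open>eta\<close>: all \<open>m\<close> machines, respectively the balancing value \<open>Y\<close>.\<close>

lemma small_budget_rates:
  assumes n: "n \<ge> 2" and s: "s > 0" and m: "m \<ge> 1"
    and B: "max ((real n * log 2 (real n) / real m powr (2 + 2 * s)) powr (1 / (1 + 2 * s))) (log 2 (real n)) \<le> B"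
    and Bt: "B < threshold s n"
  shows "block_size n B \<ge> 1" and "1 \<le> cutoff s n m B" and "cutoff s n m B \<le> real n"
    and "cutoff s n m B powr (- s) \<le> (1 + 2 powr s + 4 powr s) * limited_rate s n B"
    and "sampling_error s n m B \<le> limited_rate s n B"
    and "sampling_error s n m B \<le> (log 2 (real n) / real n) powr (s / (2 + 2 * s))"
proof -
  define l where "l = log 2 (real n)"
  define M where "M = max_index s n"
  define h where "h = 1 / (2 + 2 * s)"
  define x where "x = real n"
  define E where "E = real (eta s n m B)"
  define b where "b = real (block_size n B)"
  define T where "T = limited_rate s n B"
  note mi = max_index_bounds[OF n s, folded M_def]
  note th = threshold_powr[OF n s, folded M_def l_def x_def]
  have l: "l \<ge> 1" "l \<le> x" using log2_bounds[OF n] by (auto simp: l_def x_def)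
  have x: "x > 0" using n by (simp add: x_def)
  have h0: "h > 0" using s by (simp add: h_def)
  have hs: "h * (2 + 2 * s) = 1" using s by (simp add: h_def)
  have Bl: "l \<le> B" using B by (simp add: l_def)
  have B0: "B > 0" using Bl l by linarith
  have bl: "B / l \<ge> 1" using Bl l by simp
  have b: "b \<ge> 1" "B / l / 2 \<le> b" "b \<le> B / l"
    using nat_floor_ge_half[OF bl] unfolding b_def block_size_def l_def by linarith+
  then show "block_size n B \<ge> 1" by (simp add: b_def)
  \<comment> \<open>Y is the solution of
    \<open>(Y * B / l) powr (- s) = sqrt (Y\<^sup>2 * B / x)\<close>, that is, bias equal to noise
    at the cutoff \<open>Y * B / l\<close>.\<close>
  define Y where "Y = (x * l powr (2 * s) / B powr (1 + 2 * s)) powr h"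
  have "B powr (1 + 2 * s) \<le> threshold s n powr (1 + 2 * s)" using Bt B0 s by (intro powr_mono2) auto
  then have "1 \<le> x * l powr (2 * s) / B powr (1 + 2 * s)"
    unfolding th(1) using B0 by (simp add: le_divide_eq)
  then have Y1: "Y \<ge> 1" unfolding Y_def using h0 by (intro ge_one_powr_ge_zero) auto
  have eta: "eta s n m B = max (min (nat \<lfloor>Y\<rfloor>) m) 1"
    by (simp add: eta_def Y_def x_def l_def h_def)
  note fl = nat_floor_ge_half[OF Y1]
  have "max (min (nat \<lfloor>Y\<rfloor>) m) 1 = min (nat \<lfloor>Y\<rfloor>) m" using fl(3) m by simp
  then have "E = min (real (nat \<lfloor>Y\<rfloor>)) (real m)" unfolding E_def eta by (simp only: of_nat_min)
  moreover have "1 \<le> real (nat \<lfloor>Y\<rfloor>)" "1 \<le> real m" using fl(3) m by simp_all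
  ultimately have E: "1 \<le> E" "E \<le> Y" "min (Y / 2) (real m) \<le> E"
    using fl(1,2) by linarith+
  have K: "cutoff s n m B = min (E * b) M" by (simp add: cutoff_def E_def b_def M_def)
  have Eb: "E * b \<ge> 1" using mult_mono[of 1 E 1 b] E b by simp
  show "1 \<le> cutoff s n m B" "cutoff s n m B \<le> real n" unfolding K using Eb mi by auto
  have T: "T = l powr (max s (3 * s / (2 + 2 * s))) * (x * B * l) powr (- (s * h))"
    unfolding T_def limited_rate_eq[OF n s B0] by (simp add: l_def x_def h_def)
  \<comment> \<open>G is the common value of the two sides at the balance. Its power of l accounts
    for the term \<open>3 * s / (2 + 2 * s)\<close> in \<open>log_factor\<close>.\<close>
  define G where "G = l powr (3 * s * h) * (x * B * l) powr (- (s * h))"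
  have GT: "G \<le> T" unfolding T G_def using l h0
    by (intro mult_right_mono powr_mono) (auto simp: h_def)
  have lnY: "ln Y = h * (ln x + 2 * s * ln l - (1 + 2 * s) * ln B)"
    unfolding Y_def using x l B0 by (simp add: ln_div ln_mult)
  have lnG: "ln G = 2 * s * h * ln l - s * h * ln x - s * h * ln B"
    unfolding G_def using x l B0 by (simp add: ln_mult algebra_simps)
  have G0: "G > 0" unfolding G_def using x l B0 by simp
  have T0: "T > 0" using G0 GT by linarith
  have Y2: "Y\<^sup>2 * B / x = G\<^sup>2"
  proof -
    have "ln (Y\<^sup>2 * B / x) = 2 * ln Y + ln B - ln x"
      using Y1 B0 x by (simp add: ln_mult ln_div ln_realpow)
    also have "\<dots> = 2 * ln G"
    proof -
      \<comment> \<open>The number 1 is written as \<open>h * (2 + 2 * s)\<close>, which makes both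
        sides polynomial in h and s.\<close>
      have "2 * ln Y + (h * (2 + 2 * s)) * ln B - (h * (2 + 2 * s)) * ln x = 2 * ln G"
        unfolding lnY lnG by (simp add: algebra_simps)
      then show ?thesis unfolding hs by simp
    qed
    also have "\<dots> = ln (G\<^sup>2)" using G0 by (simp add: ln_realpow)
    finally show ?thesis using Y1 B0 x G0 by (subst (asm) ln_inj_iff) auto
  qed
  have rG: "sampling_error s n m B \<le> G"
  proof -
    have "cutoff s n m B * E * l / x \<le> (E * b) * E * l / x"
      unfolding K using E l x by (intro divide_right_mono mult_right_mono) auto
    also have "\<dots> \<le> (E * (B / l)) * E * l / x"
      using E l x b by (intro divide_right_mono mult_right_mono mult_left_mono) auto
    also have "\<dots> = E\<^sup>2 * B / x" using l by (simp add: power2_eq_square)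
    also have "\<dots> \<le> Y\<^sup>2 * B / x" using E B0 x by (intro divide_right_mono mult_right_mono power_mono) auto
    finally have "sqrt (cutoff s n m B * E * l / x) \<le> sqrt (G\<^sup>2)" unfolding Y2 by (rule real_sqrt_le_mono)
    then show ?thesis using G0 by (simp add: sampling_error_def E_def l_def x_def)
  qed
  then show "sampling_error s n m B \<le> limited_rate s n B" using GT by (simp add: T_def)
  \<comment> \<open>The assumption \<open>l \<le> B\<close> removes B from the bound; smallness for
    large n is then uniform in B and m.\<close>
  have "ln G \<le> ln ((l / x) powr (s * h))"
  proof -
    have "s * h * ln l \<le> s * h * ln B" using Bl l s h0 by (intro mult_left_mono) auto
    then show ?thesis unfolding lnG using x l by (simp add: ln_div algebra_simps)
  qed
  then have "G \<le> (l / x) powr (s * h)" using G0 x l by (subst (asm) ln_le_cancel_iff) auto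
  then show "sampling_error s n m B \<le> (log 2 (real n) / real n) powr (s / (2 + 2 * s))"
    using rG by (simp add: l_def x_def h_def)
  \<comment> \<open>A budget below the threshold makes the quotient in \<open>limited_rate\<close>
    at least \<open>l powr (- 3)\<close>, and \<open>log_factor\<close> compensates its power. Hence
    the limited rate is never faster than the minimax rate.\<close>
  have M: "M powr (- s) \<le> T"
  proof -
    have r: "1 \<le> l powr (max s (3 * s / (2 + 2 * s))) *
     (x powr (1 / (1 + 2 * s)) / (B * l powr ((3 + 4 * s) / (1 + 2 * s)))) powr (s / (2 + 2 * s))"
    proof -
      have th': "threshold s n = x powr (1 / (1 + 2 * s)) * l powr (2 * s / (1 + 2 * s))"
        by (simp add: threshold_def x_def l_def)
      have "B * l powr ((3 + 4 * s) / (1 + 2 * s)) \<le> (x powr (1 / (1 + 2 * s)) * l powr (2 * s / (1 + 2 * s))) * l powr ((3 + 4 * s) / (1 + 2 * s))"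
        using Bt unfolding th' by (intro mult_right_mono) auto
      also have "\<dots> = x powr (1 / (1 + 2 * s)) * l powr (2 * s / (1 + 2 * s) + (3 + 4 * s) / (1 + 2 * s))"
        by (simp add: powr_add)
      also have "2 * s / (1 + 2 * s) + (3 + 4 * s) / (1 + 2 * s) = 3"
        using s by (simp add: add_divide_distrib[symmetric] divide_eq_eq)
      finally have "l powr (- 3) \<le> x powr (1 / (1 + 2 * s)) / (B * l powr ((3 + 4 * s) / (1 + 2 * s)))"
        using B0 l by (simp add: powr_minus field_simps)
      then have "(l powr (- 3)) powr (s / (2 + 2 * s)) \<le> (x powr (1 / (1 + 2 * s)) / (B * l powr ((3 + 4 * s) / (1 + 2 * s)))) powr (s / (2 + 2 * s))"
        using s by (intro powr_mono2) auto
      then have "l powr (3 * s / (2 + 2 * s)) * (l powr (- 3)) powr (s / (2 + 2 * s)) \<le> l powr (max s (3 * s / (2 + 2 * s))) *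
         (x powr (1 / (1 + 2 * s)) / (B * l powr ((3 + 4 * s) / (1 + 2 * s)))) powr (s / (2 + 2 * s))"
        using l by (intro mult_mono powr_mono) auto
      moreover have "l powr (3 * s / (2 + 2 * s)) * (l powr (- 3)) powr (s / (2 + 2 * s)) = 1"
        using l by (simp add: powr_powr flip: powr_add)
      ultimately show ?thesis by simp
    qed
    have "1 * minimax_rate s n \<le> T"
      unfolding T_def limited_rate_def log_factor_def l_def[symmetric] unfolding x_def[symmetric]
      using mi(5) by (intro mult_right_mono r) auto
    then show ?thesis using mi(3) by simp
  qed
  \<comment> \<open>The balancing case. The 4 collects the two halvings from rounding down Y and
    \<open>B / l\<close>.\<close>
  have Yb: "(Y / 2 * (B / l / 2)) powr (- s) \<le> 4 powr s * T"
  proof -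
    have "ln ((Y * B / l) powr (- s)) = - s * (ln Y + ln B - ln l)"
      using Y1 B0 l by (simp add: ln_mult ln_div)
    also have "\<dots> = ln G"
    proof -
      have "- s * (ln Y + (h * (2 + 2 * s)) * ln B - (h * (2 + 2 * s)) * ln l) = ln G"
        unfolding lnY lnG by (simp add: algebra_simps)
      then show ?thesis unfolding hs by simp
    qed
    finally have "(Y * B / l) powr (- s) = G" using Y1 B0 l G0 by (subst (asm) ln_inj_iff) auto
    moreover have "(Y / 2 * (B / l / 2)) powr (- s) = 4 powr s * (Y * B / l) powr (- s)"
    proof -
      have "Y / 2 * (B / l / 2) = (Y * B / l) / 4" by simp
      then show ?thesis using Y1 B0 l by (simp only: powr_divide powr_minus) (simp add: field_simps powr_minus)
    qed
    ultimately show ?thesis using GT by simp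
  qed
  \<comment> \<open>The case in which all m machines are used up. The lower bound on B says
    \<open>x * l \<le> m powr (2 + 2 * s) * B powr (1 + 2 * s)\<close>, and the resulting factor
    \<open>l powr s\<close> is the other term of \<open>log_factor\<close>.\<close>
  have mb: "(real m * (B / l / 2)) powr (- s) \<le> 2 powr s * T"
  proof -
    have m0: "real m > 0" using m by simp
    have "(x * l / real m powr (2 + 2 * s)) powr (1 / (1 + 2 * s)) \<le> B" using B by (simp add: x_def l_def)
    then have "ln ((x * l / real m powr (2 + 2 * s)) powr (1 / (1 + 2 * s))) \<le> ln B"
      using x l m0 by (intro ln_mono) auto
    then have "(ln x + ln l - (2 + 2 * s) * ln (real m)) / (1 + 2 * s) \<le> ln B"
      using x l m0 by (simp add: ln_mult ln_div)
    then have "ln x + ln l \<le> (2 + 2 * s) * ln (real m) + (1 + 2 * s) * ln B"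
      using s by (simp add: divide_le_eq algebra_simps)
    then have "s * h * (ln x + ln l) \<le> s * h * ((2 + 2 * s) * ln (real m) + (1 + 2 * s) * ln B)"
      using s h0 by (intro mult_left_mono) auto
    also have "\<dots> = s * (h * (2 + 2 * s)) * ln (real m) + s * (h * (2 + 2 * s)) * ln B - s * h * ln B"
      by (simp add: algebra_simps)
    finally have key: "s * h * (ln x + ln l) \<le> s * ln (real m) + s * ln B - s * h * ln B"
      unfolding hs by simp
    have "ln ((real m * B / l) powr (- s)) = - s * (ln (real m) + ln B - ln l)"
      using m0 B0 l by (simp add: ln_mult ln_div)
    also have "\<dots> \<le> s * ln l - s * h * (ln x + ln B + ln l)"
      using key by (simp add: algebra_simps)
    also have "\<dots> = ln (l powr s * (x * B * l) powr (- (s * h)))"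
      using x l B0 by (simp add: ln_mult algebra_simps)
    finally have "(real m * B / l) powr (- s) \<le> l powr s * (x * B * l) powr (- (s * h))"
      using x l B0 m0 by (subst (asm) ln_le_cancel_iff) auto
    also have "\<dots> \<le> T" unfolding T using l by (intro mult_right_mono powr_mono) auto
    finally have "(real m * B / l) powr (- s) \<le> T" .
    moreover have "(real m * (B / l / 2)) powr (- s) = 2 powr s * (real m * B / l) powr (- s)"
    proof -
      have "real m * (B / l / 2) = (real m * B / l) / 2" by simp
      then show ?thesis using m0 B0 l by (simp only: powr_divide powr_minus) (simp add: field_simps powr_minus)
    qed
    ultimately show ?thesis by simp
  qed
  \<comment> \<open>Bounding the cutoff below by one of three quantities avoids computing the two
    nested minima.\<close>
  have cases: "M \<le> cutoff s n m B \<or> Y / 2 * (B / l / 2) \<le> cutoff s n m B \<or> real m * (B / l / 2) \<le> cutoff s n m B"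
  proof -
    have "Y / 2 \<le> E \<or> real m \<le> E" using E(3) by linarith
    moreover have "y * (B / l / 2) \<le> E * b" if "y \<le> E" for y
      using that b E B0 l by (intro mult_mono) auto
    ultimately have "Y / 2 * (B / l / 2) \<le> E * b \<or> real m * (B / l / 2) \<le> E * b" by blast
    then show ?thesis unfolding K by linarith
  qed
  have T3: "T \<le> (1 + 2 powr s + 4 powr s) * T" "2 powr s * T \<le> (1 + 2 powr s + 4 powr s) * T"
      "4 powr s * T \<le> (1 + 2 powr s + 4 powr s) * T"
    using T0 by (auto simp: algebra_simps)
  have mono: "cutoff s n m B powr (- s) \<le> y powr (- s)" if "y \<le> cutoff s n m B" "y > 0" for y
    using that s by (intro powr_mono2') auto
  have pos: "M > 0" "Y / 2 * (B / l / 2) > 0" "real m * (B / l / 2) > 0"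
    using mi(1) Y1 B0 l m by auto
  show "cutoff s n m B powr (- s) \<le> (1 + 2 powr s + 4 powr s) * limited_rate s n B"
    unfolding T_def[symmetric] using cases mono pos M Yb mb T3 by (meson order_trans)
qed

lemma tendsto_log2_over_n_powr:
  assumes "e > 0"
  shows "(\<lambda>n. (log 2 (real n) / real n) powr e) \<longlonglongrightarrow> 0"
proof (rule tendsto_zero_powrI)
  have "(\<lambda>n. (ln (real n) / real n) / ln 2) \<longlonglongrightarrow> 0 / ln 2"
    by (intro tendsto_divide lim_ln_over_n tendsto_const) simp
  then show "(\<lambda>n. log 2 (real n) / real n) \<longlonglongrightarrow> 0" by (simp add: log_def field_simps)
qed (use assms in \<open>auto intro!: eventually_at_top_linorderI[of 1]\<close>)

theorem theorem2p8:
  fixes s L \<sigma> :: real and N :: nat and \<psi> :: "nat \<Rightarrow> nat \<Rightarrow> real \<Rightarrow> real"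
  assumes "s > 0" and "L > 0" and "\<sigma> > 0"
    and "cdv_wavelet_basis N \<psi>" and "real N > s"
  shows "\<exists>C>0. \<forall>(m :: nat \<Rightarrow> nat) (B :: nat \<Rightarrow> real).
    (\<forall>n\<ge>1. m n \<ge> 1 \<and> m n dvd n) \<longrightarrow>
    (\<forall>\<^sub>F n in sequentially.
      (B n \<ge> threshold s n \<longrightarrow>
         estimator s \<psi> n (m n) (B n)
           \<in> dist_estimators \<sigma> (m n) (n div m n) (\<lambda>i. B n) (besov_ball s \<psi> L) \<and>
         sup_risk \<sigma> (m n) (n div m n) (estimator s \<psi> n (m n) (B n)) (besov_ball s \<psi> L)
           \<le> ennreal (C * minimax_rate s n)) \<and>
      (max ((real n * log 2 (real n) / real (m n) powr (2 + 2 * s)) powr (1 / (1 + 2 * s)))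
           (log 2 (real n)) \<le> B n \<and> B n < threshold s n \<longrightarrow>
         estimator s \<psi> n (m n) (B n)
           \<in> dist_estimators \<sigma> (m n) (n div m n) (\<lambda>i. B n) (besov_ball s \<psi> L) \<and>
         sup_risk \<sigma> (m n) (n div m n) (estimator s \<psi> n (m n) (B n)) (besov_ball s \<psi> L)
           \<le> ennreal (C * (log_factor s n *
               (real n powr (1 / (1 + 2 * s)) /
                  (B n * log 2 (real n) powr ((3 + 4 * s) / (1 + 2 * s)))) powr (s / (2 + 2 * s)) *
               minimax_rate s n))))"
proof -
  obtain C where C: "C > 0" "\<And>j x. (\<Sum>k<2^j. \<bar>\<psi> j k x\<bar>) \<le> C * 2 powr (real j / 2)"
    using cdv_wavelet_basis_level_sum[OF assms(4)] by blast
  have onb: "orthonormal_basis_unit \<psi>" using assms(4) unfolding cdv_wavelet_basis_def by blast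
  interpret bounded_wavelets \<psi> C by unfold_locales (use onb C in auto)
  define F where "F = L * C / (1 - 2 powr (- s))"
  define \<kappa> where "\<kappa> = 7 * (F\<^sup>2 + \<sigma>\<^sup>2)"
  define A where "A = F * 2 powr s"
  define A' where "A' = 4 * C * (5 + 2 * \<kappa>)"
  \<comment> \<open>The bias factor is taken large enough for both regimes, so that one constant
    serves them.\<close>
  define C0 where "C0 = A * (1 + 2 powr s + 4 powr s) + A'"
  define D where "D = 8 * C * (F + \<sigma>)"
  have "2 powr (- s) < (1::real)" using \<open>s > 0\<close> by (simp add: powr_less_one)
  then have F0: "F > 0" unfolding F_def using \<open>L > 0\<close> C by simp
  have A: "A > 0" "A' > 0" unfolding A_def A'_def \<kappa>_def using F0 C by (auto intro!: mult_pos_pos add_pos_nonneg)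
  have C0: "C0 > 0" unfolding C0_def using A by (intro add_pos_pos mult_pos_pos) (auto intro: add_pos_pos)
  have D0: "D > 0" unfolding D_def using F0 C \<open>\<sigma> > 0\<close> by simp
  show ?thesis
  proof (intro exI[of _ C0] conjI C0 allI impI)
    fix m :: "nat \<Rightarrow> nat" and B :: "nat \<Rightarrow> real"
    assume m: "\<forall>n\<ge>1. m n \<ge> 1 \<and> m n dvd n"
    \<comment> \<open>Twice the bound \<open>3 + 4 * (F + 4 * \<sigma>)\<close> from the message
      length. This and the two limits below, one for each regime, involve neither m nor B.\<close>
    have "\<forall>\<^sub>F n in sequentially. 6 + 8 * (F + 4 * \<sigma>) \<le> log 2 (real n)"
    proof (rule eventually_sequentiallyI)
      fix n assume n: "nat \<lceil>2 powr (6 + 8 * (F + 4 * \<sigma>))\<rceil> \<le> n"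
      have "0 < 2 powr (6 + 8 * (F + 4 * \<sigma>))" by simp
      moreover have le: "2 powr (6 + 8 * (F + 4 * \<sigma>)) \<le> real n" using n by linarith
      ultimately have "0 < real n" by (rule less_le_trans)
      then show "6 + 8 * (F + 4 * \<sigma>) \<le> log 2 (real n)"
        using le by (subst le_log_iff) simp_all
    qed
    moreover have "\<forall>\<^sub>F n in sequentially. (log 2 (real n) / real n) powr (s / (1 + 2 * s)) < 1 / D"
      by (rule order_tendstoD[OF tendsto_log2_over_n_powr]) (use \<open>s > 0\<close> D0 in auto)
    moreover have "\<forall>\<^sub>F n in sequentially. (log 2 (real n) / real n) powr (s / (2 + 2 * s)) < 1 / D"
      by (rule order_tendstoD[OF tendsto_log2_over_n_powr]) (use \<open>s > 0\<close> D0 in auto)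
    moreover have "\<forall>\<^sub>F n in sequentially. n \<ge> (2::nat)" by (rule eventually_ge_at_top)
    ultimately show "\<forall>\<^sub>F n in sequentially.
      (B n \<ge> threshold s n \<longrightarrow>
         estimator s \<psi> n (m n) (B n)
           \<in> dist_estimators \<sigma> (m n) (n div m n) (\<lambda>i. B n) (besov_ball s \<psi> L) \<and>
         sup_risk \<sigma> (m n) (n div m n) (estimator s \<psi> n (m n) (B n)) (besov_ball s \<psi> L)
           \<le> ennreal (C0 * minimax_rate s n)) \<and>
      (max ((real n * log 2 (real n) / real (m n) powr (2 + 2 * s)) powr (1 / (1 + 2 * s)))
           (log 2 (real n)) \<le> B n \<and> B n < threshold s n \<longrightarrow>
         estimator s \<psi> n (m n) (B n)
           \<in> dist_estimators \<sigma> (m n) (n div m n) (\<lambda>i. B n) (besov_ball s \<psi> L) \<and>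
         sup_risk \<sigma> (m n) (n div m n) (estimator s \<psi> n (m n) (B n)) (besov_ball s \<psi> L)
           \<le> ennreal (C0 * (log_factor s n *
               (real n powr (1 / (1 + 2 * s)) /
                  (B n * log 2 (real n) powr ((3 + 4 * s) / (1 + 2 * s)))) powr (s / (2 + 2 * s)) *
               minimax_rate s n)))"
    proof eventually_elim
      case (elim n)
      then have n: "n \<ge> 2" by simp
      have mn: "m n \<ge> 1" "m n dvd n" using m n by auto
      have l1: "log 2 (real n) \<ge> 1" by (rule log2_bounds[OF n])
      have th: "threshold s n > 0" by (rule threshold_powr[OF n \<open>s > 0\<close>])
      have dist: "estimator s \<psi> n (m n) (B n) \<in> dist_estimators \<sigma> (m n) (n div m n) (\<lambda>i. B n) (besov_ball s \<psi> L)"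
        if B: "B n \<ge> 0"
      proof (rule estimator_in_dist_estimators[where a="pad_length n", OF psi_measurable])
        fix f i assume f: "f \<in> besov_ball s \<psi> L" and i: "i \<in> {1..m n}"
        have fm: "f \<in> borel_measurable borel" using f by (simp add: besov_ball_def l2_unit_iff)
        have fF: "AE t in unit_measure. \<bar>f t\<bar> \<le> F"
          unfolding F_def by (rule besov_function_bound[OF f \<open>L > 0\<close> \<open>s > 0\<close>])
        show "(\<integral>\<^sup>+ d. of_nat (length (message (pad_length n) s \<psi> n (m n) (B n) i (d i)))
            \<partial>data_law \<sigma> (m n) (n div m n) f) \<le> ennreal (B n)"
          using F0 \<open>\<sigma> > 0\<close> elim(1)
          by (intro expected_message_length_le[OF fm fF _ _ i n mn(2) B]) auto
      qed
      \<comment> \<open>T stands for the rate of either regime; each then only has to bound the bias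
        and the sampling error by T.\<close>
      have risk: "sup_risk \<sigma> (m n) (n div m n) (estimator s \<psi> n (m n) (B n)) (besov_ball s \<psi> L) \<le> ennreal (C0 * T)"
        if b: "block_size n (B n) \<ge> 1" and K: "1 \<le> cutoff s n (m n) (B n)" "cutoff s n (m n) (B n) \<le> real n"
          and small: "D * sampling_error s n (m n) (B n) \<le> 1"
          and T: "cutoff s n (m n) (B n) powr (- s) \<le> (1 + 2 powr s + 4 powr s) * T"
            "sampling_error s n (m n) (B n) \<le> T" for T
      proof -
        have "sup_risk \<sigma> (m n) (n div m n) (estimator s \<psi> n (m n) (B n)) (besov_ball s \<psi> L)
          \<le> ennreal (A * cutoff s n (m n) (B n) powr (- s) + A' * sampling_error s n (m n) (B n))"
          using sup_risk_le[OF \<open>s > 0\<close> \<open>L > 0\<close> \<open>\<sigma> > 0\<close> n mn b K small[unfolded D_def F_def sampling_error_def]]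
          unfolding A_def A'_def \<kappa>_def F_def sampling_error_def .
        also have "\<dots> \<le> ennreal (C0 * T)"
        proof (rule ennreal_leI)
          have "A * cutoff s n (m n) (B n) powr (- s) \<le> A * ((1 + 2 powr s + 4 powr s) * T)"
            using A T by (intro mult_left_mono) auto
          moreover have "A' * sampling_error s n (m n) (B n) \<le> A' * T" using A T by (intro mult_left_mono) auto
          ultimately show "A * cutoff s n (m n) (B n) powr (- s) + A' * sampling_error s n (m n) (B n) \<le> C0 * T"
            unfolding C0_def by (simp add: algebra_simps)
        qed
        finally show ?thesis .
      qed
      show ?case
      proof (intro conjI impI)
        assume B: "B n \<ge> threshold s n"
        then show "estimator s \<psi> n (m n) (B n) \<in> dist_estimators \<sigma> (m n) (n div m n) (\<lambda>i. B n) (besov_ball s \<psi> L)"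
          using th by (intro dist) simp
        note r = large_budget_rates[OF n \<open>s > 0\<close> mn(1) B]
        have r0: "minimax_rate s n > 0" by (rule max_index_bounds(5)[OF n \<open>s > 0\<close>])
        have "minimax_rate s n = (log 2 (real n) / real n) powr (s / (1 + 2 * s))"
        proof -
          have "minimax_rate s n = inverse ((real n / log 2 (real n)) powr (s / (1 + 2 * s)))"
            by (simp add: minimax_rate_def powr_minus)
          also have "\<dots> = (log 2 (real n) / real n) powr (s / (1 + 2 * s))"
            using l1 n by (simp add: powr_divide)
          finally show ?thesis .
        qed
        then have "sampling_error s n (m n) (B n) \<le> 1 / D" using r(5) elim(2) by linarith
        then have small: "D * sampling_error s n (m n) (B n) \<le> 1" using D0 by (simp add: field_simps)
        have "2 powr s * minimax_rate s n \<le> (1 + 2 powr s + 4 powr s) * minimax_rate s n"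
          using r0 by (intro mult_right_mono) (auto simp: add_nonneg_nonneg)
        with r(4) have "cutoff s n (m n) (B n) powr (- s) \<le> (1 + 2 powr s + 4 powr s) * minimax_rate s n" by linarith
        then show "sup_risk \<sigma> (m n) (n div m n) (estimator s \<psi> n (m n) (B n)) (besov_ball s \<psi> L)
           \<le> ennreal (C0 * minimax_rate s n)"
          by (rule risk[OF r(1-3) small _ r(5)])
      next
        assume B: "max ((real n * log 2 (real n) / real (m n) powr (2 + 2 * s)) powr (1 / (1 + 2 * s)))
           (log 2 (real n)) \<le> B n \<and> B n < threshold s n"
        then have "B n \<ge> 0" using l1 by simp
        then show "estimator s \<psi> n (m n) (B n) \<in> dist_estimators \<sigma> (m n) (n div m n) (\<lambda>i. B n) (besov_ball s \<psi> L)"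
          by (rule dist)
        note r = small_budget_rates[OF n \<open>s > 0\<close> mn(1) B[THEN conjunct1] B[THEN conjunct2]]
        have "sampling_error s n (m n) (B n) \<le> 1 / D" using r(6) elim(3) by linarith
        then have small: "D * sampling_error s n (m n) (B n) \<le> 1" using D0 by (simp add: field_simps)
        show "sup_risk \<sigma> (m n) (n div m n) (estimator s \<psi> n (m n) (B n)) (besov_ball s \<psi> L)
           \<le> ennreal (C0 * (log_factor s n *
               (real n powr (1 / (1 + 2 * s)) /
                  (B n * log 2 (real n) powr ((3 + 4 * s) / (1 + 2 * s)))) powr (s / (2 + 2 * s)) *
               minimax_rate s n))"
          unfolding limited_rate_def[symmetric] by (rule risk[OF r(1-3) small r(4,5)])
      qed
    qed
  qed
qed

end
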